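(* Let $(R,\mathfrak m,k)$ be a commutative artinian local ring which is not a field, let $E=E_R$ be the injective envelope of $k$, and let $E^*=\operatorname{Hom}_R(E,R)$. The following statements hold: (a) If $R$ is not Gorenstein, then $\mathfrak m^2=0$ if and only if $R$ is nearly Gorenstein and the equality $\mathfrak m E^*=0$ holds. (b) Assume that $\mathfrak m E^*=0$. If $R\cong S/I$, where $(S,\mathfrak n,k)$ is an artinian Gorenstein local ring and $I$ is an ideal of $S$, then $\mathfrak n(0:_SI)\subseteq I$. (c) Assume that $R$ is the fiber product $S\times_k T$ of non-Gorenstein artinian local rings $(S,\mathfrak m_S,k)$ and $(T,\mathfrak m_T,k)$ along $k$. Then $E_R^*$ is annihilated by $\mathfrak m$ if and only if $E_S^*$ and $E_T^*$ are annihilated by $\mathfrak m_S$ and $\mathfrak m_T$, respectively.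
   Context: For an $R$-module $M$, the trace of $M$ is $\operatorname{tr}_R(M)=\sum_{f\in \operatorname{Hom}_R(M,R)}\operatorname{Im}(f)$. A Cohen-Macaulay local ring $R$ with canonical module $\omega_R$ is nearly Gorenstein if $\mathfrak m\subseteq\operatorname{tr}_R(\omega_R)$; when $R$ is artinian, $\omega_R=E_R$. For local rings $(S,\mathfrak m_S,k)$ and $(T,\mathfrak m_T,k)$ with natural surjections $\pi_S:S\to k$ and $\pi_T:T\to k$, the fiber product is $S\times_kT=\{(s,t)\in S\times T:\pi_S(s)=\pi_T(t)\}$, a local ring with maximal ideal $\mathfrak m_S\oplus\mathfrak m_T$. Here $E_S$, $E_T$ are the injective envelopes of $k$ over $S$, $T$, and $E_R^*=\operatorname{Hom}_R(E_R,R)$, $E_S^*=\operatorname{Hom}_S(E_S,S)$, $E_T^*=\operatorname{Hom}_T(E_T,T)$. *)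

theory Defs
  imports "HOL-Algebra.Algebra"
begin

section \<open>Artinian local rings\<close>

locale local_ring = cring +
  assumes ex1_maximalideal: "\<exists>!\<mm>. maximalideal \<mm> R"

definition max_ideal :: "('a, 'x) ring_scheme \<Rightarrow> 'a set" where
  "max_ideal R = (THE \<mm>. maximalideal \<mm> R)"

locale artinian_ring = cring +
  assumes descending_chain:
    "\<lbrakk>\<And>n::nat. ideal (J n) R; \<And>n. J (Suc n) \<subseteq> J n\<rbrakk> \<Longrightarrow> \<exists>N. \<forall>n\<ge>N. J n = J N"

locale artinian_local_ring = artinian_ring + local_ring

definition colon_ideal :: "('a, 'x) ring_scheme \<Rightarrow> 'a set \<Rightarrow> 'a set \<Rightarrow> 'a set" where
  "colon_ideal R J I = {r \<in> carrier R. \<forall>x\<in>I. r \<otimes>\<^bsub>R\<^esub> x \<in> J}"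

definition fiber_product ::
  "('s, 'x) ring_scheme \<Rightarrow> ('t, 'y) ring_scheme \<Rightarrow> ('s \<Rightarrow> 'k) \<Rightarrow> ('t \<Rightarrow> 'k) \<Rightarrow> ('s \<times> 't) ring"
  where
  "fiber_product S T \<pi>S \<pi>T =
     (RDirProd S T)\<lparr>carrier := {(s, t) \<in> carrier S \<times> carrier T. \<pi>S s = \<pi>T t}\<rparr>"


section \<open>Modules and homomorphisms\<close>

text \<open>The fields \<open>mult\<close> and \<open>one\<close> of a module record carry no meaning.\<close>

definition module_along :: "('a \<Rightarrow> 'b) \<Rightarrow> ('b, 'y) ring_scheme \<Rightarrow> ('a, 'b) module" where
  "module_along h A =
     \<lparr>carrier = carrier A, monoid.mult = monoid.mult A, one = one A,
      ring.zero = ring.zero A, ring.add = ring.add A,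
      smult = (\<lambda>r x. h r \<otimes>\<^bsub>A\<^esub> x)\<rparr>"

definition self_module :: "('a, 'x) ring_scheme \<Rightarrow> ('a, 'a) module" where
  "self_module R = module_along (\<lambda>r. r) R"

definition residue_module :: "('a, 'x) ring_scheme \<Rightarrow> ('a, 'a set) module" where
  "residue_module R =
     module_along (\<lambda>r. max_ideal R +>\<^bsub>R\<^esub> r) (R Quot max_ideal R)"

text \<open>Homomorphisms are extensional functions, so that \<open>Hom_module\<close> below is a module.\<close>

definition mod_hom ::
  "('a, 'x) ring_scheme \<Rightarrow> ('a, 'm, 'y) module_scheme \<Rightarrow> ('a, 'n, 'z) module_scheme \<Rightarrow> ('m \<Rightarrow> 'n) set"
  where
  "mod_hom R M N =
     {f \<in> carrier M \<rightarrow>\<^sub>E carrier N.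
        (\<forall>x\<in>carrier M. \<forall>y\<in>carrier M. f (x \<oplus>\<^bsub>M\<^esub> y) = f x \<oplus>\<^bsub>N\<^esub> f y) \<and>
        (\<forall>r\<in>carrier R. \<forall>x\<in>carrier M. f (r \<odot>\<^bsub>M\<^esub> x) = r \<odot>\<^bsub>N\<^esub> f x)}"

definition Hom_module ::
  "('a, 'x) ring_scheme \<Rightarrow> ('a, 'm, 'y) module_scheme \<Rightarrow> ('a, 'n, 'z) module_scheme
     \<Rightarrow> ('a, 'm \<Rightarrow> 'n) module"
  where
  "Hom_module R M N =
     \<lparr>carrier = mod_hom R M N,
      monoid.mult = undefined,
      one = undefined,
      ring.zero = (\<lambda>x\<in>carrier M. \<zero>\<^bsub>N\<^esub>),
      ring.add = (\<lambda>f g. \<lambda>x\<in>carrier M. f x \<oplus>\<^bsub>N\<^esub> g x),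
      smult = (\<lambda>r f. \<lambda>x\<in>carrier M. r \<odot>\<^bsub>N\<^esub> f x)\<rparr>"

definition dual_module ::
  "('a, 'x) ring_scheme \<Rightarrow> ('a, 'm, 'y) module_scheme \<Rightarrow> ('a, 'm \<Rightarrow> 'a) module" where
  "dual_module R M = Hom_module R M (self_module R)"

text \<open>The submodule \<open>IM\<close> of \<open>M\<close>, in the style of \<^const>\<open>ideal_prod\<close>.\<close>

inductive_set ideal_smult ::
  "('a, 'x) ring_scheme \<Rightarrow> 'a set \<Rightarrow> ('a, 'm, 'y) module_scheme \<Rightarrow> 'm set"
  for R and I and M
  where
    smult: "\<lbrakk>r \<in> I; x \<in> carrier M\<rbrakk> \<Longrightarrow> r \<odot>\<^bsub>M\<^esub> x \<in> ideal_smult R I M"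
  | sum: "\<lbrakk>x \<in> ideal_smult R I M; y \<in> ideal_smult R I M\<rbrakk> \<Longrightarrow> x \<oplus>\<^bsub>M\<^esub> y \<in> ideal_smult R I M"

definition annihilated_by :: "('a, 'm, 'y) module_scheme \<Rightarrow> 'a set \<Rightarrow> bool" where
  "annihilated_by M I \<longleftrightarrow> (\<forall>r\<in>I. \<forall>x\<in>carrier M. r \<odot>\<^bsub>M\<^esub> x = \<zero>\<^bsub>M\<^esub>)"

text \<open>A sum of submodules of \<open>R\<close> is the ideal generated by their union.\<close>

definition trace_ideal ::
  "('a, 'x) ring_scheme \<Rightarrow> ('a, 'm, 'y) module_scheme \<Rightarrow> 'a set" where
  "trace_ideal R M = genideal R (\<Union>f\<in>mod_hom R M (self_module R). f ` carrier M)"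


lemma module_along_module:
  assumes R: "cring R" and A: "cring A" and h: "h \<in> ring_hom R A"
  shows "module R (module_along h A)"
proof -
  interpret R: cring R by fact
  interpret A: cring A by fact
  have *: "h r \<in> carrier A" if "r \<in> carrier R" for r using h that by (simp add: ring_hom_closed)
  have ag: "abelian_group (module_along h A)"
  proof (rule abelian_groupI, goal_cases)
    case (6 x)
    then show ?case
      by (intro bexI[of _ "\<ominus>\<^bsub>A\<^esub> x"]) (auto simp: module_along_def A.l_neg)
  qed (auto simp: module_along_def A.a_ac)
  show ?thesis
    by (rule moduleI[OF R ag])
      (use h in \<open>auto simp: module_along_def * A.m_assoc A.l_distr A.r_distr ring_hom_add ring_hom_mult ring_hom_one\<close>)
qed

lemma self_module_module: "cring R \<Longrightarrow> module R (self_module R)"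
  unfolding self_module_def
  by (rule module_along_module) (auto intro!: ring_hom_memI simp: cring_def ring.ring_simprules cring.cring_simprules)

lemma (in local_ring) max_ideal: "maximalideal (max_ideal R) R"
  unfolding max_ideal_def by (rule theI'[OF ex1_maximalideal])

lemma (in local_ring) residue_module_module: "module R (residue_module R)"
proof -
  interpret m: maximalideal "max_ideal R" R by (rule max_ideal)
  show ?thesis unfolding residue_module_def
    by (rule module_along_module[OF is_cring m.quotient_is_cring[OF is_cring] m.rcos_ring_hom])
qed

lemma Hom_module_module:
  assumes "module R M" "module R N"
  shows "module R (Hom_module R M N)"
proof -
  interpret M: module R M by fact
  interpret N: module R N by fact
  show ?thesis
  proof (rule moduleI[OF M.is_cring])
    show "abelian_group (Hom_module R M N)"
    proof (rule abelian_groupI, goal_cases)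
      case (6 f)
      have "(\<lambda>x\<in>carrier M. \<ominus>\<^bsub>N\<^esub> f x) \<in> mod_hom R M N"
        using 6 by (auto simp: Hom_module_def mod_hom_def PiE_iff N.minus_add N.smult_r_minus)
      then show ?case using 6
        by (intro bexI[of _ "\<lambda>x\<in>carrier M. \<ominus>\<^bsub>N\<^esub> f x"])
          (auto simp: Hom_module_def mod_hom_def PiE_iff N.l_neg intro!: restrict_ext)
    qed (auto simp: Hom_module_def mod_hom_def PiE_iff N.a_ac N.smult_r_distr fun_eq_iff restrict_def extensional_def)
  qed (auto simp: Hom_module_def mod_hom_def PiE_iff N.smult_r_distr N.smult_l_distr N.smult_assoc1[symmetric] N.a_ac M.m_comm fun_eq_iff restrict_def extensional_def M.smult_assoc1[symmetric])
qed

lemma fiber_product_cring: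
  assumes "cring S" "cring T" "cring k" "f \<in> ring_hom S k" "g \<in> ring_hom T k"
  shows "cring (fiber_product S T f g)"
proof -
  interpret S: cring S by fact
  interpret T: cring T by fact
  interpret k: cring k by fact
  interpret f: ring_hom_cring S k f by unfold_locales fact
  interpret g: ring_hom_cring T k g by unfold_locales fact
  note d = fiber_product_def RDirProd_def DirProd_def monoid.defs
  show ?thesis
  proof (rule cringI)
    show "abelian_group (fiber_product S T f g)"
    proof (rule abelian_groupI, goal_cases)
      case (6 x)
      then show ?case
        by (intro bexI[of _ "(\<ominus>\<^bsub>S\<^esub> fst x, \<ominus>\<^bsub>T\<^esub> snd x)"]) (auto simp: d S.l_neg T.l_neg)
    qed (auto simp: d S.a_ac T.a_ac)
    show "Group.comm_monoid (fiber_product S T f g)"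
      by (rule comm_monoidI) (auto simp: d S.m_ac T.m_ac)
  qed (auto simp: d S.l_distr T.l_distr)
qed


section \<open>Injective modules and injective envelopes\<close>

text \<open>
  A definition cannot quantify over all carrier types, so the test modules \<open>M\<close> and \<open>N\<close> have
  carriers in the element type of \<open>R\<close>. This is no restriction: by Baer's criterion, lifting along
  inclusions of ideals into \<open>R\<close> already gives lifting along injective homomorphisms over any
  carrier types; this is \<open>injective_module_lift\<close> below.
\<close>

definition injective_module ::
  "('a, 'x) ring_scheme \<Rightarrow> ('a, 'm, 'y) module_scheme \<Rightarrow> bool" where
  "injective_module R Q \<longleftrightarrow> module R Q \<and>
     (\<forall>(M :: ('a, 'a) module) (N :: ('a, 'a) module) i f.
        module R M \<and> module R N \<and> i \<in> mod_hom R M N \<and> inj_on i (carrier M) \<and>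
        f \<in> mod_hom R M Q \<longrightarrow>
        (\<exists>g\<in>mod_hom R N Q. \<forall>x\<in>carrier M. g (i x) = f x))"

lemma injective_module_lift_ideal:
  assumes R: "cring R" and Q: "injective_module R Q" and J: "ideal J R"
    and fc: "\<And>r. r \<in> J \<Longrightarrow> f r \<in> carrier Q"
    and fa: "\<And>r s. r \<in> J \<Longrightarrow> s \<in> J \<Longrightarrow> f (r \<oplus>\<^bsub>R\<^esub> s) = f r \<oplus>\<^bsub>Q\<^esub> f s"
    and fs: "\<And>r s. r \<in> carrier R \<Longrightarrow> s \<in> J \<Longrightarrow> f (r \<otimes>\<^bsub>R\<^esub> s) = r \<odot>\<^bsub>Q\<^esub> f s"
  shows "\<exists>q\<in>carrier Q. \<forall>r\<in>J. f r = r \<odot>\<^bsub>Q\<^esub> q"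
proof -
  interpret R: cring R by fact
  interpret J: ideal J R by fact
  define JM where "JM = (self_module R)\<lparr>carrier := J\<rparr>"
  note d = JM_def self_module_def module_along_def
  have JR: "r \<in> carrier R" if "r \<in> J" for r using that by (rule J.Icarr)
  have "abelian_group JM"
  proof (rule abelian_groupI, goal_cases)
    case (6 x)
    then show ?case by (intro bexI[of _ "\<ominus>\<^bsub>R\<^esub> x"]) (auto simp: d R.l_neg JR)
  qed (auto simp: d R.a_ac JR)
  then have JM: "module R JM"
    by (intro moduleI R) (auto simp: d R.l_distr R.r_distr R.m_assoc JR J.I_l_closed)
  have "(\<lambda>x\<in>J. x) \<in> mod_hom R JM (self_module R)" "(\<lambda>x\<in>J. f x) \<in> mod_hom R JM Q"
    by (auto simp: mod_hom_def d JR J.I_l_closed fc fa fs)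
  moreover have "inj_on (\<lambda>x\<in>J. x) (carrier JM)" by (auto simp: d inj_on_def)
  ultimately obtain g where g: "g \<in> mod_hom R (self_module R) Q"
      "\<forall>x\<in>carrier JM. g ((\<lambda>x\<in>J. x) x) = (\<lambda>x\<in>J. f x) x"
    using Q JM self_module_module[OF R] unfolding injective_module_def by meson
  have "f r = r \<odot>\<^bsub>Q\<^esub> g \<one>\<^bsub>R\<^esub>" if "r \<in> J" for r
  proof -
    have "f r = g r" using g(2) that by (auto simp: d)
    also have "\<dots> = g (r \<odot>\<^bsub>self_module R\<^esub> \<one>\<^bsub>R\<^esub>)" by (simp add: d JR that)
    also have "\<dots> = r \<odot>\<^bsub>Q\<^esub> g \<one>\<^bsub>R\<^esub>"
      using g(1) JR[OF that] R.one_closed unfolding mod_hom_def by (simp add: d del: R.r_one)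
    finally show ?thesis .
  qed
  moreover have "g \<one>\<^bsub>R\<^esub> \<in> carrier Q" using g(1) by (auto simp: mod_hom_def d)
  ultimately show ?thesis by blast
qed

theorem injective_module_lift:
  fixes M :: "('a, 'm, 'y) module_scheme" and N :: "('a, 'n, 'z) module_scheme"
  assumes Q: "injective_module R Q" and M: "module R M" and N: "module R N"
    and i: "i \<in> mod_hom R M N" "inj_on i (carrier M)" and f: "f \<in> mod_hom R M Q"
  shows "\<exists>g\<in>mod_hom R N Q. \<forall>x\<in>carrier M. g (i x) = f x"
proof -
  interpret M: module R M by fact
  interpret N: module R N by fact
  interpret Q: module R Q using Q by (simp add: injective_module_def)
  have ih: "i x \<in> carrier N" "f x \<in> carrier Q" if "x \<in> carrier M" for x
    using that i f by (auto simp: mod_hom_def)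
  have ia: "i (x \<oplus>\<^bsub>M\<^esub> y) = i x \<oplus>\<^bsub>N\<^esub> i y" "f (x \<oplus>\<^bsub>M\<^esub> y) = f x \<oplus>\<^bsub>Q\<^esub> f y"
    if "x \<in> carrier M" "y \<in> carrier M" for x y
    using that i f by (auto simp: mod_hom_def)
  have iS: "i (r \<odot>\<^bsub>M\<^esub> y) = r \<odot>\<^bsub>N\<^esub> i y" "f (r \<odot>\<^bsub>M\<^esub> y) = r \<odot>\<^bsub>Q\<^esub> f y"
    if "r \<in> carrier R" "y \<in> carrier M" for r y
    using that i f by (auto simp: mod_hom_def)
  have i0: "i \<zero>\<^bsub>M\<^esub> = \<zero>\<^bsub>N\<^esub>" "f \<zero>\<^bsub>M\<^esub> = \<zero>\<^bsub>Q\<^esub>"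
    using iS[of "\<zero>\<^bsub>R\<^esub>" "\<zero>\<^bsub>M\<^esub>"] ih[of "\<zero>\<^bsub>M\<^esub>"] by auto
  define lin where "lin G \<longleftrightarrow> G \<subseteq> carrier N \<times> carrier Q \<and> (\<lambda>x. (i x, f x)) ` carrier M \<subseteq> G \<and>
      (\<forall>a b c d. (a, b) \<in> G \<and> (c, d) \<in> G \<longrightarrow> (a \<oplus>\<^bsub>N\<^esub> c, b \<oplus>\<^bsub>Q\<^esub> d) \<in> G) \<and>
      (\<forall>r a b. r \<in> carrier R \<and> (a, b) \<in> G \<longrightarrow> (r \<odot>\<^bsub>N\<^esub> a, r \<odot>\<^bsub>Q\<^esub> b) \<in> G) \<and>
      (\<forall>b. (\<zero>\<^bsub>N\<^esub>, b) \<in> G \<longrightarrow> b = \<zero>\<^bsub>Q\<^esub>)" for G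
  have lin0: "lin ((\<lambda>x. (i x, f x)) ` carrier M)"
    unfolding lin_def
  proof (intro conjI allI impI)
    fix b assume "(\<zero>\<^bsub>N\<^esub>, b) \<in> (\<lambda>x. (i x, f x)) ` carrier M"
    then obtain x where x: "x \<in> carrier M" "i x = \<zero>\<^bsub>N\<^esub>" "b = f x" by auto
    then have "x = \<zero>\<^bsub>M\<^esub>" using i(2) i0 by (metis inj_onD M.M.zero_closed)
    then show "b = \<zero>\<^bsub>Q\<^esub>" using x i0 by simp
  next
    fix a b c d assume "(a, b) \<in> (\<lambda>x. (i x, f x)) ` carrier M \<and> (c, d) \<in> (\<lambda>x. (i x, f x)) ` carrier M"
    then obtain x y where "x \<in> carrier M" "y \<in> carrier M" "a = i x" "b = f x" "c = i y" "d = f y" by auto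
    then show "(a \<oplus>\<^bsub>N\<^esub> c, b \<oplus>\<^bsub>Q\<^esub> d) \<in> (\<lambda>x. (i x, f x)) ` carrier M"
      by (intro image_eqI[of _ _ "x \<oplus>\<^bsub>M\<^esub> y"]) (auto simp: ia)
  next
    fix r a b assume "r \<in> carrier R \<and> (a, b) \<in> (\<lambda>x. (i x, f x)) ` carrier M"
    then obtain x where "r \<in> carrier R" "x \<in> carrier M" "a = i x" "b = f x" by auto
    then show "(r \<odot>\<^bsub>N\<^esub> a, r \<odot>\<^bsub>Q\<^esub> b) \<in> (\<lambda>x. (i x, f x)) ` carrier M"
      by (intro image_eqI[of _ _ "r \<odot>\<^bsub>M\<^esub> x"]) (auto simp: iS)
  qed (auto simp: ih)
  have "\<exists>G\<in>Collect lin. \<forall>V\<in>Collect lin. G \<subseteq> V \<longrightarrow> V = G"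
  proof (rule subset_Zorn_nonempty)
    fix C assume ne: "C \<noteq> {}" and C: "subset.chain (Collect lin) C"
    have L: "lin V" if "V \<in> C" for V using C that by (auto simp: subset_chain_def)
    have "lin (\<Union>C)"
      unfolding lin_def
    proof (intro conjI allI impI)
      show "\<Union>C \<subseteq> carrier N \<times> carrier Q"
        using L unfolding lin_def by (intro Union_least) blast
      show "(\<lambda>x. (i x, f x)) ` carrier M \<subseteq> \<Union>C"
        using ne L unfolding lin_def by blast
      fix a b c d assume "(a, b) \<in> \<Union>C \<and> (c, d) \<in> \<Union>C"
      then obtain V Y where XY: "V \<in> C" "Y \<in> C" "(a, b) \<in> V" "(c, d) \<in> Y" by auto
      then have "V \<subseteq> Y \<or> Y \<subseteq> V" using C by (auto simp: subset_chain_def)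
      then obtain Z where Z: "Z \<in> C" "(a, b) \<in> Z" "(c, d) \<in> Z" using XY by blast
      then have "(a \<oplus>\<^bsub>N\<^esub> c, b \<oplus>\<^bsub>Q\<^esub> d) \<in> Z" using L[OF Z(1)] by (auto simp: lin_def)
      then show "(a \<oplus>\<^bsub>N\<^esub> c, b \<oplus>\<^bsub>Q\<^esub> d) \<in> \<Union>C" using Z by blast
    next
      fix r a b assume "r \<in> carrier R \<and> (a, b) \<in> \<Union>C"
      then show "(r \<odot>\<^bsub>N\<^esub> a, r \<odot>\<^bsub>Q\<^esub> b) \<in> \<Union>C" using L unfolding lin_def by blast
    next
      fix b assume "(\<zero>\<^bsub>N\<^esub>, b) \<in> \<Union>C"
      then show "b = \<zero>\<^bsub>Q\<^esub>" using L unfolding lin_def by blast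
    qed
    then show "\<Union>C \<in> Collect lin" by simp
  qed (use lin0 in auto)
  then obtain G where G: "lin G" and max: "\<And>V. lin V \<Longrightarrow> G \<subseteq> V \<Longrightarrow> V = G" by auto
  have Gc: "a \<in> carrier N" "b \<in> carrier Q" if "(a, b) \<in> G" for a b using G that by (auto simp: lin_def)
  have Gi: "(i x, f x) \<in> G" if "x \<in> carrier M" for x using G that by (auto simp: lin_def)
  have Ga: "(a \<oplus>\<^bsub>N\<^esub> c, b \<oplus>\<^bsub>Q\<^esub> d) \<in> G" if "(a, b) \<in> G" "(c, d) \<in> G" for a b c d
    using G that by (auto simp: lin_def)
  have Gs: "(r \<odot>\<^bsub>N\<^esub> a, r \<odot>\<^bsub>Q\<^esub> b) \<in> G" if "r \<in> carrier R" "(a, b) \<in> G" for r a b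
    using G that by (auto simp: lin_def)
  have G0: "b = \<zero>\<^bsub>Q\<^esub>" if "(\<zero>\<^bsub>N\<^esub>, b) \<in> G" for b using G that by (auto simp: lin_def)
  have Gm: "(\<ominus>\<^bsub>N\<^esub> a, \<ominus>\<^bsub>Q\<^esub> b) \<in> G" if "(a, b) \<in> G" for a b
    using Gs[of "\<ominus>\<^bsub>R\<^esub> \<one>\<^bsub>R\<^esub>" a b] that Gc[OF that] by (simp add: N.smult_l_minus Q.smult_l_minus)
  have Gu: "b = c" if "(a, b) \<in> G" "(a, c) \<in> G" for a b c
  proof -
    have "(\<zero>\<^bsub>N\<^esub>, b \<oplus>\<^bsub>Q\<^esub> \<ominus>\<^bsub>Q\<^esub> c) \<in> G" using Ga[OF that(1) Gm[OF that(2)]] Gc[OF that(1)] by (simp add: N.M.r_neg)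
    then have "b \<oplus>\<^bsub>Q\<^esub> \<ominus>\<^bsub>Q\<^esub> c = \<zero>\<^bsub>Q\<^esub>" by (rule G0)
    then show ?thesis using Gc that by (metis Q.M.minus_equality Q.M.a_inv_closed Q.M.minus_minus)
  qed
  have Gz: "(\<zero>\<^bsub>N\<^esub>, \<zero>\<^bsub>Q\<^esub>) \<in> G" using Gi[of "\<zero>\<^bsub>M\<^esub>"] i0 by simp
  have tot: "n \<in> Domain G" if n: "n \<in> carrier N" for n
  proof -
    define J where "J = {r \<in> carrier R. r \<odot>\<^bsub>N\<^esub> n \<in> Domain G}"
    define \<phi> where "\<phi> r = (THE q. (r \<odot>\<^bsub>N\<^esub> n, q) \<in> G)" for r
    have \<phi>: "\<phi> r = q" if "(r \<odot>\<^bsub>N\<^esub> n, q) \<in> G" for r q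
      unfolding \<phi>_def using that Gu by blast
    have \<phi>G: "(r \<odot>\<^bsub>N\<^esub> n, \<phi> r) \<in> G" "r \<in> carrier R" if "r \<in> J" for r
      using that \<phi> by (auto simp: J_def)
    have add: "((r \<oplus>\<^bsub>R\<^esub> s) \<odot>\<^bsub>N\<^esub> n, \<phi> r \<oplus>\<^bsub>Q\<^esub> \<phi> s) \<in> G" if "r \<in> J" "s \<in> J" for r s
      using Ga[OF \<phi>G(1)[OF that(1)] \<phi>G(1)[OF that(2)]] \<phi>G(2) that n by (simp add: N.smult_l_distr)
    have mul: "((r \<otimes>\<^bsub>R\<^esub> s) \<odot>\<^bsub>N\<^esub> n, r \<odot>\<^bsub>Q\<^esub> \<phi> s) \<in> G" if "r \<in> carrier R" "s \<in> J" for r s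
      using Gs[OF that(1) \<phi>G(1)[OF that(2)]] \<phi>G(2) that n by (simp add: N.smult_assoc1)
    have J: "ideal J R"
    proof (rule idealI[OF cring.axioms(1)[OF M.is_cring]])
      show "subgroup J (add_monoid R)"
      proof
        show "J \<subseteq> carrier (add_monoid R)" by (auto simp: J_def)
        show "\<one>\<^bsub>add_monoid R\<^esub> \<in> J" using Gz n by (auto simp: J_def)
        show "x \<otimes>\<^bsub>add_monoid R\<^esub> y \<in> J" if "x \<in> J" "y \<in> J" for x y
          using add[OF that] \<phi>G(2) that by (auto simp: J_def)
        show "inv\<^bsub>add_monoid R\<^esub> x \<in> J" if "x \<in> J" for x
        proof -
          have "(\<ominus>\<^bsub>R\<^esub> x) \<odot>\<^bsub>N\<^esub> n = \<ominus>\<^bsub>N\<^esub> (x \<odot>\<^bsub>N\<^esub> n)" using \<phi>G(2)[OF that] n by (simp add: N.smult_l_minus)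
          then have "\<ominus>\<^bsub>R\<^esub> x \<in> J" using Gm[OF \<phi>G(1)[OF that]] \<phi>G(2)[OF that] by (auto simp: J_def)
          then show ?thesis by (simp add: a_inv_def)
        qed
      qed
      show "x \<otimes>\<^bsub>R\<^esub> a \<in> J" if "a \<in> J" "x \<in> carrier R" for a x
        using mul[OF that(2,1)] \<phi>G(2) that by (auto simp: J_def)
      then show "a \<otimes>\<^bsub>R\<^esub> x \<in> J" if "a \<in> J" "x \<in> carrier R" for a x
        using that \<phi>G(2) by (metis M.m_comm)
    qed
    obtain q where q: "q \<in> carrier Q" "\<And>r. r \<in> J \<Longrightarrow> \<phi> r = r \<odot>\<^bsub>Q\<^esub> q"
      using injective_module_lift_ideal[OF M.is_cring Q J, of \<phi>] \<phi>[OF add] \<phi>[OF mul] Gc(2)[OF \<phi>G(1)]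
      by blast
    define H where "H = {(a \<oplus>\<^bsub>N\<^esub> r \<odot>\<^bsub>N\<^esub> n, b \<oplus>\<^bsub>Q\<^esub> r \<odot>\<^bsub>Q\<^esub> q) | a b r. (a, b) \<in> G \<and> r \<in> carrier R}"
    have HI: "(a \<oplus>\<^bsub>N\<^esub> r \<odot>\<^bsub>N\<^esub> n, b \<oplus>\<^bsub>Q\<^esub> r \<odot>\<^bsub>Q\<^esub> q) \<in> H" if "(a, b) \<in> G" "r \<in> carrier R" for a b r
      using that unfolding H_def by blast
    have GH: "G \<subseteq> H"
    proof
      fix p assume p: "p \<in> G"
      obtain a b where [simp]: "p = (a, b)" by (cases p)
      show "p \<in> H" using HI[of a b "\<zero>\<^bsub>R\<^esub>"] p Gc[of a b] n q by simp
    qed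
    have "lin H"
      unfolding lin_def
    proof (intro conjI allI impI)
      show "H \<subseteq> carrier N \<times> carrier Q" using n q Gc by (auto simp: H_def)
      show "(\<lambda>x. (i x, f x)) ` carrier M \<subseteq> H" using GH Gi by auto
    next
      fix a b c d assume "(a, b) \<in> H \<and> (c, d) \<in> H"
      then obtain a' b' c' d' r s where *: "(a', b') \<in> G" "(c', d') \<in> G" "r \<in> carrier R" "s \<in> carrier R"
        "a = a' \<oplus>\<^bsub>N\<^esub> r \<odot>\<^bsub>N\<^esub> n" "b = b' \<oplus>\<^bsub>Q\<^esub> r \<odot>\<^bsub>Q\<^esub> q"
        "c = c' \<oplus>\<^bsub>N\<^esub> s \<odot>\<^bsub>N\<^esub> n" "d = d' \<oplus>\<^bsub>Q\<^esub> s \<odot>\<^bsub>Q\<^esub> q" unfolding H_def by blast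
      have "a \<oplus>\<^bsub>N\<^esub> c = (a' \<oplus>\<^bsub>N\<^esub> c') \<oplus>\<^bsub>N\<^esub> (r \<oplus>\<^bsub>R\<^esub> s) \<odot>\<^bsub>N\<^esub> n"
        "b \<oplus>\<^bsub>Q\<^esub> d = (b' \<oplus>\<^bsub>Q\<^esub> d') \<oplus>\<^bsub>Q\<^esub> (r \<oplus>\<^bsub>R\<^esub> s) \<odot>\<^bsub>Q\<^esub> q"
        using * n q Gc by (auto simp: N.smult_l_distr Q.smult_l_distr N.M.a_ac Q.M.a_ac)
      then show "(a \<oplus>\<^bsub>N\<^esub> c, b \<oplus>\<^bsub>Q\<^esub> d) \<in> H" using HI[OF Ga[OF *(1,2)], of "r \<oplus>\<^bsub>R\<^esub> s"] *(3,4) by simp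
    next
      fix r a b assume "r \<in> carrier R \<and> (a, b) \<in> H"
      then obtain a' b' s where *: "(a', b') \<in> G" "r \<in> carrier R" "s \<in> carrier R"
        "a = a' \<oplus>\<^bsub>N\<^esub> s \<odot>\<^bsub>N\<^esub> n" "b = b' \<oplus>\<^bsub>Q\<^esub> s \<odot>\<^bsub>Q\<^esub> q" unfolding H_def by blast
      have "r \<odot>\<^bsub>N\<^esub> a = r \<odot>\<^bsub>N\<^esub> a' \<oplus>\<^bsub>N\<^esub> (r \<otimes>\<^bsub>R\<^esub> s) \<odot>\<^bsub>N\<^esub> n"
        "r \<odot>\<^bsub>Q\<^esub> b = r \<odot>\<^bsub>Q\<^esub> b' \<oplus>\<^bsub>Q\<^esub> (r \<otimes>\<^bsub>R\<^esub> s) \<odot>\<^bsub>Q\<^esub> q"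
        using * n q Gc by (auto simp: N.smult_r_distr Q.smult_r_distr N.smult_assoc1 Q.smult_assoc1)
      then show "(r \<odot>\<^bsub>N\<^esub> a, r \<odot>\<^bsub>Q\<^esub> b) \<in> H" using HI[OF Gs[OF *(2,1)], of "r \<otimes>\<^bsub>R\<^esub> s"] *(2,3) by simp
    next
      fix b assume "(\<zero>\<^bsub>N\<^esub>, b) \<in> H"
      then obtain a' b' s where *: "(a', b') \<in> G" "s \<in> carrier R"
        "\<zero>\<^bsub>N\<^esub> = a' \<oplus>\<^bsub>N\<^esub> s \<odot>\<^bsub>N\<^esub> n" "b = b' \<oplus>\<^bsub>Q\<^esub> s \<odot>\<^bsub>Q\<^esub> q" unfolding H_def by blast
      have ac: "a' \<in> carrier N" "b' \<in> carrier Q" using Gc *(1) by auto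
      have "s \<odot>\<^bsub>N\<^esub> n = \<ominus>\<^bsub>N\<^esub> a'"
        using *(2,3) n ac by (metis N.M.minus_equality N.smult_closed N.M.a_comm)
      then have "(s \<odot>\<^bsub>N\<^esub> n, \<ominus>\<^bsub>Q\<^esub> b') \<in> G" using Gm[OF *(1)] by simp
      then have "s \<in> J" "\<phi> s = \<ominus>\<^bsub>Q\<^esub> b'" using *(2) \<phi> by (auto simp: J_def)
      then show "b = \<zero>\<^bsub>Q\<^esub>" using q(2)[of s] *(4) ac by (simp add: Q.M.r_neg)
    qed
    then have "H = G" using max GH by blast
    moreover have "(n, q) \<in> H"
      using HI[OF Gz, of "\<one>\<^bsub>R\<^esub>"] n q by simp
    ultimately show ?thesis by blast
  qed
  define g where "g = (\<lambda>n\<in>carrier N. THE q. (n, q) \<in> G)"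
  have g: "g n = q" if "(n, q) \<in> G" for n q
    unfolding g_def using that Gu Gc by (auto intro!: the_equality)
  have gG: "(n, g n) \<in> G" if "n \<in> carrier N" for n using tot[OF that] g by auto
  have "g \<in> mod_hom R N Q"
    unfolding mod_hom_def
  proof (intro CollectI conjI ballI)
    show "g \<in> carrier N \<rightarrow>\<^sub>E carrier Q" using Gc(2)[OF gG] by (simp add: PiE_iff) (simp add: g_def)
  qed (use gG Ga Gs in \<open>auto intro!: g\<close>)
  moreover have "\<forall>x\<in>carrier M. g (i x) = f x" using Gi g by blast
  ultimately show ?thesis by blast
qed

definition essential_submodule ::
  "('a, 'x) ring_scheme \<Rightarrow> 'm set \<Rightarrow> ('a, 'm, 'y) module_scheme \<Rightarrow> bool" where
  "essential_submodule R L M \<longleftrightarrow> submodule L R M \<and>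
     (\<forall>N. submodule N R M \<and> N \<noteq> {\<zero>\<^bsub>M\<^esub>} \<longrightarrow> N \<inter> L \<noteq> {\<zero>\<^bsub>M\<^esub>})"

definition injective_envelope ::
  "('a, 'x) ring_scheme \<Rightarrow> ('a, 'm, 'y) module_scheme \<Rightarrow> ('a, 'e, 'z) module_scheme \<Rightarrow> bool"
  where
  "injective_envelope R M E \<longleftrightarrow> module R M \<and> injective_module R E \<and>
     (\<exists>i\<in>mod_hom R M E. inj_on i (carrier M) \<and> essential_submodule R (i ` carrier M) E)"


section \<open>Gorenstein and nearly Gorenstein rings\<close>

definition injective_resolution ::
  "('a, 'x) ring_scheme \<Rightarrow> ('a, 'm, 'y) module_scheme \<Rightarrow> ('m \<Rightarrow> 'c) \<Rightarrow>
     (nat \<Rightarrow> ('a, 'c) module) \<Rightarrow> (nat \<Rightarrow> 'c \<Rightarrow> 'c) \<Rightarrow> bool"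
  where
  "injective_resolution R M \<epsilon> Q d \<longleftrightarrow>
     (\<forall>j. injective_module R (Q j)) \<and>
     \<epsilon> \<in> mod_hom R M (Q 0) \<and> inj_on \<epsilon> (carrier M) \<and>
     (\<forall>j. d j \<in> mod_hom R (Q j) (Q (Suc j))) \<and>
     \<epsilon> ` carrier M = {x \<in> carrier (Q 0). d 0 x = \<zero>\<^bsub>Q (Suc 0)\<^esub>} \<and>
     (\<forall>j. d j ` carrier (Q j) = {x \<in> carrier (Q (Suc j)). d (Suc j) x = \<zero>\<^bsub>Q (Suc (Suc j))\<^esub>})"

text \<open>
  A noetherian local ring is Gorenstein if it has finite injective dimension over itself; the
  predicate is only meant for noetherian (in particular for artinian) local rings. Lists over
  \<open>R\<close> are a large enough carrier type: the terms of the minimal injective resolution of a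
  noetherian ring \<open>R\<close> have at most max(|R|, aleph 0) elements.
\<close>

definition gorenstein_ring :: "('a, 'x) ring_scheme \<Rightarrow> bool" where
  "gorenstein_ring R \<longleftrightarrow>
     (\<exists>\<epsilon> (Q :: nat \<Rightarrow> ('a, 'a list) module) d n.
        injective_resolution R (self_module R) \<epsilon> Q d \<and>
        (\<forall>j>n. carrier (Q j) = {\<zero>\<^bsub>Q j\<^esub>}))"

text \<open>
  The canonical module of an artinian local ring is the injective envelope of its residue field.
  It is unique only up to isomorphism, and the choice \<open>\<omega>\<close> is passed as an argument.
\<close>

definition canonical_module ::
  "('a, 'x) ring_scheme \<Rightarrow> ('a, 'e, 'z) module_scheme \<Rightarrow> bool" where
  "canonical_module R \<omega> \<longleftrightarrow> artinian_local_ring R \<and> injective_envelope R (residue_module R) \<omega>"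

definition nearly_gorenstein ::
  "('a, 'x) ring_scheme \<Rightarrow> ('a, 'e, 'z) module_scheme \<Rightarrow> bool" where
  "nearly_gorenstein R \<omega> \<longleftrightarrow> canonical_module R \<omega> \<and> max_ideal R \<subseteq> trace_ideal R \<omega>"

end

theory Submission
  imports Defs
begin

text \<open>
  A homomorphism \<open>E \<rightarrow> R\<close> that hits a unit makes \<open>R\<close> a retract of the injective module \<open>E\<close>, hence
  self-injective and Gorenstein. So if \<open>R\<close> is not Gorenstein, all homomorphisms \<open>E \<rightarrow> R\<close> have image
  in \<open>\<mm>\<close>, and \<open>\<mm>\<^sup>2 = 0\<close> gives \<open>\<mm>E\<^sup>* = 0\<close>; moreover every nonzero \<open>x \<in> \<mm>\<close> is then a value of the map
  \<open>E \<rightarrow> xE = soc E \<cong> k \<cong> Rx\<close>. Conversely \<open>\<mm>E\<^sup>* = 0\<close> says that \<open>\<mm>\<close> kills the trace of \<open>E\<close>.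

  If \<open>S\<close> is Gorenstein, it is self-injective: the syzygies of a finite injective resolution are
  injective, from right to left, because the kernel of a surjection of injective modules is a direct
  summand. Then \<open>0 :\<^sub>S I = Hom\<^sub>S(R, S)\<close> is the injective envelope of \<open>k\<close> over \<open>R = S/I\<close>, and the
  composite \<open>0 :\<^sub>S I \<subseteq> S \<rightarrow> R\<close> is an element of \<open>E\<^sup>*\<close>.

  For \<open>R = S \<times>\<^sub>k T\<close>, the modules \<open>E\<^sub>S = Hom\<^sub>R(S, E)\<close> and \<open>E\<^sub>T = Hom\<^sub>R(T, E)\<close> are submodules of \<open>E\<close> with
  \<open>E = E\<^sub>S + E\<^sub>T\<close> and \<open>E\<^sub>S \<inter> E\<^sub>T = soc E\<close>. Homomorphisms \<open>E \<rightarrow> R\<close> restrict to \<open>E\<^sub>S \<rightarrow> S\<close>, and a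
  homomorphism \<open>g: E\<^sub>S \<rightarrow> \<mm>\<^sub>S\<close> extends by zero on \<open>E\<^sub>T\<close>, since it kills the socle: otherwise it would
  be a split injection with image in \<open>\<mm>\<^sub>S\<close>, forcing \<open>E\<^sub>S = \<mm>\<^sub>S E\<^sub>S\<close>.
\<close>


section \<open>Homomorphisms of modules\<close>

lemma self_module_simps [simp]:
  "carrier (self_module R) = carrier R" "\<zero>\<^bsub>self_module R\<^esub> = \<zero>\<^bsub>R\<^esub>"
  "x \<oplus>\<^bsub>self_module R\<^esub> y = x \<oplus>\<^bsub>R\<^esub> y" "r \<odot>\<^bsub>self_module R\<^esub> x = r \<otimes>\<^bsub>R\<^esub> x"
  by (simp_all add: self_module_def module_along_def)

lemma mod_hom_closed: "f \<in> mod_hom R M N \<Longrightarrow> x \<in> carrier M \<Longrightarrow> f x \<in> carrier N"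
  by (auto simp: mod_hom_def)

lemma mod_hom_add:
  "f \<in> mod_hom R M N \<Longrightarrow> x \<in> carrier M \<Longrightarrow> y \<in> carrier M \<Longrightarrow> f (x \<oplus>\<^bsub>M\<^esub> y) = f x \<oplus>\<^bsub>N\<^esub> f y"
  by (auto simp: mod_hom_def)

lemma mod_hom_smult:
  "f \<in> mod_hom R M N \<Longrightarrow> r \<in> carrier R \<Longrightarrow> x \<in> carrier M \<Longrightarrow> f (r \<odot>\<^bsub>M\<^esub> x) = r \<odot>\<^bsub>N\<^esub> f x"
  by (auto simp: mod_hom_def)

lemma mod_hom_zero:
  assumes "module R M" "module R N" "f \<in> mod_hom R M N"
  shows "f \<zero>\<^bsub>M\<^esub> = \<zero>\<^bsub>N\<^esub>"
proof -
  interpret M: module R M by fact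
  interpret N: module R N by fact
  show ?thesis
    using mod_hom_smult[OF assms(3), of "\<zero>\<^bsub>R\<^esub>" "\<zero>\<^bsub>M\<^esub>"] mod_hom_closed[OF assms(3), of "\<zero>\<^bsub>M\<^esub>"] by simp
qed

lemma mod_hom_uminus:
  assumes "module R M" "module R N" "f \<in> mod_hom R M N" "x \<in> carrier M"
  shows "f (\<ominus>\<^bsub>M\<^esub> x) = \<ominus>\<^bsub>N\<^esub> f x"
proof -
  interpret M: module R M by fact
  interpret N: module R N by fact
  have "f x \<oplus>\<^bsub>N\<^esub> f (\<ominus>\<^bsub>M\<^esub> x) = \<zero>\<^bsub>N\<^esub>"
    using mod_hom_add[OF assms(3), of x "\<ominus>\<^bsub>M\<^esub> x"] assms mod_hom_zero[OF assms(1-3)]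
    by (simp add: M.M.r_neg)
  then show ?thesis
    using mod_hom_closed[OF assms(3)] assms(4)
    by (metis M.M.a_inv_closed N.M.minus_equality N.M.a_comm)
qed

lemma mod_hom_diff:
  assumes "module R M" "module R N" "f \<in> mod_hom R M N" "x \<in> carrier M" "y \<in> carrier M"
  shows "f (x \<ominus>\<^bsub>M\<^esub> y) = f x \<ominus>\<^bsub>N\<^esub> f y"
proof -
  interpret M: module R M by fact
  show ?thesis
    using mod_hom_add[OF assms(3), of x "\<ominus>\<^bsub>M\<^esub> y"] mod_hom_uminus[OF assms(1-3,5)] assms(4,5)
    by (simp add: a_minus_def)
qed

lemma restrict_mod_hom:
  assumes "module R M"
    and "\<And>x. x \<in> carrier M \<Longrightarrow> f x \<in> carrier N"
    and "\<And>x y. x \<in> carrier M \<Longrightarrow> y \<in> carrier M \<Longrightarrow> f (x \<oplus>\<^bsub>M\<^esub> y) = f x \<oplus>\<^bsub>N\<^esub> f y"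
    and "\<And>r x. r \<in> carrier R \<Longrightarrow> x \<in> carrier M \<Longrightarrow> f (r \<odot>\<^bsub>M\<^esub> x) = r \<odot>\<^bsub>N\<^esub> f x"
  shows "restrict f (carrier M) \<in> mod_hom R M N"
proof -
  interpret M: module R M by fact
  show ?thesis using assms(2-) by (auto simp: mod_hom_def)
qed

lemma mod_hom_compose:
  assumes "module R L" "f \<in> mod_hom R L M" "g \<in> mod_hom R M N"
  shows "(\<lambda>x\<in>carrier L. g (f x)) \<in> mod_hom R L N"
  using assms by (intro restrict_mod_hom) (simp_all add: mod_hom_closed mod_hom_add mod_hom_smult)

lemma mod_hom_id:
  assumes "module R M"
  shows "(\<lambda>x\<in>carrier M. x) \<in> mod_hom R M M"
  using assms by (intro restrict_mod_hom) simp_all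

lemma mod_hom_smult_elem:
  assumes "module R M" "e \<in> carrier M"
  shows "(\<lambda>r\<in>carrier R. r \<odot>\<^bsub>M\<^esub> e) \<in> mod_hom R (self_module R) M"
proof -
  interpret M: module R M by fact
  show ?thesis
    using restrict_mod_hom[OF self_module_module[OF M.is_cring], of "\<lambda>r. r \<odot>\<^bsub>M\<^esub> e" M] assms(2)
    by (simp add: M.smult_l_distr M.smult_assoc1)
qed

lemma inj_on_mod_homI:
  assumes "module R M" "module R N" "f \<in> mod_hom R M N"
    and "\<And>x. x \<in> carrier M \<Longrightarrow> f x = \<zero>\<^bsub>N\<^esub> \<Longrightarrow> x = \<zero>\<^bsub>M\<^esub>"
  shows "inj_on f (carrier M)"
proof (rule inj_onI)
  interpret M: module R M by fact
  interpret N: module R N by fact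
  fix x y assume xy: "x \<in> carrier M" "y \<in> carrier M" "f x = f y"
  then have "f (x \<ominus>\<^bsub>M\<^esub> y) = \<zero>\<^bsub>N\<^esub>"
    using mod_hom_diff[OF assms(1-3)] mod_hom_closed[OF assms(3)] by (simp add: N.M.r_neg a_minus_def)
  then have "x \<ominus>\<^bsub>M\<^esub> y = \<zero>\<^bsub>M\<^esub>" using assms(4) xy by simp
  then have "x \<ominus>\<^bsub>M\<^esub> y \<oplus>\<^bsub>M\<^esub> y = y" using xy by simp
  then show "x = y" using xy by (simp add: a_minus_def M.M.a_assoc M.M.l_neg)
qed

text \<open>Lift the composite of the given map with the section \<open>a\<close> into
  \<open>E\<close>, then apply the retraction \<open>b\<close>. \<open>E\<close> and
  \<open>Q\<close> may have different carrier types, so mutually inverse maps transport injectivity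
  along an isomorphism.\<close>

lemma injective_module_retract:
  fixes E :: "('a, 'm, 'y) module_scheme" and Q :: "('a, 'n, 'z) module_scheme"
  assumes E: "injective_module R E" and Q: "module R Q"
    and a: "a \<in> mod_hom R Q E" and b: "b \<in> mod_hom R E Q"
    and ba: "\<And>x. x \<in> carrier Q \<Longrightarrow> b (a x) = x"
  shows "injective_module R Q"
  unfolding injective_module_def
proof (intro conjI allI impI Q)
  fix M N :: "('a, 'a) module" and i f
  assume *: "module R M \<and> module R N \<and> i \<in> mod_hom R M N \<and> inj_on i (carrier M) \<and> f \<in> mod_hom R M Q"
  then obtain g where g: "g \<in> mod_hom R N E" "\<forall>x\<in>carrier M. g (i x) = (\<lambda>x\<in>carrier M. a (f x)) x"
    using injective_module_lift[OF E, of M N i "\<lambda>x\<in>carrier M. a (f x)"] mod_hom_compose[OF _ _ a, of M f]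
    by auto
  have "(\<lambda>x\<in>carrier N. b (g x)) (i x) = f x" if "x \<in> carrier M" for x
  proof -
    have "i x \<in> carrier N" "f x \<in> carrier Q" using * that by (auto intro: mod_hom_closed)
    then show ?thesis using g(2) that ba[of "f x"] by simp
  qed
  then show "\<exists>g\<in>mod_hom R N Q. \<forall>x\<in>carrier M. g (i x) = f x"
    using mod_hom_compose[OF _ g(1) b] * by meson
qed


section \<open>Artinian local rings\<close>

text \<open>Zorn's lemma for the ideals above \<open>J\<close> that avoid \<open>\<one>\<close>:
  this condition survives unions of chains and is equivalent to properness.\<close>

lemma (in cring) exists_maximalideal:
  assumes J: "ideal J R" "J \<noteq> carrier R"
  shows "\<exists>P. maximalideal P R \<and> J \<subseteq> P"
proof -
  define A where "A = {I. ideal I R \<and> J \<subseteq> I \<and> \<one> \<notin> I}"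
  have "\<one> \<notin> J" using J ideal.one_imp_carrier by blast
  then have JA: "J \<in> A" using J by (simp add: A_def)
  have "\<exists>P\<in>A. \<forall>K\<in>A. P \<subseteq> K \<longrightarrow> K = P"
  proof (rule subset_Zorn_nonempty)
    fix C assume C: "C \<noteq> {}" "subset.chain A C"
    then have "subset.chain {I. ideal I R} C" by (auto simp: A_def subset_chain_def)
    from chain_Union_is_ideal[OF this] C show "\<Union>C \<in> A"
      by (auto simp: A_def subset_chain_def)
  qed (use JA in auto)
  then obtain P where P: "P \<in> A" "\<And>K. K \<in> A \<Longrightarrow> P \<subseteq> K \<Longrightarrow> K = P" by auto
  have "maximalideal P R"
  proof (rule maximalidealI)
    show "ideal P R" "carrier R \<noteq> P" using P(1) by (auto simp: A_def)
    fix K assume K: "ideal K R" "P \<subseteq> K" "K \<subseteq> carrier R"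
    show "K = P \<or> K = carrier R"
    proof (cases "\<one> \<in> K")
      case True then show ?thesis using ideal.one_imp_carrier[OF K(1)] by simp
    next
      case False then show ?thesis using P K by (auto simp: A_def)
    qed
  qed
  then show ?thesis using P(1) by (auto simp: A_def)
qed

context local_ring
begin

lemma max_ideal_ideal: "ideal (max_ideal R) R"
  using max_ideal maximalideal.axioms(1) by blast

lemma max_ideal_closed: "x \<in> max_ideal R \<Longrightarrow> x \<in> carrier R"
  using max_ideal_ideal ideal.Icarr by fastforce

lemma zero_max_ideal: "\<zero> \<in> max_ideal R"
  using max_ideal_ideal by (simp add: additive_subgroup.zero_closed ideal.axioms(1))

lemma max_ideal_not_Units:
  assumes "x \<in> max_ideal R" shows "x \<notin> Units R"
proof
  assume u: "x \<in> Units R"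
  interpret m: maximalideal "max_ideal R" R by (rule max_ideal)
  have "inv x \<otimes> x \<in> max_ideal R" using assms u by (intro m.I_l_closed) auto
  then show False using u m.one_imp_carrier m.I_notcarr by simp
qed

lemma one_not_max_ideal: "\<one> \<notin> max_ideal R"
  using max_ideal_not_Units by blast

lemma zero_neq_one: "\<zero> \<noteq> \<one>"
  using zero_max_ideal one_not_max_ideal by auto

text \<open>A nonunit generates a principal ideal without \<open>\<one>\<close>, which lies in some
  maximal ideal, and there is only one of these.\<close>

lemma not_Units_max_ideal:
  assumes x: "x \<in> carrier R" "x \<notin> Units R" shows "x \<in> max_ideal R"
proof -
  have "\<one> \<notin> PIdl x"
    using x by (auto simp: cgenideal_def Units_def m_comm)
  then have "PIdl x \<noteq> carrier R" by auto
  then obtain P where P: "maximalideal P R" "PIdl x \<subseteq> P"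
    using exists_maximalideal cgenideal_ideal[OF x(1)] by blast
  then have "P = max_ideal R" using ex1_maximalideal max_ideal by blast
  then show ?thesis using P cgenideal_self[OF x(1)] by auto
qed

lemma one_minus_Units:
  assumes "x \<in> max_ideal R" shows "\<one> \<ominus> x \<in> Units R"
proof (rule ccontr)
  interpret m: ideal "max_ideal R" R by (rule max_ideal_ideal)
  have xc: "x \<in> carrier R" using assms by (rule max_ideal_closed)
  assume "\<one> \<ominus> x \<notin> Units R"
  then have "\<one> \<ominus> x \<in> max_ideal R" using xc by (intro not_Units_max_ideal) auto
  then have "(\<one> \<ominus> x) \<oplus> x \<in> max_ideal R" using assms by (rule m.a_closed)
  then show False using xc one_not_max_ideal by (simp add: a_minus_def a_assoc l_neg)
qed

text \<open>The cyclic case of Nakayama's lemma: (1 - r) x = 0, and 1 - r is a unit.\<close>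

lemma smult_fixed_zero:
  assumes M: "module R M" and r: "r \<in> max_ideal R" and x: "x \<in> carrier M" and eq: "r \<odot>\<^bsub>M\<^esub> x = x"
  shows "x = \<zero>\<^bsub>M\<^esub>"
proof -
  interpret M: module R M by fact
  have rc: "r \<in> carrier R" using r by (rule max_ideal_closed)
  define u where "u = \<one> \<ominus> r"
  have u: "u \<in> Units R" unfolding u_def using r by (rule one_minus_Units)
  have "u \<odot>\<^bsub>M\<^esub> x = \<zero>\<^bsub>M\<^esub>"
    using rc x eq by (simp add: u_def a_minus_def M.smult_l_distr M.smult_l_minus M.M.r_neg)
  then have "inv u \<odot>\<^bsub>M\<^esub> (u \<odot>\<^bsub>M\<^esub> x) = \<zero>\<^bsub>M\<^esub>" using u by simp
  moreover have "inv u \<odot>\<^bsub>M\<^esub> (u \<odot>\<^bsub>M\<^esub> x) = x"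
    using u x by (simp add: M.smult_assoc1[symmetric] Units_closed)
  ultimately show ?thesis by simp
qed

end

text \<open>The descending chain condition enters here. If the claim failed, repeated multiplication
  by elements of m would give p_0, p_1, ... all satisfying \<open>Q\<close>, whose principal ideals
  become stationary; then p_n = (u r) p_n with r in m, so p_n = 0. With \<open>Q p\<close> saying
  that p x is nonzero this finds socle elements; with \<open>Q p\<close> saying that p c lies
  outside a submodule it finds multiples of c that m moves into it.\<close>

lemma (in artinian_local_ring) exists_maximal_multiple:
  assumes Q1: "Q \<one>" and Q0: "\<not> Q \<zero>"
  shows "\<exists>p\<in>carrier R. Q p \<and> (\<forall>r\<in>max_ideal R. \<not> Q (r \<otimes> p))"
proof (rule ccontr)
  assume "\<not> ?thesis"
  then have neg: "\<exists>r\<in>max_ideal R. Q (r \<otimes> p)" if "p \<in> carrier R" "Q p" for p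
    using that by auto
  have "\<exists>p. \<forall>n. (p n \<in> carrier R \<and> Q (p n)) \<and> (\<exists>r\<in>max_ideal R. p (Suc n) = r \<otimes> p n)"
  proof (rule dependent_nat_choice)
    show "\<exists>x. x \<in> carrier R \<and> Q x" using Q1 by auto
    show "\<exists>y. (y \<in> carrier R \<and> Q y) \<and> (\<exists>r\<in>max_ideal R. y = r \<otimes> x)" if x: "x \<in> carrier R \<and> Q x" for x
    proof -
      obtain r where "r \<in> max_ideal R" "Q (r \<otimes> x)" using neg[of x] x by auto
      then show ?thesis using x max_ideal_closed by (intro exI[of _ "r \<otimes> x"]) auto
    qed
  qed
  then obtain p where p: "\<And>n. p n \<in> carrier R" "\<And>n. Q (p n)"
      "\<And>n. \<exists>r\<in>max_ideal R. p (Suc n) = r \<otimes> p n" by blast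
  have "PIdl (p (Suc n)) \<subseteq> PIdl (p n)" for n
  proof (rule cgenideal_minimal[OF cgenideal_ideal[OF p(1)]])
    show "p (Suc n) \<in> PIdl (p n)"
      using p(3)[of n] max_ideal_closed by (auto simp: cgenideal_def)
  qed
  then obtain n where "\<forall>k\<ge>n. PIdl (p k) = PIdl (p n)"
    using descending_chain[of "\<lambda>n. PIdl (p n)"] cgenideal_ideal[OF p(1)] by auto
  then have "PIdl (p (Suc n)) = PIdl (p n)" by (meson le_SucI le_refl)
  then have "p n \<in> PIdl (p (Suc n))" using cgenideal_self[OF p(1), of n] by blast
  then obtain u where u: "u \<in> carrier R" "p n = u \<otimes> p (Suc n)" by (auto simp: cgenideal_def)
  obtain r where r: "r \<in> max_ideal R" "p (Suc n) = r \<otimes> p n" using p(3) by blast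
  interpret m: ideal "max_ideal R" R by (rule max_ideal_ideal)
  have "u \<otimes> r \<in> max_ideal R" using u r by (simp add: m.I_l_closed)
  moreover have "(u \<otimes> r) \<otimes> p n = p n"
    using u r p(1)[of n] max_ideal_closed by (simp add: m_assoc)
  ultimately have "p n = \<zero>"
    using smult_fixed_zero[OF self_module_module[OF is_cring]] p(1)[of n] by simp
  then show False using p(2)[of n] Q0 by simp
qed

text \<open>Serves maps described through a choice, such as a coefficient or a summand in a
  decomposition. The relation is the graph of the map, and \<open>uniq\<close> is the place where
  independence of the choice is proved.\<close>

lemma mod_hom_of_relation:
  assumes M: "module R M"
    and ex: "\<And>x. x \<in> carrier M \<Longrightarrow> \<exists>y\<in>carrier N. P x y"
    and uniq: "\<And>x y z. x \<in> carrier M \<Longrightarrow> y \<in> carrier N \<Longrightarrow> z \<in> carrier N \<Longrightarrow> P x y \<Longrightarrow> P x z \<Longrightarrow> y = z"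
    and N: "module R N"
    and add: "\<And>x x' y y'. x \<in> carrier M \<Longrightarrow> x' \<in> carrier M \<Longrightarrow> y \<in> carrier N \<Longrightarrow> y' \<in> carrier N \<Longrightarrow>
        P x y \<Longrightarrow> P x' y' \<Longrightarrow> P (x \<oplus>\<^bsub>M\<^esub> x') (y \<oplus>\<^bsub>N\<^esub> y')"
    and smult: "\<And>r x y. r \<in> carrier R \<Longrightarrow> x \<in> carrier M \<Longrightarrow> y \<in> carrier N \<Longrightarrow> P x y \<Longrightarrow>
        P (r \<odot>\<^bsub>M\<^esub> x) (r \<odot>\<^bsub>N\<^esub> y)"
  shows "\<exists>f\<in>mod_hom R M N. \<forall>x\<in>carrier M. P x (f x)"
proof -
  interpret M: module R M by fact
  interpret N: module R N by fact
  obtain f where f: "\<And>x. x \<in> carrier M \<Longrightarrow> f x \<in> carrier N" "\<And>x. x \<in> carrier M \<Longrightarrow> P x (f x)"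
    using ex by metis
  have "restrict f (carrier M) \<in> mod_hom R M N"
  proof (rule restrict_mod_hom[OF M f(1)])
    fix x y assume "x \<in> carrier M" "y \<in> carrier M"
    then show "f (x \<oplus>\<^bsub>M\<^esub> y) = f x \<oplus>\<^bsub>N\<^esub> f y"
      using f add by (intro uniq[of "x \<oplus>\<^bsub>M\<^esub> y"]) auto
  next
    fix r x assume "r \<in> carrier R" "x \<in> carrier M"
    then show "f (r \<odot>\<^bsub>M\<^esub> x) = r \<odot>\<^bsub>N\<^esub> f x"
      using f smult by (intro uniq[of "r \<odot>\<^bsub>M\<^esub> x"]) auto
  qed
  moreover have "\<forall>x\<in>carrier M. P x (restrict f (carrier M) x)" using f by simp
  ultimately show ?thesis by blast
qed

section \<open>Submodules, and extension of maps from cyclic submodules\<close>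

lemma submoduleI_smult:
  assumes M: "module R M" and H: "H \<subseteq> carrier M" "\<zero>\<^bsub>M\<^esub> \<in> H"
    and add: "\<And>x y. x \<in> H \<Longrightarrow> y \<in> H \<Longrightarrow> x \<oplus>\<^bsub>M\<^esub> y \<in> H"
    and smult: "\<And>r x. r \<in> carrier R \<Longrightarrow> x \<in> H \<Longrightarrow> r \<odot>\<^bsub>M\<^esub> x \<in> H"
  shows "submodule H R M"
proof -
  interpret M: module R M by fact
  have "\<ominus>\<^bsub>M\<^esub> x \<in> H" if "x \<in> H" for x
    using smult[of "\<ominus>\<^bsub>R\<^esub> \<one>\<^bsub>R\<^esub>" x] that H(1) by (auto simp: M.smult_l_minus)
  then show ?thesis using H add smult by (intro M.submoduleI) auto
qed

lemma submodule_zero: "submodule H R M \<Longrightarrow> \<zero>\<^bsub>M\<^esub> \<in> H"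
  using subgroup.one_closed[OF submodule.axioms(1)] by fastforce

lemma submodule_diff:
  assumes "module R M" "submodule H R M" "x \<in> H" "y \<in> H"
  shows "x \<ominus>\<^bsub>M\<^esub> y \<in> H"
  using module.submoduleE[OF assms(1,2)] assms(3,4) by (simp add: a_minus_def)

lemma mod_hom_inclusion:
  assumes "module R M" "submodule H R M"
  shows "(\<lambda>x\<in>H. x) \<in> mod_hom R (M\<lparr>carrier := H\<rparr>) M"
  using restrict_mod_hom[OF submodule.submodule_is_module[OF assms(2,1)], of "\<lambda>x. x" M]
    module.submoduleE(1)[OF assms] by auto

lemma kernel_submodule:
  assumes "module R M" "module R N" "f \<in> mod_hom R M N"
  shows "submodule {x \<in> carrier M. f x = \<zero>\<^bsub>N\<^esub>} R M"
proof -
  interpret M: module R M by fact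
  interpret N: module R N by fact
  show ?thesis
    using assms mod_hom_zero[OF assms]
    by (intro submoduleI_smult) (auto simp: mod_hom_add mod_hom_smult)
qed

lemma cyclic_submodule:
  assumes "module R M" "x \<in> carrier M"
  shows "submodule {r \<odot>\<^bsub>M\<^esub> x | r. r \<in> carrier R} R M"
proof -
  interpret M: module R M by fact
  have "\<zero>\<^bsub>M\<^esub> \<in> {r \<odot>\<^bsub>M\<^esub> x | r. r \<in> carrier R}"
    using assms(2) by (auto intro!: exI[of _ "\<zero>\<^bsub>R\<^esub>"])
  then show ?thesis
    using assms
    by (intro submoduleI_smult) (auto simp: M.smult_l_distr[symmetric] M.smult_assoc1[symmetric])
qed

text \<open>The condition on annihilators makes r x \<mapsto> r y well defined on the cyclic
  submodule Rx, and injectivity of \<open>Q\<close> extends this map to \<open>M\<close>.\<close>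

lemma injective_module_lift_cyclic:
  fixes M :: "('a, 'm, 'y) module_scheme" and Q :: "('a, 'n, 'z) module_scheme"
  assumes Q: "injective_module R Q" and M: "module R M"
    and x: "x \<in> carrier M" and y: "y \<in> carrier Q"
    and ann: "\<And>r. r \<in> carrier R \<Longrightarrow> r \<odot>\<^bsub>M\<^esub> x = \<zero>\<^bsub>M\<^esub> \<Longrightarrow> r \<odot>\<^bsub>Q\<^esub> y = \<zero>\<^bsub>Q\<^esub>"
  shows "\<exists>g\<in>mod_hom R M Q. g x = y"
proof -
  interpret M: module R M by fact
  have Qm: "module R Q" using Q by (simp add: injective_module_def)
  interpret Q: module R Q by fact
  define L where "L = M\<lparr>carrier := {r \<odot>\<^bsub>M\<^esub> x | r. r \<in> carrier R}\<rparr>"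
  have L: "module R L"
    unfolding L_def by (rule submodule.submodule_is_module[OF cyclic_submodule[OF M x] M])
  define P where "P a b \<longleftrightarrow> (\<exists>r\<in>carrier R. a = r \<odot>\<^bsub>M\<^esub> x \<and> b = r \<odot>\<^bsub>Q\<^esub> y)" for a b
  have "\<exists>f\<in>mod_hom R L Q. \<forall>a\<in>carrier L. P a (f a)"
  proof (rule mod_hom_of_relation[OF L _ _ Qm])
    fix a assume "a \<in> carrier L"
    then show "\<exists>b\<in>carrier Q. P a b" using y by (auto simp: L_def P_def)
  next
    fix a b c assume "P a b" "P a c"
    then obtain r s where rs: "r \<in> carrier R" "s \<in> carrier R" "a = r \<odot>\<^bsub>M\<^esub> x" "a = s \<odot>\<^bsub>M\<^esub> x"
      "b = r \<odot>\<^bsub>Q\<^esub> y" "c = s \<odot>\<^bsub>Q\<^esub> y" by (auto simp: P_def)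
    have "(r \<ominus>\<^bsub>R\<^esub> s) \<odot>\<^bsub>M\<^esub> x = r \<odot>\<^bsub>M\<^esub> x \<oplus>\<^bsub>M\<^esub> \<ominus>\<^bsub>M\<^esub> (s \<odot>\<^bsub>M\<^esub> x)"
      using rs(1,2) x by (simp add: a_minus_def M.smult_l_distr M.smult_l_minus)
    also have "\<dots> = \<zero>\<^bsub>M\<^esub>" using rs x by (metis M.M.r_neg M.smult_closed)
    finally have "(r \<ominus>\<^bsub>R\<^esub> s) \<odot>\<^bsub>Q\<^esub> y = \<zero>\<^bsub>Q\<^esub>" using ann rs(1,2) by simp
    then have "b \<oplus>\<^bsub>Q\<^esub> \<ominus>\<^bsub>Q\<^esub> c = \<zero>\<^bsub>Q\<^esub>"
      using rs(1,2,5,6) y by (simp add: a_minus_def Q.smult_l_distr Q.smult_l_minus)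
    then show "b = c"
      using rs(1,2,5,6) y by (metis Q.M.minus_equality Q.M.a_inv_closed Q.M.minus_minus Q.smult_closed)
  next
    fix a a' b b' assume "P a b" "P a' b'"
    then obtain r s where rs: "r \<in> carrier R" "s \<in> carrier R" "a = r \<odot>\<^bsub>M\<^esub> x" "a' = s \<odot>\<^bsub>M\<^esub> x"
      "b = r \<odot>\<^bsub>Q\<^esub> y" "b' = s \<odot>\<^bsub>Q\<^esub> y" by (auto simp: P_def)
    then show "P (a \<oplus>\<^bsub>L\<^esub> a') (b \<oplus>\<^bsub>Q\<^esub> b')"
      using x y unfolding P_def L_def
      by (intro bexI[of _ "r \<oplus>\<^bsub>R\<^esub> s"]) (simp_all add: M.smult_l_distr Q.smult_l_distr)
  next
    fix t a b assume t: "t \<in> carrier R" and "P a b"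
    then obtain r where "r \<in> carrier R" "a = r \<odot>\<^bsub>M\<^esub> x" "b = r \<odot>\<^bsub>Q\<^esub> y" by (auto simp: P_def)
    then show "P (t \<odot>\<^bsub>L\<^esub> a) (t \<odot>\<^bsub>Q\<^esub> b)"
      using x y t unfolding P_def L_def
      by (intro bexI[of _ "t \<otimes>\<^bsub>R\<^esub> r"]) (simp_all add: M.smult_assoc1 Q.smult_assoc1)
  qed
  then obtain f where f: "f \<in> mod_hom R L Q" "\<forall>a\<in>carrier L. P a (f a)" by blast
  have LM: "carrier L \<subseteq> carrier M" using x by (auto simp: L_def)
  have "(\<lambda>a\<in>carrier L. a) \<in> mod_hom R L M"
    by (rule restrict_mod_hom[OF L]) (use LM in \<open>auto simp: L_def\<close>)
  moreover have "inj_on (\<lambda>a\<in>carrier L. a) (carrier L)" by (simp add: inj_on_def)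
  ultimately obtain g where g: "g \<in> mod_hom R M Q" "\<forall>a\<in>carrier L. g ((\<lambda>a\<in>carrier L. a) a) = f a"
    using injective_module_lift[OF Q L M _ _ f(1)] by blast
  have xL: "x \<in> carrier L" using x by (auto simp: L_def intro!: exI[of _ "\<one>\<^bsub>R\<^esub>"])
  then obtain r where r: "r \<in> carrier R" "x = r \<odot>\<^bsub>M\<^esub> x" "g x = r \<odot>\<^bsub>Q\<^esub> y"
    using f(2) g(2) by (auto simp: P_def)
  \<comment> \<open>The relation \<open>P\<close> only yields some r with x = r x and g x = r y.
    Since r - 1 annihilates x, it annihilates y, so the value is y itself.\<close>
  have "(r \<ominus>\<^bsub>R\<^esub> \<one>\<^bsub>R\<^esub>) \<odot>\<^bsub>M\<^esub> x = \<zero>\<^bsub>M\<^esub>"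
    using r(1) r(2)[symmetric] x by (simp add: a_minus_def M.smult_l_distr M.smult_l_minus M.M.r_neg)
  then have "(r \<ominus>\<^bsub>R\<^esub> \<one>\<^bsub>R\<^esub>) \<odot>\<^bsub>Q\<^esub> y = \<zero>\<^bsub>Q\<^esub>" using ann r(1) by simp
  then have "r \<odot>\<^bsub>Q\<^esub> y \<oplus>\<^bsub>Q\<^esub> \<ominus>\<^bsub>Q\<^esub> y = \<zero>\<^bsub>Q\<^esub>"
    using r(1) y by (simp add: a_minus_def Q.smult_l_distr Q.smult_l_minus)
  then have "r \<odot>\<^bsub>Q\<^esub> y = y"
    using r(1) y by (metis Q.M.minus_equality Q.M.a_inv_closed Q.M.minus_minus Q.smult_closed)
  then show ?thesis using g(1) r(3) by auto
qed


section \<open>Socles and injective envelopes of the residue field\<close>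

text \<open>Encodes a simple essential socle by a generator: \<open>e\<close> spans a copy of the
  residue field, and the last clause puts it inside every nonzero submodule. Together with
  injectivity this describes the injective envelope of k by one element, and the same element serves
  after a change of rings.\<close>

definition socle_generator ::
  "('a, 'x) ring_scheme \<Rightarrow> ('a, 'm, 'y) module_scheme \<Rightarrow> 'm \<Rightarrow> bool" where
  "socle_generator R M e \<longleftrightarrow> e \<in> carrier M \<and> e \<noteq> \<zero>\<^bsub>M\<^esub> \<and>
     (\<forall>r\<in>max_ideal R. r \<odot>\<^bsub>M\<^esub> e = \<zero>\<^bsub>M\<^esub>) \<and>
     (\<forall>x\<in>carrier M. x \<noteq> \<zero>\<^bsub>M\<^esub> \<longrightarrow> (\<exists>r\<in>carrier R. r \<odot>\<^bsub>M\<^esub> x = e))"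

context local_ring
begin

lemma Units_smult_eq_zero:
  assumes "module R M" "u \<in> Units R" "x \<in> carrier M" "u \<odot>\<^bsub>M\<^esub> x = \<zero>\<^bsub>M\<^esub>"
  shows "x = \<zero>\<^bsub>M\<^esub>"
proof -
  interpret M: module R M by fact
  have "inv u \<odot>\<^bsub>M\<^esub> (u \<odot>\<^bsub>M\<^esub> x) = x"
    using assms(2,3) by (simp add: M.smult_assoc1[symmetric] Units_closed)
  then show ?thesis using assms(2,4) by simp
qed

text \<open>\<open>e\<close> is the image of the class of 1. By essentiality each nonzero cyclic
  submodule Rx meets the image of k in a nonzero element s e; then s is a unit and \<open>e\<close>
  is a multiple of x.\<close>

lemma envelope_socle_generator:
  assumes env: "injective_envelope R (residue_module R) E"
  shows "\<exists>e. socle_generator R E e"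
proof -
  interpret m: maximalideal "max_ideal R" R by (rule max_ideal)
  have k: "module R (residue_module R)" by (rule residue_module_module)
  interpret k: module R "residue_module R" by (rule k)
  have E: "module R E" using env by (simp add: injective_envelope_def injective_module_def)
  interpret E: module R E by fact
  obtain i where i: "i \<in> mod_hom R (residue_module R) E" "inj_on i (carrier (residue_module R))"
      "essential_submodule R (i ` carrier (residue_module R)) E"
    using env by (auto simp: injective_envelope_def)
  let ?c = "\<lambda>r. max_ideal R +> r"
  have cs: "?c r = r \<odot>\<^bsub>residue_module R\<^esub> ?c \<one>" if "r \<in> carrier R" for r
    using that by (simp add: residue_module_def module_along_def FactRing_def m.rcoset_mult_add)
  have cc: "?c r \<in> carrier (residue_module R)" if "r \<in> carrier R" for r
    using that by (simp add: residue_module_def module_along_def FactRing_def a_rcosetsI m.a_subset)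
  have c0: "?c r = \<zero>\<^bsub>residue_module R\<^esub> \<longleftrightarrow> r \<in> max_ideal R" if "r \<in> carrier R" for r
    using that m.a_rcos_self m.a_rcos_const
    by (auto simp: residue_module_def module_along_def FactRing_def)
  have surj: "\<exists>r\<in>carrier R. z = ?c r" if "z \<in> carrier (residue_module R)" for z
    using that by (auto simp: residue_module_def module_along_def FactRing_simps)
  define e where "e = i (?c \<one>)"
  have e: "e \<in> carrier E" unfolding e_def by (rule mod_hom_closed[OF i(1) cc]) simp
  have ic: "i (?c r) = r \<odot>\<^bsub>E\<^esub> e" if "r \<in> carrier R" for r
    using mod_hom_smult[OF i(1) that cc[OF one_closed]] cs[OF that] by (simp add: e_def)
  have i0: "i z = \<zero>\<^bsub>E\<^esub> \<longleftrightarrow> z = \<zero>\<^bsub>residue_module R\<^esub>" if "z \<in> carrier (residue_module R)" for z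
    using mod_hom_zero[OF k E i(1)] i(2) that by (metis inj_onD k.M.zero_closed)
  have ne: "e \<noteq> \<zero>\<^bsub>E\<^esub>"
    using i0[OF cc[OF one_closed]] c0[OF one_closed] one_not_max_ideal by (simp add: e_def)
  have "r \<odot>\<^bsub>E\<^esub> e = \<zero>\<^bsub>E\<^esub>" if "r \<in> max_ideal R" for r
    using ic[of r] c0[of r] i0[of "?c r"] cc[of r] that max_ideal_closed by simp
  moreover have "\<exists>r\<in>carrier R. r \<odot>\<^bsub>E\<^esub> x = e" if x: "x \<in> carrier E" "x \<noteq> \<zero>\<^bsub>E\<^esub>" for x
  proof -
    let ?N = "{r \<odot>\<^bsub>E\<^esub> x | r. r \<in> carrier R}"
    have "x \<in> ?N" using x(1) by (auto intro!: exI[of _ \<one>])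
    then have "?N \<noteq> {\<zero>\<^bsub>E\<^esub>}" using x(2) by blast
    then have ni: "?N \<inter> i ` carrier (residue_module R) \<noteq> {\<zero>\<^bsub>E\<^esub>}"
      using i(3) cyclic_submodule[OF E x(1)] by (simp add: essential_submodule_def)
    \<comment> \<open>Being different from {0} does not exclude the empty set. Zero lies in both
      submodules, so their intersection contains a nonzero element.\<close>
    have "\<zero>\<^bsub>E\<^esub> \<in> ?N" using x(1) by (auto intro!: exI[of _ \<zero>])
    moreover have "\<zero>\<^bsub>E\<^esub> \<in> i ` carrier (residue_module R)"
      using mod_hom_zero[OF k E i(1)] by (metis imageI k.M.zero_closed)
    ultimately obtain y where y: "y \<in> ?N" "y \<in> i ` carrier (residue_module R)" "y \<noteq> \<zero>\<^bsub>E\<^esub>"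
      using ni by blast
    then obtain r s where rs: "r \<in> carrier R" "y = r \<odot>\<^bsub>E\<^esub> x" "s \<in> carrier R" "y = i (?c s)"
      using surj by blast
    have "s \<notin> max_ideal R" using rs(3,4) y(3) c0[of s] i0[of "?c s"] cc[of s] by simp
    then have s: "s \<in> Units R" using rs(3) not_Units_max_ideal by blast
    have "(inv s \<otimes> r) \<odot>\<^bsub>E\<^esub> x = inv s \<odot>\<^bsub>E\<^esub> (s \<odot>\<^bsub>E\<^esub> e)"
      using rs s x(1) ic by (simp add: E.smult_assoc1)
    also have "\<dots> = e" using s e by (simp add: E.smult_assoc1[symmetric] Units_closed)
    finally show ?thesis using rs(1) s by blast
  qed
  ultimately show ?thesis using e ne unfolding socle_generator_def by blast
qed

text \<open>Some multiple r x equals \<open>e\<close>. As m kills x and \<open>e\<close> is nonzero,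
  r lies outside m and is a unit, so x is the inverse of r times \<open>e\<close>.\<close>

lemma socle_generator_spans:
  assumes M: "module R M" and e: "socle_generator R M e"
    and x: "x \<in> carrier M" "\<And>r. r \<in> max_ideal R \<Longrightarrow> r \<odot>\<^bsub>M\<^esub> x = \<zero>\<^bsub>M\<^esub>"
  shows "\<exists>r\<in>carrier R. x = r \<odot>\<^bsub>M\<^esub> e"
proof (cases "x = \<zero>\<^bsub>M\<^esub>")
  case True
  interpret M: module R M by fact
  show ?thesis using e True by (intro bexI[of _ \<zero>]) (auto simp: socle_generator_def)
next
  case False
  interpret M: module R M by fact
  obtain r where r: "r \<in> carrier R" "r \<odot>\<^bsub>M\<^esub> x = e"
    using e x(1) False by (auto simp: socle_generator_def)
  then have "r \<notin> max_ideal R" using x(2) e by (auto simp: socle_generator_def)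
  then have u: "r \<in> Units R" using r(1) not_Units_max_ideal by blast
  have "inv r \<odot>\<^bsub>M\<^esub> (r \<odot>\<^bsub>M\<^esub> x) = x"
    using u x(1) by (simp add: M.smult_assoc1[symmetric] Units_closed)
  then show ?thesis using r(2) u by (intro bexI[of _ "inv r"]) auto
qed

lemma socle_generator_ann:
  assumes M: "module R M" and e: "socle_generator R M e" and r: "r \<in> carrier R"
  shows "r \<odot>\<^bsub>M\<^esub> e = \<zero>\<^bsub>M\<^esub> \<longleftrightarrow> r \<in> max_ideal R"
  using assms not_Units_max_ideal[OF r] Units_smult_eq_zero[OF M, of r e]
  by (auto simp: socle_generator_def)

text \<open>A nonzero element of the kernel would have \<open>e\<close> among its multiples, putting
  \<open>e\<close> into the kernel.\<close>

lemma inj_on_socle_generatorI: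
  assumes M: "module R M" and N: "module R N" and f: "f \<in> mod_hom R M N"
    and e: "socle_generator R M e" and fe: "f e \<noteq> \<zero>\<^bsub>N\<^esub>"
  shows "inj_on f (carrier M)"
proof (rule inj_on_mod_homI[OF M N f], rule ccontr)
  interpret N: module R N by fact
  fix x assume x: "x \<in> carrier M" "f x = \<zero>\<^bsub>N\<^esub>" "x \<noteq> \<zero>\<^bsub>M\<^esub>"
  then obtain r where "r \<in> carrier R" "r \<odot>\<^bsub>M\<^esub> x = e" using e by (auto simp: socle_generator_def)
  then show False using mod_hom_smult[OF f, of r x] x fe by simp
qed

text \<open>Uniqueness of the envelope in the form used later. As \<open>d\<close> and
  \<open>e\<close> have the same annihilator m, some h sends \<open>d\<close> to \<open>e\<close>,
  and h is injective because \<open>e\<close> is nonzero. A retraction g of h sends \<open>e\<close>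
  back to \<open>d\<close> and is injective for the same reason; an injective g with g h = id forces
  h to be onto.\<close>

lemma injective_socle_generator_surj:
  assumes M: "injective_module R M" "socle_generator R M d"
    and N: "injective_module R N" "socle_generator R N e"
  shows "\<exists>h\<in>mod_hom R M N. h ` carrier M = carrier N"
proof -
  have Mm: "module R M" and Nm: "module R N" using M(1) N(1) by (simp_all add: injective_module_def)
  have d: "d \<in> carrier M" "d \<noteq> \<zero>\<^bsub>M\<^esub>" and e: "e \<in> carrier N" "e \<noteq> \<zero>\<^bsub>N\<^esub>"
    using M(2) N(2) by (auto simp: socle_generator_def)
  obtain h where h: "h \<in> mod_hom R M N" "h d = e"
    using injective_module_lift_cyclic[OF N(1) Mm d(1) e(1)]
      socle_generator_ann[OF Mm M(2)] socle_generator_ann[OF Nm N(2)] by auto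
  have "inj_on h (carrier M)"
    using inj_on_socle_generatorI[OF Mm Nm h(1) M(2)] h(2) e(2) by simp
  then obtain g where g: "g \<in> mod_hom R N M" "\<forall>x\<in>carrier M. g (h x) = (\<lambda>x\<in>carrier M. x) x"
    using injective_module_lift[OF M(1) Mm Nm h(1) _ mod_hom_id[OF Mm]] by auto
  have "g e = d" using g(2) h(2) d(1) by auto
  then have gi: "inj_on g (carrier N)"
    using inj_on_socle_generatorI[OF Nm Mm g(1) N(2)] d(2) by simp
  have "y \<in> h ` carrier M" if "y \<in> carrier N" for y
  proof
    have gy: "g y \<in> carrier M" using g(1) that by (rule mod_hom_closed)
    then show "g y \<in> carrier M" .
    have "h (g y) \<in> carrier N" using h(1) gy by (rule mod_hom_closed)
    moreover have "g (h (g y)) = g y" using g(2) gy by simp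
    ultimately show "y = h (g y)" using gi that by (simp add: inj_on_def)
  qed
  then have "h ` carrier M = carrier N" using mod_hom_closed[OF h(1)] by auto
  then show ?thesis using h(1) by blast
qed

end


section \<open>Self-injectivity and the Gorenstein property\<close>

text \<open>The resolution has R in degree 0 and zero modules afterwards. Since
  \<open>gorenstein_ring\<close> asks for terms carried by lists, \<open>L\<close> is a copy of R on
  one-element lists and \<open>Z\<close> is the zero module on the empty list.\<close>

lemma self_injective_gorenstein:
  assumes R: "cring R" and inj: "injective_module R (self_module R)"
  shows "gorenstein_ring (R :: ('a, 'x) ring_scheme)"
proof -
  interpret R: cring R by fact
  define L :: "('a, 'a list) module" where
    "L = \<lparr>carrier = (\<lambda>x. [x]) ` carrier R, monoid.mult = undefined, one = undefined,
          ring.zero = [\<zero>\<^bsub>R\<^esub>], ring.add = (\<lambda>a b. [hd a \<oplus>\<^bsub>R\<^esub> hd b]), smult = (\<lambda>r a. [r \<otimes>\<^bsub>R\<^esub> hd a])\<rparr>"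
  define Z :: "('a, 'a list) module" where
    "Z = \<lparr>carrier = {[]}, monoid.mult = undefined, one = undefined,
          ring.zero = [], ring.add = (\<lambda>a b. []), smult = (\<lambda>r a. [])\<rparr>"
  have "abelian_group L"
  proof (rule abelian_groupI, goal_cases)
    case (6 a)
    then show ?case by (intro bexI[of _ "[\<ominus>\<^bsub>R\<^esub> hd a]"]) (auto simp: L_def R.l_neg)
  qed (auto simp: L_def R.a_ac)
  then have L: "module R L"
    by (intro moduleI[OF R]) (auto simp: L_def R.l_distr R.r_distr R.m_assoc)
  have "abelian_group Z" by (rule abelian_groupI) (auto simp: Z_def)
  then have Z: "module R Z" by (intro moduleI[OF R]) (auto simp: Z_def)
  have \<epsilon>: "(\<lambda>x\<in>carrier R. [x]) \<in> mod_hom R (self_module R) L"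
    by (auto simp: mod_hom_def L_def)
  have "restrict hd (carrier L) \<in> mod_hom R L (self_module R)"
    by (rule restrict_mod_hom[OF L]) (auto simp: L_def)
  then have injL: "injective_module R L"
    by (rule injective_module_retract[OF inj L _ \<epsilon>]) (auto simp: L_def)
  \<comment> \<open>The zero module is a retract of \<open>L\<close> through the zero maps, hence
    injective.\<close>
  have "(\<lambda>a\<in>carrier Z. \<zero>\<^bsub>L\<^esub>) \<in> mod_hom R Z L" "(\<lambda>a\<in>carrier L. []) \<in> mod_hom R L Z"
    by (auto simp: mod_hom_def L_def Z_def)
  then have injZ: "injective_module R Z"
    by (rule injective_module_retract[OF injL Z]) (auto simp: L_def Z_def)
  define Q where "Q j = (if j = 0 then L else Z)" for j :: nat
  define d where "d j = (\<lambda>a\<in>carrier (Q j). [] :: 'a list)" for j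
  have "injective_resolution R (self_module R) (\<lambda>x\<in>carrier R. [x]) Q d"
    unfolding injective_resolution_def
  proof (intro conjI allI)
    show "injective_module R (Q j)" for j using injL injZ by (simp add: Q_def)
    show "(\<lambda>x\<in>carrier R. [x]) \<in> mod_hom R (self_module R) (Q 0)" using \<epsilon> by (simp add: Q_def)
    show "inj_on (\<lambda>x\<in>carrier R. [x]) (carrier (self_module R))" by (simp add: inj_on_def)
    show "d j \<in> mod_hom R (Q j) (Q (Suc j))" for j
      using injL injZ by (auto simp: mod_hom_def d_def Q_def Z_def L_def)
    show "(\<lambda>x\<in>carrier R. [x]) ` carrier (self_module R) = {x \<in> carrier (Q 0). d 0 x = \<zero>\<^bsub>Q (Suc 0)\<^esub>}"
      by (auto simp: d_def Q_def L_def Z_def)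
    show "d j ` carrier (Q j) = {x \<in> carrier (Q (Suc j)). d (Suc j) x = \<zero>\<^bsub>Q (Suc (Suc j))\<^esub>}" for j
      by (auto simp: d_def Q_def L_def Z_def)
  qed
  moreover have "\<forall>j>0. carrier (Q j) = {\<zero>\<^bsub>Q j\<^esub>}" by (simp add: Q_def Z_def)
  ultimately show ?thesis unfolding gorenstein_ring_def by blast
qed

text \<open>If \<open>f e\<close> were a unit, the rescaled element \<open>v\<close> would satisfy f
  v = 1; then r \<mapsto> r v is a section of \<open>f\<close>, and R is a retract of
  \<open>E\<close>.\<close>

lemma (in local_ring) mod_hom_image_max_ideal:
  assumes G: "\<not> gorenstein_ring R" and E: "injective_module R E"
    and f: "f \<in> mod_hom R E (self_module R)" and e: "e \<in> carrier E"
  shows "f e \<in> max_ideal R"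
proof (rule ccontr)
  assume nm: "f e \<notin> max_ideal R"
  have Em: "module R E" using E by (simp add: injective_module_def)
  interpret E: module R E by fact
  have "f e \<in> carrier R" using mod_hom_closed[OF f e] by simp
  then have u: "f e \<in> Units R" using nm not_Units_max_ideal by blast
  define v where "v = inv (f e) \<odot>\<^bsub>E\<^esub> e"
  have v: "v \<in> carrier E" "f v = \<one>"
    using u e mod_hom_smult[OF f, of "inv (f e)" e] by (simp_all add: v_def)
  have "f (r \<odot>\<^bsub>E\<^esub> v) = r" if "r \<in> carrier R" for r
    using mod_hom_smult[OF f that v(1)] v(2) that by simp
  then have "injective_module R (self_module R)"
    using injective_module_retract[OF E self_module_module[OF is_cring] mod_hom_smult_elem[OF Em v(1)] f]
    by simp
  then show False using G self_injective_gorenstein[OF is_cring] by blast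
qed

section \<open>Complements of kernels of surjections between injective modules\<close>

lemma sum_cyclic_submodule:
  assumes M: "module R M" and L: "submodule L R M" and b: "b \<in> carrier M"
  shows "submodule {l \<oplus>\<^bsub>M\<^esub> s \<odot>\<^bsub>M\<^esub> b | l s. l \<in> L \<and> s \<in> carrier R} R M"
proof -
  interpret M: module R M by fact
  note LE = M.submoduleE[OF L]
  have Lc: "l \<in> carrier M" if "l \<in> L" for l using LE(1) that by blast
  show ?thesis
  proof (rule submoduleI_smult[OF M])
    show "{l \<oplus>\<^bsub>M\<^esub> s \<odot>\<^bsub>M\<^esub> b | l s. l \<in> L \<and> s \<in> carrier R} \<subseteq> carrier M" using Lc b by auto
    show "\<zero>\<^bsub>M\<^esub> \<in> {l \<oplus>\<^bsub>M\<^esub> s \<odot>\<^bsub>M\<^esub> b | l s. l \<in> L \<and> s \<in> carrier R}"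
      using submodule_zero[OF L] b by (auto intro!: exI[of _ "\<zero>\<^bsub>M\<^esub>"] exI[of _ "\<zero>\<^bsub>R\<^esub>"])
  next
    fix x y
    assume "x \<in> {l \<oplus>\<^bsub>M\<^esub> s \<odot>\<^bsub>M\<^esub> b | l s. l \<in> L \<and> s \<in> carrier R}"
      "y \<in> {l \<oplus>\<^bsub>M\<^esub> s \<odot>\<^bsub>M\<^esub> b | l s. l \<in> L \<and> s \<in> carrier R}"
    then obtain k l s t where *: "k \<in> L" "l \<in> L" "s \<in> carrier R" "t \<in> carrier R"
      "x = k \<oplus>\<^bsub>M\<^esub> s \<odot>\<^bsub>M\<^esub> b" "y = l \<oplus>\<^bsub>M\<^esub> t \<odot>\<^bsub>M\<^esub> b" by blast
    then have "x \<oplus>\<^bsub>M\<^esub> y = (k \<oplus>\<^bsub>M\<^esub> l) \<oplus>\<^bsub>M\<^esub> (s \<oplus>\<^bsub>R\<^esub> t) \<odot>\<^bsub>M\<^esub> b"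
      using Lc b by (simp add: M.smult_l_distr M.M.a_ac)
    then show "x \<oplus>\<^bsub>M\<^esub> y \<in> {l \<oplus>\<^bsub>M\<^esub> s \<odot>\<^bsub>M\<^esub> b | l s. l \<in> L \<and> s \<in> carrier R}"
      using * LE(5) M.R.a_closed by blast
  next
    fix r x assume r: "r \<in> carrier R" and "x \<in> {l \<oplus>\<^bsub>M\<^esub> s \<odot>\<^bsub>M\<^esub> b | l s. l \<in> L \<and> s \<in> carrier R}"
    then obtain l s where *: "l \<in> L" "s \<in> carrier R" "x = l \<oplus>\<^bsub>M\<^esub> s \<odot>\<^bsub>M\<^esub> b" by blast
    then have "r \<odot>\<^bsub>M\<^esub> x = r \<odot>\<^bsub>M\<^esub> l \<oplus>\<^bsub>M\<^esub> (r \<otimes>\<^bsub>R\<^esub> s) \<odot>\<^bsub>M\<^esub> b"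
      using Lc b r by (simp add: M.smult_r_distr M.smult_assoc1)
    then show "r \<odot>\<^bsub>M\<^esub> x \<in> {l \<oplus>\<^bsub>M\<^esub> s \<odot>\<^bsub>M\<^esub> b | l s. l \<in> L \<and> s \<in> carrier R}"
      using * r LE(4) M.R.m_closed by blast
  qed
qed

text \<open>Zorn's lemma: meeting \<open>K\<close> only in zero passes to unions of chains. Such an
  \<open>L\<close> is the candidate for a complement of \<open>K\<close>.\<close>

lemma exists_maximal_disjoint_submodule:
  assumes M: "module R M" and K: "submodule K R M"
  shows "\<exists>L. submodule L R M \<and> L \<inter> K = {\<zero>\<^bsub>M\<^esub>} \<and>
    (\<forall>L'. submodule L' R M \<and> L' \<inter> K = {\<zero>\<^bsub>M\<^esub>} \<and> L \<subseteq> L' \<longrightarrow> L' = L)"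
proof -
  interpret M: module R M by fact
  define A where "A = {L. submodule L R M \<and> L \<inter> K = {\<zero>\<^bsub>M\<^esub>}}"
  have "\<exists>L\<in>A. \<forall>L'\<in>A. L \<subseteq> L' \<longrightarrow> L' = L"
  proof (rule subset_Zorn_nonempty)
    have "submodule {\<zero>\<^bsub>M\<^esub>} R M" by (rule submoduleI_smult[OF M]) auto
    then show "A \<noteq> {}" using submodule_zero[OF K] by (auto simp: A_def)
  next
    fix C assume C: "C \<noteq> {}" "subset.chain A C"
    have CA: "submodule L R M" "L \<inter> K = {\<zero>\<^bsub>M\<^esub>}" if "L \<in> C" for L
      using C(2) that by (auto simp: A_def subset_chain_def)
    have "submodule (\<Union>C) R M"
    proof (rule submoduleI_smult[OF M])
      show "\<Union>C \<subseteq> carrier M" using M.submoduleE(1)[OF CA(1)] by blast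
      show "\<zero>\<^bsub>M\<^esub> \<in> \<Union>C" using C(1) submodule_zero[OF CA(1)] by blast
      show "r \<odot>\<^bsub>M\<^esub> x \<in> \<Union>C" if "r \<in> carrier R" "x \<in> \<Union>C" for r x
        using that M.submoduleE(4)[OF CA(1)] by blast
      fix x y assume "x \<in> \<Union>C" "y \<in> \<Union>C"
      then obtain V W where VW: "V \<in> C" "W \<in> C" "x \<in> V" "y \<in> W" by blast
      then have "V \<subseteq> W \<or> W \<subseteq> V" using C(2) by (auto simp: subset_chain_def)
      then obtain U where "U \<in> C" "x \<in> U" "y \<in> U" using VW by blast
      then show "x \<oplus>\<^bsub>M\<^esub> y \<in> \<Union>C" using M.submoduleE(5)[OF CA(1)] by blast
    qed
    moreover have "\<Union>C \<inter> K = {\<zero>\<^bsub>M\<^esub>}" using CA(2) C(1) by blast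
    ultimately show "\<Union>C \<in> A" by (simp add: A_def)
  qed
  then obtain L where "L \<in> A" "\<And>L'. L' \<in> A \<Longrightarrow> L \<subseteq> L' \<Longrightarrow> L' = L" by auto
  then show ?thesis by (intro exI[of _ L]) (simp add: A_def)
qed

context artinian_local_ring
begin

lemma exists_socle_element: "\<exists>x\<in>carrier R. x \<noteq> \<zero> \<and> (\<forall>r\<in>max_ideal R. r \<otimes> x = \<zero>)"
  using exists_maximal_multiple[of "\<lambda>p. p \<noteq> \<zero>"] zero_neq_one[symmetric] by simp

text \<open>Take a nonzero x in the socle of R. Its annihilator lies in m and so kills c, and
  injectivity of \<open>C\<close> makes c divisible by x: c = x g(1). If b lifts g(1), then x b
  lifts c, and m kills it because m x = 0.\<close>

lemma socle_lift:
  assumes B: "module R B" and C: "injective_module R C"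
    and \<pi>: "\<pi> \<in> mod_hom R B C" "\<pi> ` carrier B = carrier C"
    and c: "c \<in> carrier C" "\<And>r. r \<in> max_ideal R \<Longrightarrow> r \<odot>\<^bsub>C\<^esub> c = \<zero>\<^bsub>C\<^esub>"
  shows "\<exists>b\<in>carrier B. \<pi> b = c \<and> (\<forall>r\<in>max_ideal R. r \<odot>\<^bsub>B\<^esub> b = \<zero>\<^bsub>B\<^esub>)"
proof -
  interpret B: module R B by fact
  have self: "module R (self_module R)" by (rule self_module_module[OF is_cring])
  obtain x where x: "x \<in> carrier R" "x \<noteq> \<zero>" "\<And>r. r \<in> max_ideal R \<Longrightarrow> r \<otimes> x = \<zero>"
    using exists_socle_element by blast
  have "r \<odot>\<^bsub>C\<^esub> c = \<zero>\<^bsub>C\<^esub>" if "r \<in> carrier R" "r \<otimes> x = \<zero>" for r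
    using Units_smult_eq_zero[OF self, of r x] x that not_Units_max_ideal c(2) by auto
  then obtain g where g: "g \<in> mod_hom R (self_module R) C" "g x = c"
    using injective_module_lift_cyclic[OF C self, of x c] x(1) c(1) by auto
  have "g \<one> \<in> carrier C" using mod_hom_closed[OF g(1)] by simp
  then obtain b where b: "b \<in> carrier B" "\<pi> b = g \<one>" using \<pi>(2) by (metis imageE)
  have "\<pi> (x \<odot>\<^bsub>B\<^esub> b) = g (x \<otimes> \<one>)"
    using mod_hom_smult[OF \<pi>(1) x(1) b(1)] mod_hom_smult[OF g(1) x(1), of \<one>] b(2) by simp
  then have "\<pi> (x \<odot>\<^bsub>B\<^esub> b) = c" using g(2) x(1) by simp
  moreover have "r \<odot>\<^bsub>B\<^esub> (x \<odot>\<^bsub>B\<^esub> b) = \<zero>\<^bsub>B\<^esub>" if "r \<in> max_ideal R" for r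
    using x(1) x(3)[OF that] b(1) max_ideal_closed[OF that] by (simp add: B.smult_assoc1[symmetric])
  ultimately show ?thesis using x(1) b(1) by (intro bexI[of _ "x \<odot>\<^bsub>B\<^esub> b"]) auto
qed

text \<open>
  The kernel of \<open>\<pi>\<close> has a complement: if a submodule \<open>L\<close> that is maximal with \<open>L \<inter> ker \<pi> = 0\<close> did
  not map onto \<open>C\<close>, then some \<open>c\<close> outside \<open>\<pi> L\<close> would satisfy \<open>\<mm>c \<subseteq> \<pi> L\<close>. Since \<open>B\<close> is
  injective and socle elements of \<open>C\<close> lift along \<open>\<pi>\<close>, this \<open>c\<close> would lift to some \<open>b\<close>
  with \<open>\<mm>b \<subseteq> L\<close>, and \<open>L + Rb\<close> would contradict maximality.
\<close>

lemma kernel_complement: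
  assumes B: "injective_module R B" and C: "injective_module R C"
    and \<pi>: "\<pi> \<in> mod_hom R B C" "\<pi> ` carrier B = carrier C"
  shows "\<exists>L. submodule L R B \<and> L \<inter> {x \<in> carrier B. \<pi> x = \<zero>\<^bsub>C\<^esub>} = {\<zero>\<^bsub>B\<^esub>} \<and> \<pi> ` L = carrier C"
proof -
  have Bm: "module R B" and Cm: "module R C" using B C by (simp_all add: injective_module_def)
  interpret B: module R B by fact
  interpret C: module R C by fact
  interpret m: ideal "max_ideal R" R by (rule max_ideal_ideal)
  define K where "K = {x \<in> carrier B. \<pi> x = \<zero>\<^bsub>C\<^esub>}"
  obtain L where L: "submodule L R B" "L \<inter> K = {\<zero>\<^bsub>B\<^esub>}"
    and max: "\<And>L'. submodule L' R B \<Longrightarrow> L' \<inter> K = {\<zero>\<^bsub>B\<^esub>} \<Longrightarrow> L \<subseteq> L' \<Longrightarrow> L' = L"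
    using exists_maximal_disjoint_submodule[OF Bm kernel_submodule[OF Bm Cm \<pi>(1)]]
    unfolding K_def by blast
  note LE = B.submoduleE[OF L(1)]
  have Lc: "l \<in> carrier B" if "l \<in> L" for l using LE(1) that by blast
  have \<pi>c: "\<pi> x \<in> carrier C" if "x \<in> carrier B" for x using \<pi>(1) that by (rule mod_hom_closed)
  have inj: "k = l" if "k \<in> L" "l \<in> L" "\<pi> k = \<pi> l" for k l
  proof -
    have "\<pi> (k \<ominus>\<^bsub>B\<^esub> l) = \<zero>\<^bsub>C\<^esub>"
      using mod_hom_diff[OF Bm Cm \<pi>(1)] that Lc \<pi>c by (simp add: a_minus_def C.M.r_neg)
    then have "k \<ominus>\<^bsub>B\<^esub> l \<in> L \<inter> K"
      using submodule_diff[OF Bm L(1)] that Lc by (auto simp: K_def)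
    then have "k \<ominus>\<^bsub>B\<^esub> l \<oplus>\<^bsub>B\<^esub> l = l" using L(2) that Lc by simp
    then show ?thesis using that Lc by (simp add: a_minus_def B.M.a_assoc B.M.l_neg)
  qed
  have "c0 \<in> \<pi> ` L" if c0: "c0 \<in> carrier C" for c0
  proof (rule ccontr)
    assume "c0 \<notin> \<pi> ` L"
    moreover have "\<zero>\<^bsub>C\<^esub> \<in> \<pi> ` L"
      using mod_hom_zero[OF Bm Cm \<pi>(1)] submodule_zero[OF L(1)] by (metis imageI)
    ultimately obtain p where p: "p \<in> carrier R" "p \<odot>\<^bsub>C\<^esub> c0 \<notin> \<pi> ` L"
        "\<And>r. r \<in> max_ideal R \<Longrightarrow> (r \<otimes> p) \<odot>\<^bsub>C\<^esub> c0 \<in> \<pi> ` L"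
      using exists_maximal_multiple[of "\<lambda>p. p \<odot>\<^bsub>C\<^esub> c0 \<notin> \<pi> ` L"] c0 by auto
    \<comment> \<open>This multiple of \<open>c0\<close> lies outside \<pi> L, while m moves it into
      \<pi> L.\<close>
    define c where "c = p \<odot>\<^bsub>C\<^esub> c0"
    have c: "c \<in> carrier C" "c \<notin> \<pi> ` L" using p c0 by (simp_all add: c_def)
    have "\<exists>l\<in>L. \<pi> l = r \<odot>\<^bsub>C\<^esub> c" if "r \<in> max_ideal R" for r
      using p(3)[OF that] p(1) c0 max_ideal_closed[OF that]
      by (auto simp: c_def C.smult_assoc1)
    \<comment> \<open>\<open>f r\<close> is the preimage of r c in \<open>L\<close>. Because \<pi>
      is injective on \<open>L\<close>, this is a homomorphism from m to \<open>B\<close>, and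
      injectivity of \<open>B\<close> makes it multiplication by some \<open>b0\<close>.\<close>
    then obtain f where f: "\<And>r. r \<in> max_ideal R \<Longrightarrow> f r \<in> L"
        "\<And>r. r \<in> max_ideal R \<Longrightarrow> \<pi> (f r) = r \<odot>\<^bsub>C\<^esub> c" by metis
    have "\<exists>q\<in>carrier B. \<forall>r\<in>max_ideal R. f r = r \<odot>\<^bsub>B\<^esub> q"
    proof (rule injective_module_lift_ideal[OF is_cring B max_ideal_ideal])
      show "f r \<in> carrier B" if "r \<in> max_ideal R" for r using f(1)[OF that] Lc by blast
      show "f (r \<oplus> s) = f r \<oplus>\<^bsub>B\<^esub> f s" if "r \<in> max_ideal R" "s \<in> max_ideal R" for r s
        using that f LE(5) Lc c(1) max_ideal_closed
        by (intro inj) (simp_all add: mod_hom_add[OF \<pi>(1)] C.smult_l_distr m.a_closed)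
      show "f (r \<otimes> s) = r \<odot>\<^bsub>B\<^esub> f s" if "r \<in> carrier R" "s \<in> max_ideal R" for r s
        using that f LE(4) Lc c(1) max_ideal_closed
        by (intro inj) (simp_all add: mod_hom_smult[OF \<pi>(1)] C.smult_assoc1 m.I_l_closed)
    qed
    then obtain b0 where b0: "b0 \<in> carrier B" "\<And>r. r \<in> max_ideal R \<Longrightarrow> f r = r \<odot>\<^bsub>B\<^esub> b0" by blast
    \<comment> \<open>\<pi> b0 and c agree after multiplication by m, so their difference is a socle
      element. Subtracting a socle lift of it from \<open>b0\<close> keeps the action of m and gives
      an exact preimage of c.\<close>
    have "r \<odot>\<^bsub>C\<^esub> (\<pi> b0 \<ominus>\<^bsub>C\<^esub> c) = \<zero>\<^bsub>C\<^esub>" if "r \<in> max_ideal R" for r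
    proof -
      have "r \<odot>\<^bsub>C\<^esub> \<pi> b0 = r \<odot>\<^bsub>C\<^esub> c"
        using mod_hom_smult[OF \<pi>(1) _ b0(1), of r] b0(2) f(2) that max_ideal_closed by metis
      then show ?thesis
        using that max_ideal_closed \<pi>c[OF b0(1)] c(1)
        by (simp add: a_minus_def C.smult_r_distr C.smult_r_minus C.M.r_neg)
    qed
    then obtain b1 where b1: "b1 \<in> carrier B" "\<pi> b1 = \<pi> b0 \<ominus>\<^bsub>C\<^esub> c"
        "\<And>r. r \<in> max_ideal R \<Longrightarrow> r \<odot>\<^bsub>B\<^esub> b1 = \<zero>\<^bsub>B\<^esub>"
      using socle_lift[OF Bm C \<pi>, of "\<pi> b0 \<ominus>\<^bsub>C\<^esub> c"] \<pi>c[OF b0(1)] c(1) by auto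
    define b where "b = b0 \<ominus>\<^bsub>B\<^esub> b1"
    have b: "b \<in> carrier B" using b0 b1 by (simp add: b_def)
    have "\<pi> b = \<pi> b0 \<ominus>\<^bsub>C\<^esub> (\<pi> b0 \<ominus>\<^bsub>C\<^esub> c)"
      using mod_hom_diff[OF Bm Cm \<pi>(1) b0(1) b1(1)] b1(2) by (simp add: b_def)
    also have "\<dots> = c"
      using \<pi>c[OF b0(1)] c(1) by (simp add: a_minus_def C.M.minus_add C.M.a_assoc[symmetric] C.M.r_neg)
    finally have \<pi>b: "\<pi> b = c" .
    have mb: "r \<odot>\<^bsub>B\<^esub> b \<in> L" if "r \<in> max_ideal R" for r
    proof -
      have "r \<odot>\<^bsub>B\<^esub> b = r \<odot>\<^bsub>B\<^esub> b0"
        using b0(1) b1(1) b1(3)[OF that] max_ideal_closed[OF that]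
        by (simp add: b_def a_minus_def B.smult_r_distr B.smult_r_minus)
      then show ?thesis using f(1) b0(2) that by metis
    qed
    define L' where "L' = {l \<oplus>\<^bsub>B\<^esub> s \<odot>\<^bsub>B\<^esub> b | l s. l \<in> L \<and> s \<in> carrier R}"
    have L': "submodule L' R B" unfolding L'_def by (rule sum_cyclic_submodule[OF Bm L(1) b])
    have I: "l \<oplus>\<^bsub>B\<^esub> s \<odot>\<^bsub>B\<^esub> b \<in> L'" if "l \<in> L" "s \<in> carrier R" for l s
      using that unfolding L'_def by blast
    have LL': "L \<subseteq> L'" using I[of _ \<zero>] Lc b by auto
    have bL': "b \<in> L'" using I[OF submodule_zero[OF L(1)], of \<one>] b by simp
    have "y = \<zero>\<^bsub>B\<^esub>" if y: "y \<in> L'" "y \<in> K" for y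
    proof -
      obtain l s where ls: "l \<in> L" "s \<in> carrier R" "y = l \<oplus>\<^bsub>B\<^esub> s \<odot>\<^bsub>B\<^esub> b"
        using y(1) unfolding L'_def by blast
      \<comment> \<open>A unit coefficient would put c into \<pi> L; a coefficient in m puts y into
        \<open>L\<close>, which meets the kernel only in zero.\<close>
      show ?thesis
      proof (cases "s \<in> Units R")
        case True
        have "\<pi> l \<oplus>\<^bsub>C\<^esub> s \<odot>\<^bsub>C\<^esub> c = \<zero>\<^bsub>C\<^esub>"
          using y(2) ls b Lc \<pi>b by (simp add: K_def mod_hom_add[OF \<pi>(1)] mod_hom_smult[OF \<pi>(1)])
        then have "s \<odot>\<^bsub>C\<^esub> c = \<ominus>\<^bsub>C\<^esub> \<pi> l"
          using ls(1,2) Lc \<pi>c c(1) by (metis C.M.minus_equality C.M.a_comm C.smult_closed)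
        also have "\<dots> = \<pi> (\<ominus>\<^bsub>B\<^esub> l)" using mod_hom_uminus[OF Bm Cm \<pi>(1)] ls(1) Lc by simp
        finally have "\<pi> (inv s \<odot>\<^bsub>B\<^esub> (\<ominus>\<^bsub>B\<^esub> l)) = inv s \<odot>\<^bsub>C\<^esub> (s \<odot>\<^bsub>C\<^esub> c)"
          using mod_hom_smult[OF \<pi>(1), of "inv s" "\<ominus>\<^bsub>B\<^esub> l"] True ls(1) Lc by simp
        also have "\<dots> = c" using True c(1) ls(2) by (simp add: C.smult_assoc1[symmetric])
        finally have "c \<in> \<pi> ` L"
          using LE(3,4) ls(1) True by (metis Units_inv_closed imageI)
        then show ?thesis using c(2) by simp
      next
        case False
        then have "y \<in> L" using ls mb LE(5) not_Units_max_ideal by simp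
        then show ?thesis using L(2) y(2) by blast
      qed
    qed
    moreover have "\<zero>\<^bsub>B\<^esub> \<in> L'" "\<zero>\<^bsub>B\<^esub> \<in> K" using submodule_zero[OF L'] L(2) by auto
    ultimately have "L' \<inter> K = {\<zero>\<^bsub>B\<^esub>}" by blast
    then have "b \<in> L" using max[OF L' _ LL'] bL' by simp
    then show False using \<pi>b c(2) by blast
  qed
  then have "\<pi> ` L = carrier C" using \<pi>c Lc by blast
  then show ?thesis using L unfolding K_def by blast
qed

text \<open>With \<open>L\<close> a complement of the kernel \<open>K\<close>, the projection of
  \<open>B\<close> onto \<open>K\<close> along \<open>L\<close> retracts the inclusion of
  \<open>K\<close>.\<close>

lemma kernel_injective:
  assumes B: "injective_module R B" and C: "injective_module R C"
    and \<pi>: "\<pi> \<in> mod_hom R B C" "\<pi> ` carrier B = carrier C"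
  shows "injective_module R (B\<lparr>carrier := {x \<in> carrier B. \<pi> x = \<zero>\<^bsub>C\<^esub>}\<rparr>)"
proof -
  have Bm: "module R B" and Cm: "module R C" using B C by (simp_all add: injective_module_def)
  interpret B: module R B by fact
  interpret C: module R C by fact
  define K where "K = {x \<in> carrier B. \<pi> x = \<zero>\<^bsub>C\<^esub>}"
  have Ks: "submodule K R B" unfolding K_def by (rule kernel_submodule[OF Bm Cm \<pi>(1)])
  have Km: "module R (B\<lparr>carrier := K\<rparr>)" by (rule submodule.submodule_is_module[OF Ks Bm])
  obtain L where L: "submodule L R B" "L \<inter> K = {\<zero>\<^bsub>B\<^esub>}" "\<pi> ` L = carrier C"
    using kernel_complement[OF assms] unfolding K_def by blast
  note LE = B.submoduleE[OF L(1)] and KE = B.submoduleE[OF Ks]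
  have Lc: "l \<in> carrier B" if "l \<in> L" for l using LE(1) that by blast
  have Kc: "l \<in> carrier B" if "l \<in> K" for l using KE(1) that by blast
  \<comment> \<open>\<rho> x is the element of \<open>K\<close> for which x - \<rho> x lies in
    \<open>L\<close>; it exists because \<pi> x has a preimage in \<open>L\<close>.\<close>
  have "\<exists>\<rho>\<in>mod_hom R B (B\<lparr>carrier := K\<rparr>). \<forall>x\<in>carrier B. x \<ominus>\<^bsub>B\<^esub> \<rho> x \<in> L"
  proof (rule mod_hom_of_relation[OF Bm _ _ Km])
    fix x assume x: "x \<in> carrier B"
    then obtain l where l: "l \<in> L" "\<pi> l = \<pi> x"
      using L(3) mod_hom_closed[OF \<pi>(1) x] by (metis imageE)
    have "\<pi> (x \<ominus>\<^bsub>B\<^esub> l) = \<zero>\<^bsub>C\<^esub>"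
      using mod_hom_diff[OF Bm Cm \<pi>(1) x] l Lc mod_hom_closed[OF \<pi>(1) x] by (simp add: a_minus_def C.M.r_neg)
    then have "x \<ominus>\<^bsub>B\<^esub> l \<in> K" using x l Lc by (simp add: K_def)
    moreover have "x \<ominus>\<^bsub>B\<^esub> (x \<ominus>\<^bsub>B\<^esub> l) = l"
      using x l(1) Lc by (simp add: a_minus_def B.M.minus_add B.M.a_assoc[symmetric] B.M.r_neg)
    ultimately show "\<exists>y\<in>carrier (B\<lparr>carrier := K\<rparr>). x \<ominus>\<^bsub>B\<^esub> y \<in> L"
      using l(1) by (intro bexI[of _ "x \<ominus>\<^bsub>B\<^esub> l"]) simp_all
  next
    fix x y z assume x: "x \<in> carrier B" and yz: "y \<in> carrier (B\<lparr>carrier := K\<rparr>)"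
      "z \<in> carrier (B\<lparr>carrier := K\<rparr>)" "x \<ominus>\<^bsub>B\<^esub> y \<in> L" "x \<ominus>\<^bsub>B\<^esub> z \<in> L"
    then have yc: "y \<in> carrier B" "z \<in> carrier B" using Kc by auto
    have "(x \<ominus>\<^bsub>B\<^esub> z) \<ominus>\<^bsub>B\<^esub> (x \<ominus>\<^bsub>B\<^esub> y) = (x \<oplus>\<^bsub>B\<^esub> \<ominus>\<^bsub>B\<^esub> x) \<oplus>\<^bsub>B\<^esub> (y \<oplus>\<^bsub>B\<^esub> \<ominus>\<^bsub>B\<^esub> z)"
      using x yc by (simp add: a_minus_def B.M.minus_add B.M.a_ac)
    also have "\<dots> = y \<ominus>\<^bsub>B\<^esub> z" using x yc by (simp add: a_minus_def B.M.r_neg)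
    finally have "y \<ominus>\<^bsub>B\<^esub> z \<in> L \<inter> K"
      using submodule_diff[OF Bm L(1) yz(4,3)] submodule_diff[OF Bm Ks] yz(1,2) by simp
    then have "y \<ominus>\<^bsub>B\<^esub> z \<oplus>\<^bsub>B\<^esub> z = z" using L(2) yc by simp
    then show "y = z" using yc by (simp add: a_minus_def B.M.a_assoc B.M.l_neg)
  next
    fix x x' y y' assume *: "x \<in> carrier B" "x' \<in> carrier B" "y \<in> carrier (B\<lparr>carrier := K\<rparr>)"
      "y' \<in> carrier (B\<lparr>carrier := K\<rparr>)" "x \<ominus>\<^bsub>B\<^esub> y \<in> L" "x' \<ominus>\<^bsub>B\<^esub> y' \<in> L"
    then have yc: "y \<in> carrier B" "y' \<in> carrier B" using Kc by auto
    have "x \<oplus>\<^bsub>B\<^esub> x' \<ominus>\<^bsub>B\<^esub> (y \<oplus>\<^bsub>B\<^esub> y') = (x \<ominus>\<^bsub>B\<^esub> y) \<oplus>\<^bsub>B\<^esub> (x' \<ominus>\<^bsub>B\<^esub> y')"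
      using *(1,2) yc by (simp add: a_minus_def B.M.minus_add B.M.a_ac)
    then show "x \<oplus>\<^bsub>B\<^esub> x' \<ominus>\<^bsub>B\<^esub> (y \<oplus>\<^bsub>B\<lparr>carrier := K\<rparr>\<^esub> y') \<in> L" using LE(5) *(5,6) by simp
  next
    fix r x y assume *: "r \<in> carrier R" "x \<in> carrier B" "y \<in> carrier (B\<lparr>carrier := K\<rparr>)" "x \<ominus>\<^bsub>B\<^esub> y \<in> L"
    then have yc: "y \<in> carrier B" using Kc by auto
    have "r \<odot>\<^bsub>B\<^esub> x \<ominus>\<^bsub>B\<^esub> r \<odot>\<^bsub>B\<^esub> y = r \<odot>\<^bsub>B\<^esub> (x \<ominus>\<^bsub>B\<^esub> y)"
      using *(1,2) yc by (simp add: a_minus_def B.smult_r_distr B.smult_r_minus)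
    then show "r \<odot>\<^bsub>B\<^esub> x \<ominus>\<^bsub>B\<^esub> (r \<odot>\<^bsub>B\<lparr>carrier := K\<rparr>\<^esub> y) \<in> L" using LE(4) *(1,4) by simp
  qed
  then obtain \<rho> where \<rho>: "\<rho> \<in> mod_hom R B (B\<lparr>carrier := K\<rparr>)" "\<And>x. x \<in> carrier B \<Longrightarrow> x \<ominus>\<^bsub>B\<^esub> \<rho> x \<in> L"
    by blast
  have "\<rho> x = x" if x: "x \<in> K" for x
  proof -
    have \<rho>x: "\<rho> x \<in> K" using mod_hom_closed[OF \<rho>(1) Kc[OF x]] by simp
    then have "x \<ominus>\<^bsub>B\<^esub> \<rho> x \<in> L \<inter> K"
      using \<rho>(2)[OF Kc[OF x]] submodule_diff[OF Bm Ks x] by simp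
    then have "x \<ominus>\<^bsub>B\<^esub> \<rho> x \<oplus>\<^bsub>B\<^esub> \<rho> x = \<rho> x" using L(2) Kc[OF \<rho>x] by simp
    then show ?thesis using Kc[OF x] Kc[OF \<rho>x] by (simp add: a_minus_def B.M.a_assoc B.M.l_neg)
  qed
  then show ?thesis
    using injective_module_retract[OF B Km mod_hom_inclusion[OF Bm Ks] \<rho>(1)] by (simp add: K_def)
qed

text \<open>\<open>Z j\<close> is the kernel of \<open>d j\<close>. By exactness \<open>d j\<close>
  maps \<open>Q j\<close> onto \<open>Z (Suc j)\<close>, so \<open>kernel_injective\<close> moves
  injectivity one step to the left, from the vanishing terms down to \<open>Z 0\<close>, which is a
  copy of R through \<epsilon>.\<close>

lemma gorenstein_self_injective:
  assumes "gorenstein_ring R"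
  shows "injective_module R (self_module R)"
proof -
  obtain \<epsilon> and Q :: "nat \<Rightarrow> ('a, 'a list) module" and d n where
    res: "injective_resolution R (self_module R) \<epsilon> Q d"
    and fin: "\<And>j. j > n \<Longrightarrow> carrier (Q j) = {\<zero>\<^bsub>Q j\<^esub>}"
    using assms unfolding gorenstein_ring_def by blast
  have Q: "injective_module R (Q j)" and d: "d j \<in> mod_hom R (Q j) (Q (Suc j))"
    and dd: "d j ` carrier (Q j) = {x \<in> carrier (Q (Suc j)). d (Suc j) x = \<zero>\<^bsub>Q (Suc (Suc j))\<^esub>}" for j
    using res unfolding injective_resolution_def by blast+
  have \<epsilon>: "\<epsilon> \<in> mod_hom R (self_module R) (Q 0)" "inj_on \<epsilon> (carrier (self_module R))"
    "\<epsilon> ` carrier (self_module R) = {x \<in> carrier (Q 0). d 0 x = \<zero>\<^bsub>Q (Suc 0)\<^esub>}"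
    using res unfolding injective_resolution_def by blast+
  have Qm: "module R (Q j)" for j using Q by (simp add: injective_module_def)
  define Z where "Z j = (Q j)\<lparr>carrier := {x \<in> carrier (Q j). d j x = \<zero>\<^bsub>Q (Suc j)\<^esub>}\<rparr>" for j
  have step: "injective_module R (Z j)" if Z: "injective_module R (Z (Suc j))" for j
  proof -
    have "d j \<in> mod_hom R (Q j) (Z (Suc j))"
      using d[of j] dd[of j] by (auto simp: mod_hom_def Z_def PiE_iff)
    moreover have "d j ` carrier (Q j) = carrier (Z (Suc j))" using dd[of j] by (simp add: Z_def)
    ultimately show ?thesis
      using kernel_injective[OF Q Z] by (simp add: Z_def)
  qed
  have base: "injective_module R (Z j)" if "j > n" for j
  proof -
    have "carrier (Q j) = {x \<in> carrier (Q j). d j x = \<zero>\<^bsub>Q (Suc j)\<^esub>}"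
      using fin[OF that] mod_hom_zero[OF Qm Qm d] by auto
    then have "Z j = Q j" by (simp add: Z_def)
    then show ?thesis using Q by simp
  qed
  \<comment> \<open>Truncated subtraction turns the descent into an induction on \<open>k\<close>:
    \<open>k = 0\<close> is the range beyond \<open>n\<close>, and \<open>k = Suc n\<close> includes
    \<open>j = 0\<close>.\<close>
  have "injective_module R (Z j)" if "j \<ge> Suc n - k" for j k
    using that
  proof (induction k arbitrary: j)
    case 0
    then show ?case using base by simp
  next
    case (Suc k)
    then have "Suc j \<ge> Suc n - k" by simp
    then show ?case using Suc.IH step by blast
  qed
  then have Z0: "injective_module R (Z 0)" by (metis diff_self_eq_0 le_refl)
  then have Zm: "module R (Z 0)" by (simp add: injective_module_def)
  have self: "module R (self_module R)" by (rule self_module_module[OF is_cring])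
  have Zc: "carrier (Z 0) = \<epsilon> ` carrier R" using \<epsilon>(3) by (simp add: Z_def)
  have \<epsilon>Z: "\<epsilon> \<in> mod_hom R (self_module R) (Z 0)"
    using \<epsilon>(1,3) by (auto simp: mod_hom_def Z_def PiE_iff)
  \<comment> \<open>\<open>b\<close> is the inverse of \<epsilon> on its image.\<close>
  have "\<exists>b\<in>mod_hom R (Z 0) (self_module R). \<forall>z\<in>carrier (Z 0). \<epsilon> (b z) = z"
  proof (rule mod_hom_of_relation[OF Zm _ _ self])
    show "\<exists>y\<in>carrier (self_module R). \<epsilon> y = x" if "x \<in> carrier (Z 0)" for x
      using that Zc by auto
    show "y = z" if "y \<in> carrier (self_module R)" "z \<in> carrier (self_module R)" "\<epsilon> y = x" "\<epsilon> z = x" for x y z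
      using that \<epsilon>(2) by (simp add: inj_on_def)
    show "\<epsilon> (y \<oplus>\<^bsub>self_module R\<^esub> y') = x \<oplus>\<^bsub>Z 0\<^esub> x'"
      if "y \<in> carrier (self_module R)" "y' \<in> carrier (self_module R)" "\<epsilon> y = x" "\<epsilon> y' = x'" for x x' y y'
      using mod_hom_add[OF \<epsilon>Z that(1,2)] that(3,4) by simp
    show "\<epsilon> (r \<odot>\<^bsub>self_module R\<^esub> y) = r \<odot>\<^bsub>Z 0\<^esub> x"
      if "r \<in> carrier R" "y \<in> carrier (self_module R)" "\<epsilon> y = x" for r x y
      using mod_hom_smult[OF \<epsilon>Z that(1,2)] that(3) by simp
  qed
  then obtain b where b: "b \<in> mod_hom R (Z 0) (self_module R)" "\<And>z. z \<in> carrier (Z 0) \<Longrightarrow> \<epsilon> (b z) = z"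
    by blast
  have "b (\<epsilon> x) = x" if "x \<in> carrier (self_module R)" for x
  proof -
    have "\<epsilon> x \<in> carrier (Z 0)" using \<epsilon>Z that by (rule mod_hom_closed)
    then show ?thesis
      using b(2) mod_hom_closed[OF b(1)] \<epsilon>(2) that by (meson inj_onD)
  qed
  then show ?thesis by (rule injective_module_retract[OF Z0 self \<epsilon>Z b(1)])
qed

text \<open>\<open>e\<close> may be any nonzero element killed by m. A nonzero x has a nonzero
  multiple p x that m kills, and self-injectivity gives an endomorphism with p x \<mapsto> e.
  Endomorphisms of R are multiplications, so \<open>e\<close> is a multiple of x.\<close>

lemma self_injective_socle_generator:
  assumes inj: "injective_module R (self_module R)"
  shows "\<exists>e. socle_generator R (self_module R) e"
proof -
  have self: "module R (self_module R)" by (rule self_module_module[OF is_cring])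
  obtain e where e: "e \<in> carrier R" "e \<noteq> \<zero>" "\<And>r. r \<in> max_ideal R \<Longrightarrow> r \<otimes> e = \<zero>"
    using exists_socle_element by blast
  have "\<exists>r\<in>carrier R. r \<otimes> x = e" if x: "x \<in> carrier R" "x \<noteq> \<zero>" for x
  proof -
    obtain p where p: "p \<in> carrier R" "p \<otimes> x \<noteq> \<zero>" "\<And>r. r \<in> max_ideal R \<Longrightarrow> (r \<otimes> p) \<otimes> x = \<zero>"
      using exists_maximal_multiple[of "\<lambda>p. p \<otimes> x \<noteq> \<zero>"] x by auto
    have "r \<otimes> e = \<zero>" if "r \<in> carrier R" "r \<otimes> (p \<otimes> x) = \<zero>" for r
      using Units_smult_eq_zero[OF self, of r "p \<otimes> x"] that p(1,2) x(1) not_Units_max_ideal e(3) by auto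
    then obtain g where g: "g \<in> mod_hom R (self_module R) (self_module R)" "g (p \<otimes> x) = e"
      using injective_module_lift_cyclic[OF inj self, of "p \<otimes> x" e] p(1) x(1) e(1) by auto
    have g1: "g \<one> \<in> carrier R" using mod_hom_closed[OF g(1)] by simp
    have "e = (p \<otimes> x) \<otimes> g \<one>"
      using mod_hom_smult[OF g(1), of "p \<otimes> x" \<one>] g(2) p(1) x(1) by simp
    then have "(p \<otimes> g \<one>) \<otimes> x = e" using p(1) x(1) g1 by (simp add: m_ac)
    then show ?thesis using p(1) g1 by blast
  qed
  then show ?thesis using e by (auto simp: socle_generator_def)
qed

end


section \<open>Coinduction along a surjective ring homomorphism\<close>

text \<open>
  Up to isomorphism this is \<open>Hom\<^sub>R(S, M)\<close>, realised on the elements of \<open>M\<close> annihilated by the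
  kernel of \<open>q\<close>.
\<close>

definition coinduced_module ::
  "('r, 'x) ring_scheme \<Rightarrow> ('s, 'y) ring_scheme \<Rightarrow> ('r \<Rightarrow> 's) \<Rightarrow> ('r, 'm, 'z) module_scheme \<Rightarrow> ('s, 'm) module"
  where
  "coinduced_module R S q M =
     \<lparr>carrier = {x \<in> carrier M. \<forall>r\<in>carrier R. q r = \<zero>\<^bsub>S\<^esub> \<longrightarrow> r \<odot>\<^bsub>M\<^esub> x = \<zero>\<^bsub>M\<^esub>},
      monoid.mult = undefined, one = undefined,
      ring.zero = ring.zero M, ring.add = ring.add M,
      smult = (\<lambda>s x. (SOME r. r \<in> carrier R \<and> q r = s) \<odot>\<^bsub>M\<^esub> x)\<rparr>"

definition restrict_scalars :: "('r \<Rightarrow> 's) \<Rightarrow> ('s, 'm, 'z) module_scheme \<Rightarrow> ('r, 'm) module" where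
  "restrict_scalars q M =
     \<lparr>carrier = carrier M, monoid.mult = undefined, one = undefined,
      ring.zero = ring.zero M, ring.add = ring.add M, smult = (\<lambda>r x. q r \<odot>\<^bsub>M\<^esub> x)\<rparr>"

locale local_surjection = R: local_ring R + S: local_ring S
  for R (structure) and S (structure) +
  fixes q
  assumes hom: "q \<in> ring_hom R S" and surj: "q ` carrier R = carrier S"
begin

sublocale ring_hom_cring R S q
  by unfold_locales (rule hom)

lemma lift: "s \<in> carrier S \<Longrightarrow> \<exists>r\<in>carrier R. q r = s"
  using surj by (metis imageE)

lemma kernel_max_ideal:
  assumes "r \<in> carrier R" "q r = \<zero>\<^bsub>S\<^esub>" shows "r \<in> max_ideal R"
proof (rule R.not_Units_max_ideal[OF assms(1)])
  show "r \<notin> Units R"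
  proof
    assume u: "r \<in> Units R"
    then have "q (r \<otimes>\<^bsub>R\<^esub> inv\<^bsub>R\<^esub> r) = \<zero>\<^bsub>S\<^esub>" using assms by (simp del: R.Units_r_inv)
    then show False using u S.zero_neq_one by simp
  qed
qed

text \<open>Units go to units. Conversely, if q r is a unit and t lifts its inverse, then 1 - r t
  lies in the kernel, hence in m; with r in m this would put 1 into m.\<close>

lemma max_ideal_image_iff:
  assumes r: "r \<in> carrier R"
  shows "q r \<in> max_ideal S \<longleftrightarrow> r \<in> max_ideal R"
proof
  assume qr: "q r \<in> max_ideal S"
  show "r \<in> max_ideal R"
  proof (rule R.not_Units_max_ideal[OF r], rule notI)
    assume u: "r \<in> Units R"
    then have "q r \<otimes>\<^bsub>S\<^esub> q (inv\<^bsub>R\<^esub> r) = \<one>\<^bsub>S\<^esub>" "q (inv\<^bsub>R\<^esub> r) \<otimes>\<^bsub>S\<^esub> q r = \<one>\<^bsub>S\<^esub>"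
      using r by (simp_all add: hom_mult[symmetric] del: hom_mult)
    then have "q r \<in> Units S"
      using u r unfolding Units_def[of S] by (auto intro!: bexI[of _ "q (inv\<^bsub>R\<^esub> r)"])
    then show False using qr S.max_ideal_not_Units by blast
  qed
next
  interpret m: ideal "max_ideal R" R by (rule R.max_ideal_ideal)
  assume rm: "r \<in> max_ideal R"
  show "q r \<in> max_ideal S"
  proof (rule S.not_Units_max_ideal, simp add: r, rule notI)
    assume u: "q r \<in> Units S"
    then obtain t where t: "t \<in> carrier R" "q t = inv\<^bsub>S\<^esub> q r" using lift by blast
    then have "q (r \<otimes>\<^bsub>R\<^esub> t) = \<one>\<^bsub>S\<^esub>" using u r by simp
    then have "q (\<one>\<^bsub>R\<^esub> \<ominus>\<^bsub>R\<^esub> r \<otimes>\<^bsub>R\<^esub> t) = \<zero>\<^bsub>S\<^esub>"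
      using r t(1) by (simp add: a_minus_def S.r_neg del: hom_mult)
    then have "\<one>\<^bsub>R\<^esub> \<ominus>\<^bsub>R\<^esub> r \<otimes>\<^bsub>R\<^esub> t \<in> max_ideal R" using r t(1) by (intro kernel_max_ideal) auto
    moreover have "r \<otimes>\<^bsub>R\<^esub> t \<in> max_ideal R" using rm t(1) by (simp add: m.I_r_closed)
    ultimately have "(\<one>\<^bsub>R\<^esub> \<ominus>\<^bsub>R\<^esub> r \<otimes>\<^bsub>R\<^esub> t) \<oplus>\<^bsub>R\<^esub> r \<otimes>\<^bsub>R\<^esub> t \<in> max_ideal R" by (rule m.a_closed)
    then show False using r t(1) R.one_not_max_ideal by (simp add: a_minus_def R.a_assoc R.l_neg)
  qed
qed

lemma restrict_scalars_module:
  assumes "module S M" shows "module R (restrict_scalars q M)"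
proof -
  interpret M: module S M by fact
  have "abelian_group (restrict_scalars q M)"
  proof (rule abelian_groupI, goal_cases)
    case (6 x)
    then show ?case by (intro bexI[of _ "\<ominus>\<^bsub>M\<^esub> x"]) (auto simp: restrict_scalars_def M.M.l_neg)
  qed (auto simp: restrict_scalars_def M.M.a_ac)
  then show ?thesis
    by (intro moduleI[OF R.is_cring])
      (auto simp: restrict_scalars_def M.smult_l_distr M.smult_r_distr M.smult_assoc1)
qed

context
  fixes M :: "('a, 'm, 'z) module_scheme"
  assumes M: "module R M"
begin

interpretation M: module R M by (rule M)

lemma coinduced_carrier:
  "x \<in> carrier (coinduced_module R S q M) \<longleftrightarrow>
     x \<in> carrier M \<and> (\<forall>r\<in>carrier R. q r = \<zero>\<^bsub>S\<^esub> \<longrightarrow> r \<odot>\<^bsub>M\<^esub> x = \<zero>\<^bsub>M\<^esub>)"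
  by (simp add: coinduced_module_def)

lemma coinduced_simps [simp]:
  "x \<oplus>\<^bsub>coinduced_module R S q M\<^esub> y = x \<oplus>\<^bsub>M\<^esub> y" "\<zero>\<^bsub>coinduced_module R S q M\<^esub> = \<zero>\<^bsub>M\<^esub>"
  by (simp_all add: coinduced_module_def)

text \<open>The definition of the action picks some lift of the scalar. Two lifts differ by an
  element of the kernel of \<open>q\<close>, which kills x, so any lift may be used.\<close>

lemma coinduced_smult:
  assumes x: "x \<in> carrier (coinduced_module R S q M)" and r: "r \<in> carrier R"
  shows "q r \<odot>\<^bsub>coinduced_module R S q M\<^esub> x = r \<odot>\<^bsub>M\<^esub> x"
proof -
  define t where "t = (SOME t. t \<in> carrier R \<and> q t = q r)"
  have t: "t \<in> carrier R" "q t = q r"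
    using someI[of "\<lambda>t. t \<in> carrier R \<and> q t = q r" r] r by (simp_all add: t_def)
  have xM: "x \<in> carrier M" using x by (simp add: coinduced_carrier)
  have "q (t \<ominus>\<^bsub>R\<^esub> r) = \<zero>\<^bsub>S\<^esub>" using t r by (simp add: a_minus_def S.r_neg)
  then have "(t \<ominus>\<^bsub>R\<^esub> r) \<odot>\<^bsub>M\<^esub> x = \<zero>\<^bsub>M\<^esub>" using x t r by (simp add: coinduced_carrier)
  then have "t \<odot>\<^bsub>M\<^esub> x \<oplus>\<^bsub>M\<^esub> \<ominus>\<^bsub>M\<^esub> (r \<odot>\<^bsub>M\<^esub> x) = \<zero>\<^bsub>M\<^esub>"
    using t r xM by (simp add: a_minus_def M.smult_l_distr M.smult_l_minus)
  then have "t \<odot>\<^bsub>M\<^esub> x = r \<odot>\<^bsub>M\<^esub> x"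
    using t(1) r xM by (metis M.M.minus_equality M.M.a_inv_closed M.M.minus_minus M.smult_closed)
  then show ?thesis by (simp add: coinduced_module_def t_def)
qed

lemma coinduced_submodule: "submodule (carrier (coinduced_module R S q M)) R M"
proof (rule submoduleI_smult[OF M])
  fix r x assume r: "r \<in> carrier R" and x: "x \<in> carrier (coinduced_module R S q M)"
  have "t \<odot>\<^bsub>M\<^esub> (r \<odot>\<^bsub>M\<^esub> x) = r \<odot>\<^bsub>M\<^esub> (t \<odot>\<^bsub>M\<^esub> x)" if "t \<in> carrier R" for t
    using that r x by (simp add: coinduced_carrier M.smult_assoc1[symmetric] R.m_comm)
  then show "r \<odot>\<^bsub>M\<^esub> x \<in> carrier (coinduced_module R S q M)"
    using r x by (simp add: coinduced_carrier)
qed (auto simp: coinduced_carrier M.smult_r_distr)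

lemma coinduced_module_module: "module S (coinduced_module R S q M)"
proof -
  note sub = M.submoduleE[OF coinduced_submodule]
  have cM: "x \<in> carrier M" if "x \<in> carrier (coinduced_module R S q M)" for x
    using that by (simp add: coinduced_carrier)
  have ag: "abelian_group (coinduced_module R S q M)"
  proof (rule abelian_groupI, goal_cases)
    case (6 x)
    then show ?case
      using sub(3)[of x] cM[of x] by (intro bexI[of _ "\<ominus>\<^bsub>M\<^esub> x"]) (auto simp: M.M.l_neg)
  qed (auto simp: M.M.a_ac cM sub(5) submodule_zero[OF coinduced_submodule])
  show ?thesis
  proof (rule moduleI[OF S.is_cring ag])
    fix s x assume s: "s \<in> carrier S" and x: "x \<in> carrier (coinduced_module R S q M)"
    then obtain r where r: "r \<in> carrier R" "s = q r" using lift by blast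
    then show "s \<odot>\<^bsub>coinduced_module R S q M\<^esub> x \<in> carrier (coinduced_module R S q M)"
      using x sub(4) by (simp add: coinduced_smult)
  next
    fix s t x assume s: "s \<in> carrier S" "t \<in> carrier S" and x: "x \<in> carrier (coinduced_module R S q M)"
    then obtain a b where ab: "a \<in> carrier R" "s = q a" "b \<in> carrier R" "t = q b" using lift by metis
    then have "s \<oplus>\<^bsub>S\<^esub> t = q (a \<oplus>\<^bsub>R\<^esub> b)" "s \<otimes>\<^bsub>S\<^esub> t = q (a \<otimes>\<^bsub>R\<^esub> b)" by simp_all
    then show "(s \<oplus>\<^bsub>S\<^esub> t) \<odot>\<^bsub>coinduced_module R S q M\<^esub> x =
        s \<odot>\<^bsub>coinduced_module R S q M\<^esub> x \<oplus>\<^bsub>coinduced_module R S q M\<^esub> t \<odot>\<^bsub>coinduced_module R S q M\<^esub> x"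
      "s \<otimes>\<^bsub>S\<^esub> t \<odot>\<^bsub>coinduced_module R S q M\<^esub> x =
        s \<odot>\<^bsub>coinduced_module R S q M\<^esub> (t \<odot>\<^bsub>coinduced_module R S q M\<^esub> x)"
      using ab x cM[OF x] sub(4)[OF ab(3) x]
      by (simp_all add: coinduced_smult M.smult_l_distr M.smult_assoc1 del: hom_add hom_mult)
  next
    fix s x y assume s: "s \<in> carrier S" and x: "x \<in> carrier (coinduced_module R S q M)"
      "y \<in> carrier (coinduced_module R S q M)"
    then obtain r where r: "r \<in> carrier R" "s = q r" using lift by blast
    then show "s \<odot>\<^bsub>coinduced_module R S q M\<^esub> (x \<oplus>\<^bsub>coinduced_module R S q M\<^esub> y) =
        s \<odot>\<^bsub>coinduced_module R S q M\<^esub> x \<oplus>\<^bsub>coinduced_module R S q M\<^esub> s \<odot>\<^bsub>coinduced_module R S q M\<^esub> y"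
      using x cM sub(5)[OF x] by (simp add: coinduced_smult M.smult_r_distr)
  next
    fix x assume x: "x \<in> carrier (coinduced_module R S q M)"
    show "\<one>\<^bsub>S\<^esub> \<odot>\<^bsub>coinduced_module R S q M\<^esub> x = x"
      using coinduced_smult[OF x R.one_closed] cM[OF x] by simp
  qed
qed

end

text \<open>An S-linear map into the coinduced module amounts to an R-linear map into
  \<open>E\<close> from the module with restricted scalars, so the extension problem is solved over
  \<open>R\<close>. The extension takes values in the coinduced module, because the kernel of
  \<open>q\<close> acts as zero on its source.\<close>

lemma coinduced_injective:
  assumes E: "injective_module R E"
  shows "injective_module S (coinduced_module R S q E)"
proof -
  have Em: "module R E" using E by (simp add: injective_module_def)
  interpret E: module R E by fact
  show ?thesis
    unfolding injective_module_def
  proof (intro conjI allI impI coinduced_module_module[OF Em])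
    fix M N :: "('c, 'c) module" and i f
    assume *: "module S M \<and> module S N \<and> i \<in> mod_hom S M N \<and> inj_on i (carrier M) \<and>
      f \<in> mod_hom S M (coinduced_module R S q E)"
    then interpret N: module S N by simp
    have i: "i \<in> mod_hom R (restrict_scalars q M) (restrict_scalars q N)"
      using * by (auto simp: mod_hom_def restrict_scalars_def)
    have fc: "f x \<in> carrier (coinduced_module R S q E)" if "x \<in> carrier M" for x
      using * that by (auto intro: mod_hom_closed)
    have "f \<in> mod_hom R (restrict_scalars q M) E"
      using * fc by (auto simp: mod_hom_def restrict_scalars_def PiE_iff coinduced_smult[OF Em]
          coinduced_simps[OF Em] coinduced_carrier[OF Em])
    then obtain g where g: "g \<in> mod_hom R (restrict_scalars q N) E" "\<forall>x\<in>carrier M. g (i x) = f x"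
      using injective_module_lift[OF E restrict_scalars_module restrict_scalars_module i, of f] *
      by (auto simp: restrict_scalars_def)
    have gs: "g (q r \<odot>\<^bsub>N\<^esub> x) = r \<odot>\<^bsub>E\<^esub> g x" if "r \<in> carrier R" "x \<in> carrier N" for r x
      using g(1) that by (auto simp: mod_hom_def restrict_scalars_def)
    have gE: "g x \<in> carrier E" if "x \<in> carrier N" for x
      using g(1) that by (auto simp: mod_hom_def restrict_scalars_def)
    have g0: "g \<zero>\<^bsub>N\<^esub> = \<zero>\<^bsub>E\<^esub>"
      using gs[of "\<zero>\<^bsub>R\<^esub>" "\<zero>\<^bsub>N\<^esub>"] gE by simp
    have "r \<odot>\<^bsub>E\<^esub> g x = \<zero>\<^bsub>E\<^esub>" if "x \<in> carrier N" "r \<in> carrier R" "q r = \<zero>\<^bsub>S\<^esub>" for x r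
      using gs[OF that(2,1)] that g0 by simp
    then have gc: "g x \<in> carrier (coinduced_module R S q E)" if "x \<in> carrier N" for x
      using that gE by (simp add: coinduced_carrier[OF Em])
    have "g (s \<odot>\<^bsub>N\<^esub> x) = s \<odot>\<^bsub>coinduced_module R S q E\<^esub> g x" if s: "s \<in> carrier S" "x \<in> carrier N" for s x
    proof -
      obtain r where "r \<in> carrier R" "s = q r" using lift s(1) by blast
      then show ?thesis using gs gc s(2) by (simp add: coinduced_smult[OF Em])
    qed
    then have "g \<in> mod_hom S N (coinduced_module R S q E)"
      using g(1) gc by (auto simp: mod_hom_def restrict_scalars_def PiE_iff coinduced_simps[OF Em])
    then show "\<exists>g\<in>mod_hom S N (coinduced_module R S q E). \<forall>x\<in>carrier M. g (i x) = f x"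
      using g(2) by blast
  qed
qed

text \<open>The kernel of \<open>q\<close> lies in m, so it kills \<open>e\<close>; and multiples
  over \<open>R\<close> and over \<open>S\<close> agree along \<open>q\<close>.\<close>

lemma coinduced_socle_generator:
  assumes M: "module R M" and e: "socle_generator R M e"
  shows "socle_generator S (coinduced_module R S q M) e"
  unfolding socle_generator_def
proof (intro conjI ballI impI)
  show ec: "e \<in> carrier (coinduced_module R S q M)"
    using e kernel_max_ideal by (auto simp: coinduced_carrier[OF M] socle_generator_def)
  show "e \<noteq> \<zero>\<^bsub>coinduced_module R S q M\<^esub>"
    using e by (simp add: coinduced_simps[OF M] socle_generator_def)
  show "s \<odot>\<^bsub>coinduced_module R S q M\<^esub> e = \<zero>\<^bsub>coinduced_module R S q M\<^esub>" if s: "s \<in> max_ideal S" for s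
  proof -
    obtain r where r: "r \<in> carrier R" "s = q r" using lift S.max_ideal_closed[OF s] by blast
    then have "r \<in> max_ideal R" using s max_ideal_image_iff by simp
    then show ?thesis
      using r e coinduced_smult[OF M ec] by (simp add: coinduced_simps[OF M] socle_generator_def)
  qed
  show "\<exists>s\<in>carrier S. s \<odot>\<^bsub>coinduced_module R S q M\<^esub> x = e"
    if x: "x \<in> carrier (coinduced_module R S q M)" "x \<noteq> \<zero>\<^bsub>coinduced_module R S q M\<^esub>" for x
  proof -
    obtain r where "r \<in> carrier R" "r \<odot>\<^bsub>M\<^esub> x = e"
      using e x by (auto simp: coinduced_carrier[OF M] coinduced_simps[OF M] socle_generator_def)
    then show ?thesis using coinduced_smult[OF M x(1)] by (intro bexI[of _ "q r"]) auto
  qed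
qed

end


section \<open>Duals of injective envelopes\<close>

lemma annihilated_by_dual_iff:
  "annihilated_by (dual_module R M) J \<longleftrightarrow>
     (\<forall>r\<in>J. \<forall>f\<in>mod_hom R M (self_module R). \<forall>x\<in>carrier M. r \<otimes>\<^bsub>R\<^esub> f x = \<zero>\<^bsub>R\<^esub>)"
proof -
  have "(\<lambda>x\<in>carrier M. r \<otimes>\<^bsub>R\<^esub> f x) = (\<lambda>x\<in>carrier M. \<zero>\<^bsub>R\<^esub>) \<longleftrightarrow> (\<forall>x\<in>carrier M. r \<otimes>\<^bsub>R\<^esub> f x = \<zero>\<^bsub>R\<^esub>)" for r f
    by (auto simp: fun_eq_iff restrict_def)
  then show ?thesis by (simp add: annihilated_by_def dual_module_def Hom_module_def)
qed

lemma ideal_smult_eq_zero_iff: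
  assumes M: "module R M" and J: "ideal J R"
  shows "ideal_smult R J M = {\<zero>\<^bsub>M\<^esub>} \<longleftrightarrow> annihilated_by M J"
proof
  assume "ideal_smult R J M = {\<zero>\<^bsub>M\<^esub>}"
  then show "annihilated_by M J" using ideal_smult.smult[of _ J _ M R] by (auto simp: annihilated_by_def)
next
  interpret M: module R M by fact
  assume ann: "annihilated_by M J"
  have "x = \<zero>\<^bsub>M\<^esub>" if "x \<in> ideal_smult R J M" for x
    using that by induction (use ann in \<open>auto simp: annihilated_by_def\<close>)
  moreover have "\<zero>\<^bsub>R\<^esub> \<in> J" using J by (simp add: additive_subgroup.zero_closed ideal.axioms(1))
  then have "\<zero>\<^bsub>M\<^esub> \<in> ideal_smult R J M" using ideal_smult.smult[of "\<zero>\<^bsub>R\<^esub>" J "\<zero>\<^bsub>M\<^esub>" M R] by simp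
  ultimately show "ideal_smult R J M = {\<zero>\<^bsub>M\<^esub>}" by blast
qed

text \<open>Pulling functionals back along \<open>h\<close> turns each value of a functional on
  \<open>N\<close> into a value of a functional on \<open>M\<close>.\<close>

lemma annihilated_by_dual_surj:
  assumes M: "module R M" and h: "h \<in> mod_hom R M N" "h ` carrier M = carrier N"
    and ann: "annihilated_by (dual_module R M) J"
  shows "annihilated_by (dual_module R N) J"
  unfolding annihilated_by_dual_iff
proof (intro ballI)
  fix r f y assume r: "r \<in> J" and f: "f \<in> mod_hom R N (self_module R)" and y: "y \<in> carrier N"
  obtain x where x: "x \<in> carrier M" "y = h x" using y h(2) by blast
  have "r \<otimes>\<^bsub>R\<^esub> (\<lambda>x\<in>carrier M. f (h x)) x = \<zero>\<^bsub>R\<^esub>"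
    using ann mod_hom_compose[OF M h(1) f] r x(1) unfolding annihilated_by_dual_iff by blast
  then show "r \<otimes>\<^bsub>R\<^esub> f y = \<zero>\<^bsub>R\<^esub>" using x by simp
qed

text \<open>Two such modules map onto each other in both directions, so the condition is independent
  of the chosen envelope.\<close>

lemma (in local_ring) annihilated_by_dual_unique:
  assumes "injective_module R M" "socle_generator R M d" "injective_module R N" "socle_generator R N e"
  shows "annihilated_by (dual_module R M) J \<longleftrightarrow> annihilated_by (dual_module R N) J"
proof -
  have "module R M" "module R N" using assms by (simp_all add: injective_module_def)
  then show ?thesis
    using injective_socle_generator_surj[OF assms] injective_socle_generator_surj[OF assms(3,4,1,2)]
      annihilated_by_dual_surj by metis
qed

section \<open>The square of the maximal ideal and the trace of the envelope\<close>

lemma ideal_prod_subset: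
  assumes K: "ideal K R" and "\<And>x y. x \<in> I \<Longrightarrow> y \<in> J \<Longrightarrow> x \<otimes>\<^bsub>R\<^esub> y \<in> K"
  shows "I \<cdot>\<^bsub>R\<^esub> J \<subseteq> K"
proof
  fix z assume "z \<in> I \<cdot>\<^bsub>R\<^esub> J"
  then show "z \<in> K"
    by induction (use assms additive_subgroup.a_closed[OF ideal.axioms(1)[OF K]] in auto)
qed

lemma (in local_ring) max_ideal_square_zero_iff:
  "max_ideal R \<cdot>\<^bsub>R\<^esub> max_ideal R = {\<zero>} \<longleftrightarrow> (\<forall>x\<in>max_ideal R. \<forall>y\<in>max_ideal R. x \<otimes> y = \<zero>)"
proof
  assume "max_ideal R \<cdot>\<^bsub>R\<^esub> max_ideal R = {\<zero>}"
  then show "\<forall>x\<in>max_ideal R. \<forall>y\<in>max_ideal R. x \<otimes> y = \<zero>" using ideal_prod.prod by fastforce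
next
  assume *: "\<forall>x\<in>max_ideal R. \<forall>y\<in>max_ideal R. x \<otimes> y = \<zero>"
  have "max_ideal R \<cdot>\<^bsub>R\<^esub> max_ideal R \<subseteq> {\<zero>}"
    by (rule ideal_prod_subset[OF zeroideal]) (use * in simp)
  moreover have "\<zero> \<in> max_ideal R \<cdot>\<^bsub>R\<^esub> max_ideal R"
    using ideal_prod.prod[OF zero_max_ideal zero_max_ideal, of R] by simp
  ultimately show "max_ideal R \<cdot>\<^bsub>R\<^esub> max_ideal R = {\<zero>}" by blast
qed

text \<open>Since m x = 0, multiplication by x maps \<open>E\<close> into its socle, which
  \<open>e\<close> spans. Followed by r e \<mapsto> r x it is a functional that has x among its
  values.\<close>

lemma (in local_ring) square_zero_trace:
  assumes E: "injective_module R E" and e: "socle_generator R E e"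
    and sq: "\<And>x y. x \<in> max_ideal R \<Longrightarrow> y \<in> max_ideal R \<Longrightarrow> x \<otimes> y = \<zero>"
  shows "max_ideal R \<subseteq> trace_ideal R E"
proof
  fix x assume xm: "x \<in> max_ideal R"
  have Em: "module R E" using E by (simp add: injective_module_def)
  interpret E: module R E by fact
  have self: "module R (self_module R)" by (rule self_module_module[OF is_cring])
  have x: "x \<in> carrier R" using xm by (rule max_ideal_closed)
  have ec: "e \<in> carrier E" using e by (simp add: socle_generator_def)
  let ?U = "\<Union>f\<in>mod_hom R E (self_module R). f ` carrier E"
  have U: "?U \<subseteq> carrier R" using mod_hom_closed[of _ R E "self_module R"] by auto
  show "x \<in> trace_ideal R E"
  proof (cases "x = \<zero>")
    case True
    then show ?thesis
      using genideal_ideal[OF U] unfolding trace_ideal_def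
      by (simp add: additive_subgroup.zero_closed ideal.axioms(1))
  next
    case False
    have "r \<odot>\<^bsub>E\<^esub> e = \<zero>\<^bsub>E\<^esub>" if "r \<in> carrier R" "r \<otimes> x = \<zero>" for r
      using Units_smult_eq_zero[OF self, of r x] False x that not_Units_max_ideal
        socle_generator_ann[OF Em e] by auto
    \<comment> \<open>\<open>g \<one>\<close> is the point at which the functional takes the value
      x, as x times it equals \<open>e\<close>.\<close>
    then obtain g where g: "g \<in> mod_hom R (self_module R) E" "g x = e"
      using injective_module_lift_cyclic[OF E self, of x e] x ec by auto
    have g1: "g \<one> \<in> carrier E" using mod_hom_closed[OF g(1)] by simp
    have xg: "x \<odot>\<^bsub>E\<^esub> g \<one> = e" using mod_hom_smult[OF g(1) x, of \<one>] g(2) x by simp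
    \<comment> \<open>r e \<mapsto> r x is well defined: the annihilator of \<open>e\<close> is m,
      and m x = 0.\<close>
    have rx: "r \<otimes> x = s \<otimes> x" if "r \<in> carrier R" "s \<in> carrier R" "r \<odot>\<^bsub>E\<^esub> e = s \<odot>\<^bsub>E\<^esub> e" for r s
    proof -
      have "(r \<ominus> s) \<odot>\<^bsub>E\<^esub> e = \<zero>\<^bsub>E\<^esub>"
        using that ec by (simp add: a_minus_def E.smult_l_distr E.smult_l_minus E.M.r_neg)
      then have "r \<ominus> s \<in> max_ideal R" using socle_generator_ann[OF Em e] that(1,2) by simp
      then have "(r \<ominus> s) \<otimes> x = \<zero>" using sq xm by blast
      then have "r \<otimes> x \<ominus> s \<otimes> x = \<zero>" using that(1,2) x by (simp add: a_minus_def l_distr l_minus)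
      then show ?thesis using that(1,2) x by simp
    qed
    define P where "P a b \<longleftrightarrow> (\<exists>r\<in>carrier R. x \<odot>\<^bsub>E\<^esub> a = r \<odot>\<^bsub>E\<^esub> e \<and> b = r \<otimes> x)" for a b
    have P_uniq: "b = c" if P: "P a b" "P a c" for a b c
    proof -
      obtain r s where rs: "r \<in> carrier R" "x \<odot>\<^bsub>E\<^esub> a = r \<odot>\<^bsub>E\<^esub> e" "b = r \<otimes> x"
        "s \<in> carrier R" "x \<odot>\<^bsub>E\<^esub> a = s \<odot>\<^bsub>E\<^esub> e" "c = s \<otimes> x"
        using P unfolding P_def by blast
      then have "r \<odot>\<^bsub>E\<^esub> e = s \<odot>\<^bsub>E\<^esub> e" by metis
      then show ?thesis using rx[OF rs(1,4)] rs(3,6) by simp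
    qed
    have "\<exists>f\<in>mod_hom R E (self_module R). \<forall>a\<in>carrier E. P a (f a)"
    proof (rule mod_hom_of_relation[OF Em _ P_uniq self])
      fix a assume a: "a \<in> carrier E"
      have "r \<odot>\<^bsub>E\<^esub> (x \<odot>\<^bsub>E\<^esub> a) = \<zero>\<^bsub>E\<^esub>" if "r \<in> max_ideal R" for r
        using a x that max_ideal_closed[OF that] sq[OF that xm] by (simp add: E.smult_assoc1[symmetric])
      then show "\<exists>b\<in>carrier (self_module R). P a b"
        using socle_generator_spans[OF Em e, of "x \<odot>\<^bsub>E\<^esub> a"] a x by (auto simp: P_def)
    next
      fix a a' b b' assume *: "a \<in> carrier E" "a' \<in> carrier E" "P a b" "P a' b'"
      then obtain r s where "r \<in> carrier R" "s \<in> carrier R" "x \<odot>\<^bsub>E\<^esub> a = r \<odot>\<^bsub>E\<^esub> e" "b = r \<otimes> x"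
        "x \<odot>\<^bsub>E\<^esub> a' = s \<odot>\<^bsub>E\<^esub> e" "b' = s \<otimes> x" unfolding P_def by blast
      then show "P (a \<oplus>\<^bsub>E\<^esub> a') (b \<oplus>\<^bsub>self_module R\<^esub> b')"
        using *(1,2) x ec unfolding P_def
        by (intro bexI[of _ "r \<oplus> s"]) (simp_all add: E.smult_l_distr E.smult_r_distr l_distr)
    next
      fix t a b assume *: "t \<in> carrier R" "a \<in> carrier E" "P a b"
      then obtain r where r: "r \<in> carrier R" "x \<odot>\<^bsub>E\<^esub> a = r \<odot>\<^bsub>E\<^esub> e" "b = r \<otimes> x" unfolding P_def by blast
      have "x \<odot>\<^bsub>E\<^esub> (t \<odot>\<^bsub>E\<^esub> a) = t \<odot>\<^bsub>E\<^esub> (x \<odot>\<^bsub>E\<^esub> a)"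
        using * x by (simp add: E.smult_assoc1[symmetric] m_comm)
      then show "P (t \<odot>\<^bsub>E\<^esub> a) (t \<odot>\<^bsub>self_module R\<^esub> b)"
        using *(1) r x ec unfolding P_def
        by (intro bexI[of _ "t \<otimes> r"]) (simp_all add: E.smult_assoc1 m_assoc)
    qed
    then obtain f where f: "f \<in> mod_hom R E (self_module R)" "\<forall>a\<in>carrier E. P a (f a)" by blast
    have "P (g \<one>) x" using xg ec x unfolding P_def by (intro bexI[of _ \<one>]) simp_all
    then have "f (g \<one>) = x" using P_uniq f(2) g1 by blast
    then have "x \<in> ?U" using f(1) g1 by blast
    then show ?thesis using genideal_self[OF U] by (auto simp: trace_ideal_def)
  qed
qed

text \<open>The annihilator of x is an ideal containing the image of every functional, hence also
  the ideal generated by these images.\<close>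

lemma (in local_ring) trace_annihilated:
  assumes E: "module R E" and ann: "annihilated_by (dual_module R E) (max_ideal R)"
    and x: "x \<in> max_ideal R" and y: "y \<in> trace_ideal R E"
  shows "x \<otimes> y = \<zero>"
proof -
  have xc: "x \<in> carrier R" using x by (rule max_ideal_closed)
  have "ideal {y \<in> carrier R. x \<otimes> y = \<zero>} R"
  proof (rule idealI[OF ring_axioms])
    show "subgroup {y \<in> carrier R. x \<otimes> y = \<zero>} (add_monoid R)"
      by (rule add.subgroupI) (use xc in \<open>auto simp: r_distr r_minus a_inv_def[symmetric] intro!: exI[of _ \<zero>]\<close>)
    show "z \<otimes> a \<in> {y \<in> carrier R. x \<otimes> y = \<zero>}"
      if "a \<in> {y \<in> carrier R. x \<otimes> y = \<zero>}" "z \<in> carrier R" for a z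
      using xc that m_lcomm[of x z a] by simp
    show "a \<otimes> z \<in> {y \<in> carrier R. x \<otimes> y = \<zero>}"
      if "a \<in> {y \<in> carrier R. x \<otimes> y = \<zero>}" "z \<in> carrier R" for a z
      using xc that by (simp add: m_assoc[symmetric])
  qed
  moreover have "(\<Union>f\<in>mod_hom R E (self_module R). f ` carrier E) \<subseteq> {y \<in> carrier R. x \<otimes> y = \<zero>}"
    using ann x mod_hom_closed[of _ R E "self_module R"] by (auto simp: annihilated_by_dual_iff)
  ultimately have "trace_ideal R E \<subseteq> {y \<in> carrier R. x \<otimes> y = \<zero>}"
    unfolding trace_ideal_def by (rule genideal_minimal)
  then show ?thesis using y by blast
qed


section \<open>Fiber products over the residue field\<close>

text \<open>
  An abstract form of \<open>R = S \<times>\<^sub>k T\<close>: the residue field does not occur, only the two projections.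
\<close>

locale fiber_projections = p: local_surjection R S p + q: local_surjection R T q
  for R (structure) and S (structure) and T (structure) and p q +
  assumes kernels_disjoint: "\<lbrakk>r \<in> carrier R; p r = \<zero>\<^bsub>S\<^esub>; q r = \<zero>\<^bsub>T\<^esub>\<rbrakk> \<Longrightarrow> r = \<zero>\<^bsub>R\<^esub>"
    and lift_left: "s \<in> max_ideal S \<Longrightarrow> \<exists>r\<in>carrier R. p r = s \<and> q r = \<zero>\<^bsub>T\<^esub>"
    and lift_right: "t \<in> max_ideal T \<Longrightarrow> \<exists>r\<in>carrier R. p r = \<zero>\<^bsub>S\<^esub> \<and> q r = t"
begin

lemma swap: "fiber_projections R T S q p"
  by unfold_locales (use kernels_disjoint lift_left lift_right in blast)+

lemma projections_eq:
  assumes "a \<in> carrier R" "b \<in> carrier R" "p a = p b" "q a = q b"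
  shows "a = b"
proof -
  have "p (a \<ominus>\<^bsub>R\<^esub> b) = \<zero>\<^bsub>S\<^esub>" "q (a \<ominus>\<^bsub>R\<^esub> b) = \<zero>\<^bsub>T\<^esub>"
    using assms by (simp_all add: a_minus_def p.S.r_neg q.S.r_neg)
  then have "a \<ominus>\<^bsub>R\<^esub> b = \<zero>\<^bsub>R\<^esub>" using assms(1,2) kernels_disjoint by simp
  then show ?thesis using assms(1,2) by simp
qed

text \<open>\<open>lift_left\<close> supplies an element a with coordinates (p r, 0), and r - a then
  lies in the kernel of \<open>p\<close>.\<close>

lemma max_ideal_decompose:
  assumes r: "r \<in> max_ideal R"
  shows "\<exists>a\<in>carrier R. \<exists>b\<in>carrier R. r = a \<oplus>\<^bsub>R\<^esub> b \<and> q a = \<zero>\<^bsub>T\<^esub> \<and> p b = \<zero>\<^bsub>S\<^esub>"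
proof -
  have rc: "r \<in> carrier R" using r by (rule p.R.max_ideal_closed)
  then obtain a where a: "a \<in> carrier R" "p a = p r" "q a = \<zero>\<^bsub>T\<^esub>"
    using r lift_left p.max_ideal_image_iff by metis
  have "p (r \<ominus>\<^bsub>R\<^esub> a) = \<zero>\<^bsub>S\<^esub>" using a(1,2) rc by (simp add: a_minus_def p.S.r_neg)
  moreover have "r = a \<oplus>\<^bsub>R\<^esub> (r \<ominus>\<^bsub>R\<^esub> a)"
    using a(1) rc p.R.a_lcomm[of a r "\<ominus>\<^bsub>R\<^esub> a"] by (simp add: a_minus_def p.R.r_neg)
  ultimately show ?thesis using a rc by (intro bexI[of _ a] bexI[of _ "r \<ominus>\<^bsub>R\<^esub> a"]) auto
qed

text \<open>
  \<open>E = E\<^sub>S + E\<^sub>T\<close>: the map \<open>a + b \<mapsto> ax\<close> on \<open>\<mm> = ker q \<oplus> ker p\<close> is multiplication by some \<open>y\<close>.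
\<close>

lemma injective_sum:
  assumes E: "injective_module R E" and x: "x \<in> carrier E"
  shows "\<exists>y\<in>carrier (coinduced_module R S p E). x \<ominus>\<^bsub>E\<^esub> y \<in> carrier (coinduced_module R T q E)"
proof -
  have Em: "module R E" using E by (simp add: injective_module_def)
  interpret E: module R E by fact
  interpret m: ideal "max_ideal R" R by (rule p.R.max_ideal_ideal)
  \<comment> \<open>\<alpha> is the projection of m onto ker q: \<alpha> r has coordinates (p r, 0).
    It vanishes on ker p, so ker p will kill y; it is the identity on ker q, so ker q will kill x -
    y.\<close>
  have "\<exists>a. a \<in> carrier R \<and> p a = p r \<and> q a = \<zero>\<^bsub>T\<^esub>" if "r \<in> max_ideal R" for r
    using that lift_left[of "p r"] p.max_ideal_image_iff p.R.max_ideal_closed by blast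
  then obtain \<alpha> where \<alpha>: "\<And>r. r \<in> max_ideal R \<Longrightarrow> \<alpha> r \<in> carrier R"
      "\<And>r. r \<in> max_ideal R \<Longrightarrow> p (\<alpha> r) = p r" "\<And>r. r \<in> max_ideal R \<Longrightarrow> q (\<alpha> r) = \<zero>\<^bsub>T\<^esub>"
    by metis
  have "\<exists>y\<in>carrier E. \<forall>r\<in>max_ideal R. \<alpha> r \<odot>\<^bsub>E\<^esub> x = r \<odot>\<^bsub>E\<^esub> y"
  proof (rule injective_module_lift_ideal[OF p.R.is_cring E p.R.max_ideal_ideal])
    show "\<alpha> r \<odot>\<^bsub>E\<^esub> x \<in> carrier E" if "r \<in> max_ideal R" for r using \<alpha>(1)[OF that] x by simp
  next
    fix r s assume rs: "r \<in> max_ideal R" "s \<in> max_ideal R"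
    then have "r \<oplus>\<^bsub>R\<^esub> s \<in> max_ideal R" by (rule m.a_closed)
    then have "\<alpha> (r \<oplus>\<^bsub>R\<^esub> s) = \<alpha> r \<oplus>\<^bsub>R\<^esub> \<alpha> s"
      using \<alpha> rs p.R.max_ideal_closed by (intro projections_eq) simp_all
    then show "\<alpha> (r \<oplus>\<^bsub>R\<^esub> s) \<odot>\<^bsub>E\<^esub> x = \<alpha> r \<odot>\<^bsub>E\<^esub> x \<oplus>\<^bsub>E\<^esub> \<alpha> s \<odot>\<^bsub>E\<^esub> x"
      using \<alpha>(1) rs x by (simp add: E.smult_l_distr)
  next
    fix r s assume rs: "r \<in> carrier R" "s \<in> max_ideal R"
    then have "r \<otimes>\<^bsub>R\<^esub> s \<in> max_ideal R" by (simp add: m.I_l_closed)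
    then have "\<alpha> (r \<otimes>\<^bsub>R\<^esub> s) = r \<otimes>\<^bsub>R\<^esub> \<alpha> s"
      using \<alpha> rs p.R.max_ideal_closed by (intro projections_eq) simp_all
    then show "\<alpha> (r \<otimes>\<^bsub>R\<^esub> s) \<odot>\<^bsub>E\<^esub> x = r \<odot>\<^bsub>E\<^esub> (\<alpha> s \<odot>\<^bsub>E\<^esub> x)"
      using \<alpha>(1) rs x by (simp add: E.smult_assoc1)
  qed
  then obtain y where y: "y \<in> carrier E" "\<And>r. r \<in> max_ideal R \<Longrightarrow> \<alpha> r \<odot>\<^bsub>E\<^esub> x = r \<odot>\<^bsub>E\<^esub> y" by blast
  have "r \<odot>\<^bsub>E\<^esub> y = \<zero>\<^bsub>E\<^esub>" if r: "r \<in> carrier R" "p r = \<zero>\<^bsub>S\<^esub>" for r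
  proof -
    have rm: "r \<in> max_ideal R" using r by (rule p.kernel_max_ideal)
    then have "\<alpha> r = \<zero>\<^bsub>R\<^esub>" using \<alpha>[OF rm] r by (intro kernels_disjoint) simp_all
    then show ?thesis using y(2)[OF rm] x by simp
  qed
  moreover have "r \<odot>\<^bsub>E\<^esub> (x \<ominus>\<^bsub>E\<^esub> y) = \<zero>\<^bsub>E\<^esub>" if r: "r \<in> carrier R" "q r = \<zero>\<^bsub>T\<^esub>" for r
  proof -
    have rm: "r \<in> max_ideal R" using r by (rule q.kernel_max_ideal)
    then have "\<alpha> r = r" using \<alpha>[OF rm] r by (intro projections_eq) simp_all
    then have "r \<odot>\<^bsub>E\<^esub> x = r \<odot>\<^bsub>E\<^esub> y" using y(2)[OF rm] by simp
    then show ?thesis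
      using r(1) x y(1) by (simp add: a_minus_def E.smult_r_distr E.smult_r_minus E.M.r_neg)
  qed
  ultimately show ?thesis
    using x y(1)
    by (intro bexI[of _ y]) (simp_all add: p.coinduced_carrier[OF Em] q.coinduced_carrier[OF Em])
qed

text \<open>Restricting \<open>f\<close> to the coinduced module and applying \<open>p\<close> gives
  a functional over S. Write r = a + b with a in ker q and b in ker p. The p-coordinate of a f(x)
  vanishes by hypothesis and its q-coordinate because q a = 0, while b already kills x.\<close>

lemma dual_annihilated_left:
  assumes Em: "module R E"
    and ann: "annihilated_by (dual_module S (coinduced_module R S p E)) (max_ideal S)"
    and f: "f \<in> mod_hom R E (self_module R)" and r: "r \<in> max_ideal R"
    and x: "x \<in> carrier (coinduced_module R S p E)"
  shows "r \<otimes>\<^bsub>R\<^esub> f x = \<zero>\<^bsub>R\<^esub>"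
proof -
  interpret E: module R E by fact
  let ?D = "coinduced_module R S p E"
  have xE: "x \<in> carrier E" using x by (simp add: p.coinduced_carrier[OF Em])
  have fc: "f y \<in> carrier R" if "y \<in> carrier E" for y using mod_hom_closed[OF f that] by simp
  have DE: "y \<in> carrier E" if "y \<in> carrier ?D" for y using that by (simp add: p.coinduced_carrier[OF Em])
  obtain a b where ab: "a \<in> carrier R" "b \<in> carrier R" "r = a \<oplus>\<^bsub>R\<^esub> b" "q a = \<zero>\<^bsub>T\<^esub>" "p b = \<zero>\<^bsub>S\<^esub>"
    using max_ideal_decompose[OF r] by blast
  have "p a = p r" using ab by simp
  then have pa: "p a \<in> max_ideal S"
    using r p.max_ideal_image_iff p.R.max_ideal_closed by simp
  have "(\<lambda>y\<in>carrier ?D. p (f y)) \<in> mod_hom S ?D (self_module S)"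
  proof (rule restrict_mod_hom[OF p.coinduced_module_module[OF Em]])
    fix s y assume s: "s \<in> carrier S" and y: "y \<in> carrier ?D"
    obtain t where t: "t \<in> carrier R" "s = p t" using p.lift s by blast
    show "p (f (s \<odot>\<^bsub>?D\<^esub> y)) = s \<odot>\<^bsub>self_module S\<^esub> p (f y)"
      using t y DE fc mod_hom_smult[OF f t(1) DE[OF y]] by (simp add: p.coinduced_smult[OF Em])
  qed (use DE fc in \<open>simp_all add: p.coinduced_simps[OF Em] mod_hom_add[OF f]\<close>)
  then have "p a \<otimes>\<^bsub>S\<^esub> (\<lambda>y\<in>carrier ?D. p (f y)) x = \<zero>\<^bsub>S\<^esub>"
    using ann pa x unfolding annihilated_by_dual_iff by blast
  then have "p a \<otimes>\<^bsub>S\<^esub> p (f x) = \<zero>\<^bsub>S\<^esub>" using x by simp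
  then have "a \<otimes>\<^bsub>R\<^esub> f x = \<zero>\<^bsub>R\<^esub>"
    using ab(1,4) fc[OF xE] by (intro kernels_disjoint) simp_all
  moreover have "b \<odot>\<^bsub>E\<^esub> x = \<zero>\<^bsub>E\<^esub>" using x ab(2,5) by (simp add: p.coinduced_carrier[OF Em])
  then have "b \<otimes>\<^bsub>R\<^esub> f x = \<zero>\<^bsub>R\<^esub>"
    using mod_hom_smult[OF f ab(2) xE] mod_hom_zero[OF Em self_module_module[OF p.R.is_cring] f] by simp
  ultimately show ?thesis using ab(1-3) fc[OF xE] by (simp add: p.R.l_distr)
qed

text \<open>A functional g over S has values in the maximal ideal of S and vanishes on the socle. It
  therefore extends by zero on the T-part to a functional on \<open>E\<close> with values in ker q,
  and the hypothesis on \<open>E\<close> applies to the extension.\<close>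

lemma dual_annihilated_restrict:
  assumes G: "\<not> gorenstein_ring S" and E: "injective_module R E" and e: "socle_generator R E e"
    and ann: "annihilated_by (dual_module R E) (max_ideal R)"
  shows "annihilated_by (dual_module S (coinduced_module R S p E)) (max_ideal S)"
  unfolding annihilated_by_dual_iff
proof (intro ballI)
  let ?D = "coinduced_module R S p E" and ?D' = "coinduced_module R T q E"
  fix s g z assume s: "s \<in> max_ideal S" and g: "g \<in> mod_hom S ?D (self_module S)" and z: "z \<in> carrier ?D"
  have Em: "module R E" using E by (simp add: injective_module_def)
  interpret E: module R E by fact
  have D: "module S ?D" by (rule p.coinduced_module_module[OF Em])
  interpret D: module S ?D by fact
  have Dinj: "injective_module S ?D" by (rule p.coinduced_injective[OF E])
  have De: "socle_generator S ?D e" by (rule p.coinduced_socle_generator[OF Em e])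
  have selfS: "module S (self_module S)" by (rule self_module_module[OF p.S.is_cring])
  note D'sub = q.coinduced_submodule[OF Em] and Dsub = p.coinduced_submodule[OF Em]
  have DE: "y \<in> carrier E" if "y \<in> carrier ?D" for y using that by (simp add: p.coinduced_carrier[OF Em])
  have D'E: "y \<in> carrier E" if "y \<in> carrier ?D'" for y using that by (simp add: q.coinduced_carrier[OF Em])
  have ec: "e \<in> carrier ?D" using De by (simp add: socle_generator_def)
  have gm: "g y \<in> max_ideal S" if "y \<in> carrier ?D" for y
    by (rule p.S.mod_hom_image_max_ideal[OF G Dinj g that])
  have gc: "g y \<in> carrier S" if "y \<in> carrier ?D" for y
    using gm[OF that] by (rule p.S.max_ideal_closed)
  \<comment> \<open>Otherwise g is injective and split by some h, so each y equals g y times h 1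
    with g y in the maximal ideal. For y = h 1 this forces h 1 = 0, and then \<open>e\<close> =
    0.\<close>
  have ge: "g e = \<zero>\<^bsub>S\<^esub>"
  proof (rule ccontr)
    assume "g e \<noteq> \<zero>\<^bsub>S\<^esub>"
    then have "inj_on g (carrier ?D)"
      using p.S.inj_on_socle_generatorI[OF D selfS g De] by simp
    then obtain h where h: "h \<in> mod_hom S (self_module S) ?D" "\<forall>y\<in>carrier ?D. h (g y) = (\<lambda>y\<in>carrier ?D. y) y"
      using injective_module_lift[OF Dinj D selfS g _ mod_hom_id[OF D]] by blast
    have h1: "h \<one>\<^bsub>S\<^esub> \<in> carrier ?D" using mod_hom_closed[OF h(1)] by simp
    have hg: "g y \<odot>\<^bsub>?D\<^esub> h \<one>\<^bsub>S\<^esub> = y" if "y \<in> carrier ?D" for y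
      using mod_hom_smult[OF h(1) gc[OF that], of "\<one>\<^bsub>S\<^esub>"] h(2) that gc[OF that] by simp
    have "h \<one>\<^bsub>S\<^esub> = \<zero>\<^bsub>?D\<^esub>"
      using p.S.smult_fixed_zero[OF D gm[OF h1] h1 hg[OF h1]] .
    then have "e = \<zero>\<^bsub>?D\<^esub>" using hg[OF ec] gc[OF ec] by simp
    then show False using De by (simp add: socle_generator_def)
  qed
  \<comment> \<open>A difference lying in both coinduced modules is killed by ker q and ker p, hence
    by m. So it is a multiple of \<open>e\<close>, which g kills.\<close>
  have g_cong: "g y = g y'"
    if y: "y \<in> carrier ?D" "y' \<in> carrier ?D" "y \<ominus>\<^bsub>E\<^esub> y' \<in> carrier ?D'" for y y'
  proof -
    have yd: "y \<ominus>\<^bsub>E\<^esub> y' \<in> carrier ?D" using submodule_diff[OF Em Dsub y(1,2)] .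
    have "r \<odot>\<^bsub>E\<^esub> (y \<ominus>\<^bsub>E\<^esub> y') = \<zero>\<^bsub>E\<^esub>" if r: "r \<in> max_ideal R" for r
    proof -
      obtain a b where ab: "a \<in> carrier R" "b \<in> carrier R" "r = a \<oplus>\<^bsub>R\<^esub> b" "q a = \<zero>\<^bsub>T\<^esub>" "p b = \<zero>\<^bsub>S\<^esub>"
        using max_ideal_decompose[OF r] by blast
      have "a \<odot>\<^bsub>E\<^esub> (y \<ominus>\<^bsub>E\<^esub> y') = \<zero>\<^bsub>E\<^esub>" "b \<odot>\<^bsub>E\<^esub> (y \<ominus>\<^bsub>E\<^esub> y') = \<zero>\<^bsub>E\<^esub>"
        using yd y(3) ab(1,2,4,5) by (simp_all add: p.coinduced_carrier[OF Em] q.coinduced_carrier[OF Em])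
      then show ?thesis using ab(1-3) DE[OF yd] by (simp add: E.smult_l_distr)
    qed
    then obtain r where r: "r \<in> carrier R" "y \<ominus>\<^bsub>E\<^esub> y' = r \<odot>\<^bsub>E\<^esub> e"
      using p.R.socle_generator_spans[OF Em e DE[OF yd]] by blast
    then have yr: "y \<ominus>\<^bsub>E\<^esub> y' = p r \<odot>\<^bsub>?D\<^esub> e" by (simp add: p.coinduced_smult[OF Em ec])
    have "y \<ominus>\<^bsub>E\<^esub> y' \<oplus>\<^bsub>E\<^esub> y' = y"
      using DE y(1,2) by (simp add: a_minus_def E.M.a_assoc E.M.l_neg)
    then have "g y = g (y \<ominus>\<^bsub>E\<^esub> y' \<oplus>\<^bsub>?D\<^esub> y')" by (simp add: p.coinduced_simps[OF Em])
    also have "\<dots> = g (y \<ominus>\<^bsub>E\<^esub> y') \<oplus>\<^bsub>S\<^esub> g y'" using mod_hom_add[OF g yd y(2)] by simp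
    also have "g (y \<ominus>\<^bsub>E\<^esub> y') = \<zero>\<^bsub>S\<^esub>"
      unfolding yr using mod_hom_smult[OF g _ ec, of "p r"] r(1) ge by simp
    finally show ?thesis using gc y(2) by simp
  qed
  \<comment> \<open>The graph of the extension: w is an S-part of x, and y is the element of R with
    coordinates (g w, 0).\<close>
  define P where "P x y \<longleftrightarrow> (\<exists>w\<in>carrier ?D. x \<ominus>\<^bsub>E\<^esub> w \<in> carrier ?D' \<and> p y = g w \<and> q y = \<zero>\<^bsub>T\<^esub>)" for x y
  have uniq: "y = y'"
    if x: "x \<in> carrier E" and y: "y \<in> carrier (self_module R)" "y' \<in> carrier (self_module R)" "P x y" "P x y'"
    for x y y'
  proof -
    obtain w w' where w: "w \<in> carrier ?D" "x \<ominus>\<^bsub>E\<^esub> w \<in> carrier ?D'" "p y = g w" "q y = \<zero>\<^bsub>T\<^esub>"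
      and w': "w' \<in> carrier ?D" "x \<ominus>\<^bsub>E\<^esub> w' \<in> carrier ?D'" "p y' = g w'" "q y' = \<zero>\<^bsub>T\<^esub>"
      using y(3,4) unfolding P_def by blast
    have "(x \<ominus>\<^bsub>E\<^esub> w') \<ominus>\<^bsub>E\<^esub> (x \<ominus>\<^bsub>E\<^esub> w) = (x \<oplus>\<^bsub>E\<^esub> \<ominus>\<^bsub>E\<^esub> x) \<oplus>\<^bsub>E\<^esub> (w \<oplus>\<^bsub>E\<^esub> \<ominus>\<^bsub>E\<^esub> w')"
      using x DE[OF w(1)] DE[OF w'(1)] by (simp add: a_minus_def E.M.minus_add E.M.a_ac)
    also have "\<dots> = w \<ominus>\<^bsub>E\<^esub> w'" using x DE[OF w(1)] DE[OF w'(1)] by (simp add: a_minus_def E.M.r_neg)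
    finally have "w \<ominus>\<^bsub>E\<^esub> w' \<in> carrier ?D'" using submodule_diff[OF Em D'sub w'(2) w(2)] by simp
    then have "g w = g w'" using g_cong w(1) w'(1) by blast
    then show ?thesis using w w' y(1,2) by (intro projections_eq) simp_all
  qed
  have "\<exists>f\<in>mod_hom R E (self_module R). \<forall>x\<in>carrier E. P x (f x)"
  proof (rule mod_hom_of_relation[OF Em _ uniq self_module_module[OF p.R.is_cring]])
    fix x assume "x \<in> carrier E"
    then obtain w where w: "w \<in> carrier ?D" "x \<ominus>\<^bsub>E\<^esub> w \<in> carrier ?D'" using injective_sum[OF E] by blast
    obtain y where "y \<in> carrier R" "p y = g w" "q y = \<zero>\<^bsub>T\<^esub>" using lift_left[OF gm[OF w(1)]] by blast
    then show "\<exists>y\<in>carrier (self_module R). P x y" using w by (auto simp: P_def)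
  next
    fix x x' y y' assume c: "x \<in> carrier E" "x' \<in> carrier E" "y \<in> carrier (self_module R)"
      "y' \<in> carrier (self_module R)" and P: "P x y" "P x' y'"
    obtain w w' where w: "w \<in> carrier ?D" "x \<ominus>\<^bsub>E\<^esub> w \<in> carrier ?D'" "p y = g w" "q y = \<zero>\<^bsub>T\<^esub>"
      and w': "w' \<in> carrier ?D" "x' \<ominus>\<^bsub>E\<^esub> w' \<in> carrier ?D'" "p y' = g w'" "q y' = \<zero>\<^bsub>T\<^esub>"
      using P unfolding P_def by blast
    have "x \<oplus>\<^bsub>E\<^esub> x' \<ominus>\<^bsub>E\<^esub> (w \<oplus>\<^bsub>E\<^esub> w') = (x \<ominus>\<^bsub>E\<^esub> w) \<oplus>\<^bsub>E\<^esub> (x' \<ominus>\<^bsub>E\<^esub> w')"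
      using c(1,2) DE[OF w(1)] DE[OF w'(1)] by (simp add: a_minus_def E.M.minus_add E.M.a_ac)
    then have "x \<oplus>\<^bsub>E\<^esub> x' \<ominus>\<^bsub>E\<^esub> (w \<oplus>\<^bsub>E\<^esub> w') \<in> carrier ?D'"
      using E.submoduleE(5)[OF D'sub w(2) w'(2)] by simp
    moreover have "w \<oplus>\<^bsub>E\<^esub> w' \<in> carrier ?D" using E.submoduleE(5)[OF Dsub w(1) w'(1)] .
    moreover have "g (w \<oplus>\<^bsub>E\<^esub> w') = g w \<oplus>\<^bsub>S\<^esub> g w'"
      using mod_hom_add[OF g w(1) w'(1)] by (simp add: p.coinduced_simps[OF Em])
    ultimately show "P (x \<oplus>\<^bsub>E\<^esub> x') (y \<oplus>\<^bsub>self_module R\<^esub> y')"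
      using w(3,4) w'(3,4) c(3,4) unfolding P_def by (intro bexI[of _ "w \<oplus>\<^bsub>E\<^esub> w'"]) simp_all
  next
    fix r x y assume c: "r \<in> carrier R" "x \<in> carrier E" "y \<in> carrier (self_module R)" and P: "P x y"
    obtain w where w: "w \<in> carrier ?D" "x \<ominus>\<^bsub>E\<^esub> w \<in> carrier ?D'" "p y = g w" "q y = \<zero>\<^bsub>T\<^esub>"
      using P unfolding P_def by blast
    have "r \<odot>\<^bsub>E\<^esub> x \<ominus>\<^bsub>E\<^esub> r \<odot>\<^bsub>E\<^esub> w = r \<odot>\<^bsub>E\<^esub> (x \<ominus>\<^bsub>E\<^esub> w)"
      using c(1,2) DE[OF w(1)] by (simp add: a_minus_def E.smult_r_distr E.smult_r_minus)
    then have "r \<odot>\<^bsub>E\<^esub> x \<ominus>\<^bsub>E\<^esub> r \<odot>\<^bsub>E\<^esub> w \<in> carrier ?D'"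
      using E.submoduleE(4)[OF D'sub c(1) w(2)] by simp
    moreover have "r \<odot>\<^bsub>E\<^esub> w \<in> carrier ?D" using E.submoduleE(4)[OF Dsub c(1) w(1)] .
    moreover have "g (r \<odot>\<^bsub>E\<^esub> w) = p r \<otimes>\<^bsub>S\<^esub> g w"
      using mod_hom_smult[OF g _ w(1), of "p r"] c(1) by (simp add: p.coinduced_smult[OF Em w(1)])
    ultimately show "P (r \<odot>\<^bsub>E\<^esub> x) (r \<odot>\<^bsub>self_module R\<^esub> y)"
      using w(3,4) c(1,3) unfolding P_def by (intro bexI[of _ "r \<odot>\<^bsub>E\<^esub> w"]) simp_all
  qed
  then obtain f where f: "f \<in> mod_hom R E (self_module R)" "\<And>x. x \<in> carrier E \<Longrightarrow> P x (f x)" by blast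
  \<comment> \<open>On z the extension is (g z, 0), with z serving as its own S-part.\<close>
  obtain y where y: "y \<in> carrier R" "p y = g z" "q y = \<zero>\<^bsub>T\<^esub>" using lift_left[OF gm[OF z]] by blast
  have "z \<ominus>\<^bsub>E\<^esub> z \<in> carrier ?D'"
    using DE[OF z] submodule_zero[OF D'sub] by (simp add: a_minus_def E.M.r_neg)
  then have "P z y" using z y unfolding P_def by blast
  then have fz: "f z = y"
    using uniq[of z "f z" y] f DE[OF z] mod_hom_closed[OF f(1) DE[OF z]] y(1) by simp
  \<comment> \<open>Lift s to m, apply the hypothesis to the extension at z, and read off the
    p-coordinate.\<close>
  obtain r where r: "r \<in> carrier R" "p r = s" using p.lift p.S.max_ideal_closed[OF s] by blast
  then have "r \<in> max_ideal R" using s p.max_ideal_image_iff[OF r(1)] by simp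
  then have "r \<otimes>\<^bsub>R\<^esub> f z = \<zero>\<^bsub>R\<^esub>" using ann f(1) DE[OF z] unfolding annihilated_by_dual_iff by blast
  then have "p (r \<otimes>\<^bsub>R\<^esub> y) = \<zero>\<^bsub>S\<^esub>" using fz by simp
  then show "s \<otimes>\<^bsub>S\<^esub> g z = \<zero>\<^bsub>S\<^esub>" using r y(1,2) by simp
qed

text \<open>\<open>swap\<close> makes the one-sided results available for T. For the converse,
  \<open>injective_sum\<close> splits x into elements of the two coinduced modules, each handled by
  \<open>dual_annihilated_left\<close>.\<close>

lemma dual_annihilated_iff:
  assumes "\<not> gorenstein_ring S" "\<not> gorenstein_ring T"
    and E: "injective_module R E" and e: "socle_generator R E e"
  shows "annihilated_by (dual_module R E) (max_ideal R) \<longleftrightarrow>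
    annihilated_by (dual_module S (coinduced_module R S p E)) (max_ideal S) \<and>
    annihilated_by (dual_module T (coinduced_module R T q E)) (max_ideal T)"
proof
  interpret sw: fiber_projections R T S q p by (rule swap)
  assume "annihilated_by (dual_module R E) (max_ideal R)"
  then show "annihilated_by (dual_module S (coinduced_module R S p E)) (max_ideal S) \<and>
    annihilated_by (dual_module T (coinduced_module R T q E)) (max_ideal T)"
    using dual_annihilated_restrict[OF assms(1) E e] sw.dual_annihilated_restrict[OF assms(2) E e] by blast
next
  interpret sw: fiber_projections R T S q p by (rule swap)
  assume ann: "annihilated_by (dual_module S (coinduced_module R S p E)) (max_ideal S) \<and>
    annihilated_by (dual_module T (coinduced_module R T q E)) (max_ideal T)"
  have Em: "module R E" using E by (simp add: injective_module_def)
  interpret E: module R E by fact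
  show "annihilated_by (dual_module R E) (max_ideal R)"
    unfolding annihilated_by_dual_iff
  proof (intro ballI)
    fix r f x assume r: "r \<in> max_ideal R" and f: "f \<in> mod_hom R E (self_module R)" and x: "x \<in> carrier E"
    obtain y where y: "y \<in> carrier (coinduced_module R S p E)"
      "x \<ominus>\<^bsub>E\<^esub> y \<in> carrier (coinduced_module R T q E)"
      using injective_sum[OF E x] by blast
    have "r \<otimes>\<^bsub>R\<^esub> f y = \<zero>\<^bsub>R\<^esub>"
      using dual_annihilated_left[OF Em _ f r y(1)] ann by blast
    moreover have "r \<otimes>\<^bsub>R\<^esub> f (x \<ominus>\<^bsub>E\<^esub> y) = \<zero>\<^bsub>R\<^esub>"
      using sw.dual_annihilated_left[OF Em _ f r y(2)] ann by blast
    moreover have yc: "y \<in> carrier E" using y(1) by (simp add: p.coinduced_carrier[OF Em])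
    moreover have "x = x \<ominus>\<^bsub>E\<^esub> y \<oplus>\<^bsub>E\<^esub> y" using x yc by (simp add: a_minus_def E.M.a_assoc E.M.l_neg)
    then have "f x = f (x \<ominus>\<^bsub>E\<^esub> y) \<oplus>\<^bsub>R\<^esub> f y"
      using mod_hom_add[OF f, of "x \<ominus>\<^bsub>E\<^esub> y" y] x yc by simp
    moreover have "f y \<in> carrier R" "f (x \<ominus>\<^bsub>E\<^esub> y) \<in> carrier R"
      using mod_hom_closed[OF f] x yc by simp_all
    ultimately show "r \<otimes>\<^bsub>R\<^esub> f x = \<zero>\<^bsub>R\<^esub>"
      using p.R.max_ideal_closed[OF r] by (simp add: p.R.r_distr)
  qed
qed

end

section \<open>The concrete fiber product as an instance of two projections\<close>

lemma (in field) field_local_ring: "local_ring R"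
proof (intro local_ring.intro local_ring_axioms.intro is_cring ex1I)
  show "maximalideal {\<zero>} R" by (rule zeromaximalideal)
  fix P assume "maximalideal P R"
  then interpret P: maximalideal P R .
  show "P = {\<zero>}" using all_ideals P.is_ideal P.I_notcarr by blast
qed

lemma (in field) max_ideal_field: "max_ideal R = {\<zero>}"
proof -
  interpret local_ring R by (rule field_local_ring)
  show ?thesis using ex1_maximalideal max_ideal zeromaximalideal by blast
qed

text \<open>An element s is completed to a pair because \<open>g\<close> is onto, and likewise for t
  with \<open>f\<close>. Elements of the maximal ideal of S or T go to zero in k, so they can be
  paired with zero.\<close>

lemma fiber_product_projections:
  fixes k :: "('k, 'z) ring_scheme"
  assumes R: "local_ring R" and S: "local_ring S" and T: "local_ring T" and k: "field k"
    and f: "f \<in> ring_hom S k" "f ` carrier S = carrier k"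
    and g: "g \<in> ring_hom T k" "g ` carrier T = carrier k"
    and \<phi>: "\<phi> \<in> ring_iso R (fiber_product S T f g)"
  shows "fiber_projections R S T (\<lambda>r. fst (\<phi> r)) (\<lambda>r. snd (\<phi> r))"
proof -
  interpret R: local_ring R by fact
  interpret S: local_ring S by fact
  interpret T: local_ring T by fact
  interpret k: field k by fact
  \<comment> \<open>The field k counts as a local ring with maximal ideal 0, so
    \<open>max_ideal_image_iff\<close> identifies the maximal ideals of S and T with the preimages
    of 0.\<close>
  interpret f: local_surjection S k f
    by (rule local_surjection.intro[OF S k.field_local_ring local_surjection_axioms.intro[OF f]])
  interpret g: local_surjection T k g
    by (rule local_surjection.intro[OF T k.field_local_ring local_surjection_axioms.intro[OF g]])
  note d = fiber_product_def RDirProd_def DirProd_def monoid.defs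
  have cF: "carrier (fiber_product S T f g) = {(s, t) \<in> carrier S \<times> carrier T. f s = g t}"
    by (simp add: fiber_product_def)
  have zF: "\<zero>\<^bsub>fiber_product S T f g\<^esub> = (\<zero>\<^bsub>S\<^esub>, \<zero>\<^bsub>T\<^esub>)" by (simp add: d)
  have \<phi>h: "\<phi> \<in> ring_hom R (fiber_product S T f g)"
    and \<phi>b: "bij_betw \<phi> (carrier R) (carrier (fiber_product S T f g))"
    using \<phi> by (simp_all add: ring_iso_def)
  have hit: "\<exists>r\<in>carrier R. \<phi> r = (s, t)" if "s \<in> carrier S" "t \<in> carrier T" "f s = g t" for s t
  proof -
    have "(s, t) \<in> \<phi> ` carrier R" using \<phi>b that cF by (simp add: bij_betw_def)
    then show ?thesis by (metis imageE)
  qed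
  have \<phi>c: "fst (\<phi> r) \<in> carrier S" "snd (\<phi> r) \<in> carrier T" if "r \<in> carrier R" for r
    using ring_hom_closed[OF \<phi>h that] by (auto simp: cF)
  have "(\<lambda>r. fst (\<phi> r)) \<in> ring_hom R S" "(\<lambda>r. snd (\<phi> r)) \<in> ring_hom R T"
    using \<phi>c ring_hom_mult[OF \<phi>h] ring_hom_add[OF \<phi>h] ring_hom_one[OF \<phi>h]
    by (auto intro!: ring_hom_memI simp: d split_beta)
  moreover have "s \<in> (\<lambda>r. fst (\<phi> r)) ` carrier R" if s: "s \<in> carrier S" for s
  proof -
    obtain t where "t \<in> carrier T" "g t = f s" using g.lift[of "f s"] s by auto
    then show ?thesis using hit[of s t] s by force
  qed
  moreover have "t \<in> (\<lambda>r. snd (\<phi> r)) ` carrier R" if t: "t \<in> carrier T" for t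
  proof -
    obtain s where "s \<in> carrier S" "f s = g t" using f.lift[of "g t"] t by auto
    then show ?thesis using hit[of s t] t by force
  qed
  moreover have "r = \<zero>\<^bsub>R\<^esub>" if "r \<in> carrier R" "fst (\<phi> r) = \<zero>\<^bsub>S\<^esub>" "snd (\<phi> r) = \<zero>\<^bsub>T\<^esub>" for r
  proof -
    \<comment> \<open>\<open>ring_hom\<close> mentions sums, products and one only. The vanishing of
      r is obtained from r + r = r, which holds because both coordinates are zero.\<close>
    have "\<phi> (r \<oplus>\<^bsub>R\<^esub> r) = \<phi> r" using ring_hom_add[OF \<phi>h that(1,1)] that(2,3)
      by (simp add: d split_beta prod_eq_iff)
    then have "r \<oplus>\<^bsub>R\<^esub> r = r" using \<phi>b that(1) by (simp add: bij_betw_def inj_on_def)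
    then show ?thesis using that(1) by simp
  qed
  moreover have "\<exists>r\<in>carrier R. fst (\<phi> r) = s \<and> snd (\<phi> r) = \<zero>\<^bsub>T\<^esub>" if s: "s \<in> max_ideal S" for s
  proof -
    have "f s = \<zero>\<^bsub>k\<^esub>" using f.max_ideal_image_iff[OF S.max_ideal_closed[OF s]] s k.max_ideal_field by simp
    then show ?thesis using hit[of s "\<zero>\<^bsub>T\<^esub>"] S.max_ideal_closed[OF s] by force
  qed
  moreover have "\<exists>r\<in>carrier R. fst (\<phi> r) = \<zero>\<^bsub>S\<^esub> \<and> snd (\<phi> r) = t" if t: "t \<in> max_ideal T" for t
  proof -
    have "g t = \<zero>\<^bsub>k\<^esub>" using g.max_ideal_image_iff[OF T.max_ideal_closed[OF t]] t k.max_ideal_field by simp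
    then show ?thesis using hit[of "\<zero>\<^bsub>S\<^esub>" t] T.max_ideal_closed[OF t] by force
  qed
  ultimately show ?thesis
    using \<phi>c R S T
    by (intro fiber_projections.intro local_surjection.intro local_surjection_axioms.intro
        fiber_projections_axioms.intro) auto
qed


section \<open>Quotients of Gorenstein rings\<close>

text \<open>Uniqueness of the envelope transfers the annihilation hypothesis from \<open>E\<close>
  to the module coinduced from S. The restriction of \<open>q\<close> to it is a functional, so q x
  q y = 0 for x in the maximal ideal of S and y in 0 : I, that is, x y lies in I.\<close>

lemma quotient_colon_subset:
  fixes S :: "('s, 'y) ring_scheme"
  assumes R: "local_ring R" and S: "artinian_local_ring S" and G: "gorenstein_ring S"
    and I: "ideal I S" and iso: "R \<simeq> S Quot I"
    and E: "injective_module R E" and e: "socle_generator R E e"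
    and ann: "annihilated_by (dual_module R E) (max_ideal R)"
  shows "max_ideal S \<cdot>\<^bsub>S\<^esub> colon_ideal S {\<zero>\<^bsub>S\<^esub>} I \<subseteq> I"
proof (rule ideal_prod_subset[OF I])
  interpret R: local_ring R by fact
  interpret S: artinian_local_ring S by fact
  interpret I: ideal I S by fact
  have Em: "module R E" using E by (simp add: injective_module_def)
  interpret Q: ring "S Quot I" by (rule I.quotient_is_ring)
  have "S Quot I \<simeq> R" using iso ring_iso_sym[OF R.ring_axioms] by blast
  then obtain \<psi> where \<psi>: "\<psi> \<in> ring_hom (S Quot I) R" "bij_betw \<psi> (carrier (S Quot I)) (carrier R)"
    by (auto simp: is_ring_iso_def ring_iso_def)
  \<comment> \<open>The projection S \<rightarrow> S/I followed by the isomorphism S/I \<rightarrow>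
    R.\<close>
  define q where "q s = \<psi> (I +>\<^bsub>S\<^esub> s)" for s
  have "q = \<psi> \<circ> (+>\<^bsub>S\<^esub>) I" by (simp add: q_def fun_eq_iff)
  then have "q \<in> ring_hom S R" using ring_hom_trans[OF I.rcos_ring_hom \<psi>(1)] by simp
  moreover have "q ` carrier S = carrier R"
  proof -
    have "q ` carrier S = \<psi> ` ((+>\<^bsub>S\<^esub>) I ` carrier S)" by (auto simp: q_def)
    also have "(+>\<^bsub>S\<^esub>) I ` carrier S = carrier (S Quot I)" by (auto simp: FactRing_simps)
    finally show ?thesis using \<psi>(2) by (simp add: bij_betw_def)
  qed
  ultimately interpret q: local_surjection S R q
    by (intro local_surjection.intro local_surjection_axioms.intro S.local_ring_axioms R)
  have ker: "s \<in> I" if s: "s \<in> carrier S" "q s = \<zero>\<^bsub>R\<^esub>" for s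
  proof -
    have "\<psi> \<zero>\<^bsub>S Quot I\<^esub> = \<zero>\<^bsub>R\<^esub>" by (rule ring_hom_zero[OF \<psi>(1) Q.ring_axioms R.ring_axioms])
    moreover have "I +>\<^bsub>S\<^esub> s \<in> carrier (S Quot I)" using s(1) by (auto simp: FactRing_simps)
    ultimately have "I +>\<^bsub>S\<^esub> s = \<zero>\<^bsub>S Quot I\<^esub>"
      using \<psi>(2) s(2) Q.zero_closed by (simp add: q_def bij_betw_def inj_on_def)
    then show ?thesis using I.a_rcos_self[OF s(1)] by (simp add: FactRing_def)
  qed
  have self: "module S (self_module S)" by (rule self_module_module[OF S.is_cring])
  have inj: "injective_module S (self_module S)" by (rule S.gorenstein_self_injective[OF G])
  obtain d where d: "socle_generator S (self_module S) d"
    using S.self_injective_socle_generator[OF inj] by blast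
  \<comment> \<open>An envelope of k over R made of the elements of S that ker q annihilates. By
    \<open>ker\<close>, every element of 0 : I is among them.\<close>
  let ?D = "coinduced_module S R q (self_module S)"
  have D: "module R ?D" by (rule q.coinduced_module_module[OF self])
  have Dc: "y \<in> carrier S" if "y \<in> carrier ?D" for y
    using that by (simp add: q.coinduced_carrier[OF self])
  have annD: "annihilated_by (dual_module R ?D) (max_ideal R)"
    using R.annihilated_by_dual_unique[OF E e q.coinduced_injective[OF inj]
        q.coinduced_socle_generator[OF self d]] ann by blast
  have qD: "(\<lambda>y\<in>carrier ?D. q y) \<in> mod_hom R ?D (self_module R)"
  proof (rule restrict_mod_hom[OF D])
    fix r y assume r: "r \<in> carrier R" and y: "y \<in> carrier ?D"
    obtain t where "t \<in> carrier S" "r = q t" using q.lift r by blast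
    then show "q (r \<odot>\<^bsub>?D\<^esub> y) = r \<odot>\<^bsub>self_module R\<^esub> q y"
      using Dc[OF y] by (simp add: q.coinduced_smult[OF self y])
  qed (use Dc in \<open>simp_all add: q.coinduced_simps[OF self]\<close>)
  fix x y assume x: "x \<in> max_ideal S" and y: "y \<in> colon_ideal S {\<zero>\<^bsub>S\<^esub>} I"
  have xc: "x \<in> carrier S" using x by (rule S.max_ideal_closed)
  have yc: "y \<in> carrier S" using y by (simp add: colon_ideal_def)
  have "r \<otimes>\<^bsub>S\<^esub> y = \<zero>\<^bsub>S\<^esub>" if "r \<in> carrier S" "q r = \<zero>\<^bsub>R\<^esub>" for r
    using y ker[OF that] that(1) yc by (simp add: colon_ideal_def S.m_comm[of r y])
  then have yD: "y \<in> carrier ?D" using yc by (simp add: q.coinduced_carrier[OF self])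
  have "q x \<in> max_ideal R" using x xc q.max_ideal_image_iff by simp
  then have "q x \<otimes>\<^bsub>R\<^esub> (\<lambda>y\<in>carrier ?D. q y) y = \<zero>\<^bsub>R\<^esub>"
    using annD qD yD unfolding annihilated_by_dual_iff by blast
  then have "q (x \<otimes>\<^bsub>S\<^esub> y) = \<zero>\<^bsub>R\<^esub>" using yD xc yc by simp
  then show "x \<otimes>\<^bsub>S\<^esub> y \<in> I" using ker xc yc by simp
qed

section \<open>The three statements for arbitrary choices of the envelopes\<close>

theorem theorem3:
  fixes R :: "'r ring" and E :: "('r, 'e) module"
  assumes "artinian_local_ring R"
    and "\<not> field R"
    and "injective_envelope R (residue_module R) E"
  shows
    "(\<not> gorenstein_ring R \<longrightarrow>
        (max_ideal R \<cdot>\<^bsub>R\<^esub> max_ideal R = {\<zero>\<^bsub>R\<^esub>} \<longleftrightarrow>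
         nearly_gorenstein R E \<and>
         ideal_smult R (max_ideal R) (dual_module R E) = {\<zero>\<^bsub>dual_module R E\<^esub>}))
     \<and>
     (ideal_smult R (max_ideal R) (dual_module R E) = {\<zero>\<^bsub>dual_module R E\<^esub>} \<longrightarrow>
        (\<forall>(S :: 's ring) I.
           artinian_local_ring S \<and> gorenstein_ring S \<and> ideal I S \<and> R \<simeq> S Quot I \<longrightarrow>
           max_ideal S \<cdot>\<^bsub>S\<^esub> colon_ideal S {\<zero>\<^bsub>S\<^esub>} I \<subseteq> I))
     \<and>
     (\<forall>(S :: 'u ring) (T :: 'v ring) (k :: 'k ring) \<pi>S \<pi>T
        (ES :: ('u, 'eu) module) (ET :: ('v, 'ev) module).
        artinian_local_ring S \<and> \<not> gorenstein_ring S \<and>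
        artinian_local_ring T \<and> \<not> gorenstein_ring T \<and>
        field k \<and>
        \<pi>S \<in> ring_hom S k \<and> \<pi>S ` carrier S = carrier k \<and>
        \<pi>T \<in> ring_hom T k \<and> \<pi>T ` carrier T = carrier k \<and>
        R \<simeq> fiber_product S T \<pi>S \<pi>T \<and>
        injective_envelope S (residue_module S) ES \<and>
        injective_envelope T (residue_module T) ET \<longrightarrow>
        (annihilated_by (dual_module R E) (max_ideal R) \<longleftrightarrow>
         annihilated_by (dual_module S ES) (max_ideal S) \<and>
         annihilated_by (dual_module T ET) (max_ideal T)))"
proof -
  interpret R: artinian_local_ring R by fact
  have E: "injective_module R E" using assms(3) by (simp add: injective_envelope_def)
  have Em: "module R E" using E by (simp add: injective_module_def)
  obtain e where e: "socle_generator R E e" using R.envelope_socle_generator[OF assms(3)] by blast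
  \<comment> \<open>Brings the two phrasings, a vanishing submodule and elementwise annihilation,
    into one form.\<close>
  have dual: "ideal_smult R (max_ideal R) (dual_module R E) = {\<zero>\<^bsub>dual_module R E\<^esub>} \<longleftrightarrow>
      annihilated_by (dual_module R E) (max_ideal R)"
    by (rule ideal_smult_eq_zero_iff[OF _ R.max_ideal_ideal])
      (simp add: dual_module_def Hom_module_module Em self_module_module R.is_cring)
  have ng: "nearly_gorenstein R E \<longleftrightarrow> max_ideal R \<subseteq> trace_ideal R E"
    using assms(1,3) by (simp add: nearly_gorenstein_def canonical_module_def)
  have a: "max_ideal R \<cdot>\<^bsub>R\<^esub> max_ideal R = {\<zero>\<^bsub>R\<^esub>} \<longleftrightarrow>
      nearly_gorenstein R E \<and> annihilated_by (dual_module R E) (max_ideal R)"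
    if G: "\<not> gorenstein_ring R"
  proof
    assume "max_ideal R \<cdot>\<^bsub>R\<^esub> max_ideal R = {\<zero>\<^bsub>R\<^esub>}"
    then have sq: "x \<otimes>\<^bsub>R\<^esub> y = \<zero>\<^bsub>R\<^esub>" if "x \<in> max_ideal R" "y \<in> max_ideal R" for x y
      using that R.max_ideal_square_zero_iff by blast
    \<comment> \<open>By \<open>G\<close> all functionals take values in m, and products of two
      elements of m vanish.\<close>
    then have "annihilated_by (dual_module R E) (max_ideal R)"
      using R.mod_hom_image_max_ideal[OF G E] by (auto simp: annihilated_by_dual_iff)
    then show "nearly_gorenstein R E \<and> annihilated_by (dual_module R E) (max_ideal R)"
      using R.square_zero_trace[OF E e sq] ng by blast
  next
    assume "nearly_gorenstein R E \<and> annihilated_by (dual_module R E) (max_ideal R)"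
    \<comment> \<open>m lies in the trace, and m annihilates the trace.\<close>
    then show "max_ideal R \<cdot>\<^bsub>R\<^esub> max_ideal R = {\<zero>\<^bsub>R\<^esub>}"
      using R.trace_annihilated[OF Em] ng R.max_ideal_square_zero_iff by blast
  qed
  have b: "max_ideal S \<cdot>\<^bsub>S\<^esub> colon_ideal S {\<zero>\<^bsub>S\<^esub>} I \<subseteq> I"
    if "annihilated_by (dual_module R E) (max_ideal R)" "artinian_local_ring S" "gorenstein_ring S"
      "ideal I S" "R \<simeq> S Quot I" for S :: "'s ring" and I
    using quotient_colon_subset[OF R.local_ring_axioms that(2-5) E e that(1)] .
  have c: "annihilated_by (dual_module R E) (max_ideal R) \<longleftrightarrow>
      annihilated_by (dual_module S ES) (max_ideal S) \<and> annihilated_by (dual_module T ET) (max_ideal T)"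
    if S: "artinian_local_ring S" "\<not> gorenstein_ring S"
      and T: "artinian_local_ring T" "\<not> gorenstein_ring T"
      and k: "field k" "\<pi>S \<in> ring_hom S k" "\<pi>S ` carrier S = carrier k"
        "\<pi>T \<in> ring_hom T k" "\<pi>T ` carrier T = carrier k"
      and iso: "R \<simeq> fiber_product S T \<pi>S \<pi>T"
      and ES: "injective_envelope S (residue_module S) ES"
      and ET: "injective_envelope T (residue_module T) ET"
    for S :: "'u ring" and T :: "'v ring" and k :: "'k ring" and \<pi>S \<pi>T
      and ES :: "('u, 'eu) module" and ET :: "('v, 'ev) module"
  proof -
    interpret S: artinian_local_ring S by fact
    interpret T: artinian_local_ring T by fact
    obtain \<phi> where "\<phi> \<in> ring_iso R (fiber_product S T \<pi>S \<pi>T)"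
      using iso by (auto simp: is_ring_iso_def)
    then interpret F: fiber_projections R S T "\<lambda>r. fst (\<phi> r)" "\<lambda>r. snd (\<phi> r)"
      by (intro fiber_product_projections[OF R.local_ring_axioms S.local_ring_axioms T.local_ring_axioms k])
    obtain d d' where "socle_generator S ES d" "socle_generator T ET d'"
      using S.envelope_socle_generator[OF ES] T.envelope_socle_generator[OF ET] by blast
    moreover have "injective_module S ES" "injective_module T ET"
      using ES ET by (simp_all add: injective_envelope_def)
    \<comment> \<open>The modules coinduced from \<open>E\<close> are injective with simple
      essential socle over S and T, so they may be exchanged for \<open>ES\<close> and
      \<open>ET\<close>.\<close>
    ultimately show ?thesis
      using F.dual_annihilated_iff[OF S(2) T(2) E e]
        S.annihilated_by_dual_unique[OF _ _ F.p.coinduced_injective[OF E] F.p.coinduced_socle_generator[OF Em e]]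
        T.annihilated_by_dual_unique[OF _ _ F.q.coinduced_injective[OF E] F.q.coinduced_socle_generator[OF Em e]]
      by metis
  qed
  show ?thesis
    unfolding dual
    by (intro conjI allI impI; (elim conjE)?) (rule a b c; assumption)+
qed

end
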